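(* Let $\omega$ be a non-quasianalytic weight function. Then the multiplication operator $M\colon\mathcal{O}_{M,\omega}(\mathbb{R}^N)\times\mathcal{S}'_\omega(\mathbb{R}^N)\to\mathcal{S}'_\omega(\mathbb{R}^N)$, $(f,T)\mapsto fT$, is separately continuous and hence a hypocontinuous bilinear mapping.
   Context: Weights. A non-quasianalytic weight function is a continuous increasing function $\omega:[0,\infty)\to[0,\infty)$ such that: ($\alpha$) there is $K\ge 1$ with $\omega(2t)\le K(1+\omega(t))$ for all $t\ge 0$; ($\beta$) $\int_1^\infty \frac{\omega(t)}{1+t^2}\,dt<\infty$; ($\gamma$) there are $a\in\mathbb{R}$, $b>0$ with $\omega(t)\ge a+b\log(1+t)$ for all $t\ge 0$; ($\delta$) $\varphi_\omega(t)=\omega(e^t)$ is convex. It is assumed (normalization) that $\omega$ vanishes on $[0,1]$. For $x\in\mathbb{R}^N$, $\omega(x):=\omega(|x|)$. The Young conjugate is $\varphi^*_\omega(s):=\sup_{t\ge 0}\{st-\varphi_\omega(t)\}$, $s\ge 0$ (the value $+\infty$ is allowed, with $\exp(-\infty)=0$). Spaces. $\mathcal{S}_\omega(\mathbb{R}^N)$ is the set of all $f\in L^1(\mathbb{R}^N)$ such that $f,\hat f\in C^\infty(\mathbb{R}^N)$ and $\|\exp(\lambda\omega)\partial^\alpha f\|_\infty<\infty$, $\|\exp(\lambda\omega)\partial^\alpha\hat f\|_\infty<\infty$ for all $\lambda>0$, $\alpha\in\mathbb{N}_0^N$; it is a Fréchet space with the norms $q_{m,n}(f):=\sup_{\alpha}\|\exp(n\omega)\partial^\alpha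 f\|_\infty\exp\left(-m\varphi^*_\omega\left(\frac{|\alpha|}{m}\right)\right)$, $m,n\in\mathbb{N}$. $\mathcal{S}'_\omega(\mathbb{R}^N)$ is its strong dual. For $m,n\in\mathbb{N}$ let $\mathcal{O}^m_{n,\omega}(\mathbb{R}^N)$ be the space of all $f\in C^\infty(\mathbb{R}^N)$ with $r_{m,n}(f):=\sup_{\alpha\in\mathbb{N}_0^N}\sup_{x\in\mathbb{R}^N}|\partial^\alpha f(x)|\exp\left(-n\omega(x)-m\varphi^*_\omega\left(\frac{|\alpha|}{m}\right)\right)<\infty$, with norm $r_{m,n}$. Set $\mathcal{O}_{M,\omega}(\mathbb{R}^N):=\bigcap_{m}\bigcup_{n}\mathcal{O}^m_{n,\omega}(\mathbb{R}^N)$ with the topology of the projective limit over $m$ of the locally convex inductive limits $\mathrm{ind}_{n}\,\mathcal{O}^m_{n,\omega}(\mathbb{R}^N)$. For $f\in\mathcal{O}_{M,\omega}(\mathbb{R}^N)$ one has $fg\in\mathcal{S}_\omega(\mathbb{R}^N)$ for all $g\in\mathcal{S}_\omega(\mathbb{R}^N)$, with $g\mapsto fg$ continuous; for $T\in\mathcal{S}'_\omega(\mathbb{R}^N)$, $fT$ is defined by $\langle fT,g\rangle:=\langle T,fg\rangle$, $g\in\mathcal{S}_\omega(\mathbb{R}^N)$. Hypocontinuity. A bilinear map $b\colon E\times F\to G$ between topological vector spaces is hypocontinuous if for every bounded $A\subset E$ the set $\{b(x,\cdot):x\in A\}$ is equicontinuous in $\mathcal{L}(F,G)$, and for every bounded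 $B\subset F$ the set $\{b(\cdot,y):y\in B\}$ is equicontinuous in $\mathcal{L}(E,G)$. *)

theory Defs
  imports "HOL-Analysis.Analysis" "HOL-Library.Function_Algebras"
begin

section \<open>Weight functions\<close>

definition nonquasianalytic_weight :: "(real \<Rightarrow> real) \<Rightarrow> bool" where
  "nonquasianalytic_weight \<omega> \<longleftrightarrow>
     continuous_on {0..} \<omega> \<and> mono_on {0..} \<omega> \<and> (\<forall>t\<ge>0. 0 \<le> \<omega> t) \<and>
     (\<exists>K\<ge>1. \<forall>t\<ge>0. \<omega> (2 * t) \<le> K * (1 + \<omega> t)) \<and>
     set_integrable lborel {1..} (\<lambda>t. \<omega> t / (1 + t\<^sup>2)) \<and>
     (\<exists>a. \<exists>b>0. \<forall>t\<ge>0. a + b * ln (1 + t) \<le> \<omega> t) \<and>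
     convex_on UNIV (\<lambda>t. \<omega> (exp t)) \<and>
     (\<forall>t\<in>{0..1}. \<omega> t = 0)"

definition young_conj :: "(real \<Rightarrow> real) \<Rightarrow> real \<Rightarrow> ereal" where
  "young_conj \<omega> s = (SUP t\<in>{0..}. ereal (s * t - \<omega> (exp t)))"

definition exp_ereal :: "ereal \<Rightarrow> ennreal" where
  "exp_ereal s = (case s of ereal r \<Rightarrow> ennreal (exp r) | PInfty \<Rightarrow> \<infinity> | MInfty \<Rightarrow> 0)"


section \<open>Smooth functions, multi-indices and the Fourier transform\<close>

definition partial_deriv :: "'n::finite \<Rightarrow> (real^'n \<Rightarrow> complex) \<Rightarrow> real^'n \<Rightarrow> complex" where
  "partial_deriv i f x = vector_derivative (\<lambda>t. f (x + t *\<^sub>R axis i 1)) (at 0)"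

primrec C_times :: "nat \<Rightarrow> (real^'n::finite \<Rightarrow> complex) \<Rightarrow> bool" where
  "C_times 0 f \<longleftrightarrow> continuous_on UNIV f"
| "C_times (Suc k) f \<longleftrightarrow> (\<forall>x. f differentiable at x) \<and> (\<forall>i. C_times k (partial_deriv i f))"

definition smooth :: "(real^'n::finite \<Rightarrow> complex) \<Rightarrow> bool" where
  "smooth f \<longleftrightarrow> (\<forall>k. C_times k f)"

text \<open>A multi-index is a function on the coordinate type. As this type carries no order, the partial
  derivatives are applied in the order of some fixed enumeration of it; on smooth functions, the only
  ones the operator is used for, the choice is immaterial by Schwarz's theorem.\<close>

definition coord_list :: "'n::finite list" where
  "coord_list = (SOME is. set is = UNIV \<and> distinct is)"

definition multi_deriv :: "('n::finite \<Rightarrow> nat) \<Rightarrow> (real^'n \<Rightarrow> complex) \<Rightarrow> real^'n \<Rightarrow> complex" where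
  "multi_deriv \<alpha> f = foldr (\<lambda>i. partial_deriv i ^^ \<alpha> i) coord_list f"

definition mi_length :: "('n::finite \<Rightarrow> nat) \<Rightarrow> nat" where
  "mi_length \<alpha> = (\<Sum>i\<in>UNIV. \<alpha> i)"

definition fourier :: "(real^'n::finite \<Rightarrow> complex) \<Rightarrow> real^'n \<Rightarrow> complex" where
  "fourier f \<xi> = (LINT x|lborel. f x * exp (- \<i> * complex_of_real (x \<bullet> \<xi>)))"


section \<open>Topological vector spaces of complex-valued functions\<close>

text \<open>All spaces below, duals included, are vector spaces of complex-valued functions with the
  pointwise operations. Such a topological vector space is represented by its topology alone;
  \<open>topspace\<close> is the underlying vector space.\<close>

definition cscale :: "complex \<Rightarrow> ('a \<Rightarrow> complex) \<Rightarrow> 'a \<Rightarrow> complex" where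
  "cscale c f = (\<lambda>z. c * f z)"

definition absolutely_convex :: "('a \<Rightarrow> complex) set \<Rightarrow> bool" where
  "absolutely_convex V \<longleftrightarrow>
     (\<forall>x\<in>V. \<forall>y\<in>V. \<forall>a b. norm a + norm b \<le> 1 \<longrightarrow> cscale a x + cscale b y \<in> V)"

definition seminorm_topology ::
    "('a \<Rightarrow> complex) set \<Rightarrow> (('a \<Rightarrow> complex) \<Rightarrow> ennreal) set \<Rightarrow> ('a \<Rightarrow> complex) topology" where
  "seminorm_topology E P = topology (\<lambda>U. U \<subseteq> E \<and>
     (\<forall>x\<in>U. \<exists>Q \<epsilon>. finite Q \<and> Q \<subseteq> P \<and> (0::real) < \<epsilon> \<and>
        {y\<in>E. \<forall>p\<in>Q. p (y - x) < ennreal \<epsilon>} \<subseteq> U))"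

text \<open>Locally convex inductive limit of an increasing family with respect to the inclusions: the
  absolutely convex subsets of the union that contain a zero neighbourhood of every step form a basis
  of zero neighbourhoods.\<close>

definition ind_limit_topology ::
    "'i set \<Rightarrow> ('i \<Rightarrow> ('a \<Rightarrow> complex) topology) \<Rightarrow> ('a \<Rightarrow> complex) topology" where
  "ind_limit_topology I T = topology (\<lambda>U. U \<subseteq> (\<Union>n\<in>I. topspace (T n)) \<and>
     (\<forall>x\<in>U. \<exists>V. V \<subseteq> (\<Union>n\<in>I. topspace (T n)) \<and> absolutely_convex V \<and>
        (\<forall>n\<in>I. \<exists>W. openin (T n) W \<and> 0 \<in> W \<and> W \<subseteq> V) \<and> (\<lambda>v. x + v) ` V \<subseteq> U))"

text \<open>Projective limit with respect to inclusions: the initial topology on the intersection.\<close>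

definition proj_limit_topology ::
    "'i set \<Rightarrow> ('i \<Rightarrow> ('a \<Rightarrow> complex) topology) \<Rightarrow> ('a \<Rightarrow> complex) topology" where
  "proj_limit_topology I T =
     topology_generated_by (\<Union>m\<in>I. {U \<inter> (\<Inter>m\<in>I. topspace (T m)) |U. openin (T m) U})"

definition tvs_bounded :: "('a \<Rightarrow> complex) topology \<Rightarrow> ('a \<Rightarrow> complex) set \<Rightarrow> bool" where
  "tvs_bounded E B \<longleftrightarrow> B \<subseteq> topspace E \<and>
     (\<forall>U. openin E U \<and> 0 \<in> U \<longrightarrow> (\<exists>\<rho>>0. \<forall>c. \<rho> \<le> norm c \<longrightarrow> B \<subseteq> cscale c ` U))"

text \<open>Functionals on \<open>E\<close> are extended by zero outside \<open>topspace E\<close>, so that they are determined by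
  their values on \<open>topspace E\<close> and closed under the pointwise operations.\<close>

definition dual_space :: "('a \<Rightarrow> complex) topology \<Rightarrow> (('a \<Rightarrow> complex) \<Rightarrow> complex) set" where
  "dual_space E = {u. (\<forall>f. f \<notin> topspace E \<longrightarrow> u f = 0) \<and>
     (\<forall>f\<in>topspace E. \<forall>g\<in>topspace E. u (f + g) = u f + u g) \<and>
     (\<forall>c. \<forall>f\<in>topspace E. u (cscale c f) = c * u f) \<and>
     continuous_map E euclidean u}"

definition strong_dual :: "('a \<Rightarrow> complex) topology \<Rightarrow> (('a \<Rightarrow> complex) \<Rightarrow> complex) topology" where
  "strong_dual E = seminorm_topology (dual_space E)
     {\<lambda>u. (SUP f\<in>B. ennreal (norm (u f))) |B. tvs_bounded E B}"

definition linear_map_on ::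
    "('a \<Rightarrow> complex) topology \<Rightarrow> ('b \<Rightarrow> complex) topology \<Rightarrow>
     (('a \<Rightarrow> complex) \<Rightarrow> ('b \<Rightarrow> complex)) \<Rightarrow> bool" where
  "linear_map_on E F h \<longleftrightarrow> h ` topspace E \<subseteq> topspace F \<and>
     (\<forall>x\<in>topspace E. \<forall>y\<in>topspace E. h (x + y) = h x + h y) \<and>
     (\<forall>c. \<forall>x\<in>topspace E. h (cscale c x) = cscale c (h x))"

definition bilinear_map_on ::
    "('a \<Rightarrow> complex) topology \<Rightarrow> ('b \<Rightarrow> complex) topology \<Rightarrow> ('c \<Rightarrow> complex) topology \<Rightarrow>
     (('a \<Rightarrow> complex) \<Rightarrow> ('b \<Rightarrow> complex) \<Rightarrow> ('c \<Rightarrow> complex)) \<Rightarrow> bool" where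
  "bilinear_map_on E F G b \<longleftrightarrow>
     (\<forall>x\<in>topspace E. linear_map_on F G (b x)) \<and>
     (\<forall>y\<in>topspace F. linear_map_on E G (\<lambda>x. b x y))"

definition separately_continuous ::
    "('a \<Rightarrow> complex) topology \<Rightarrow> ('b \<Rightarrow> complex) topology \<Rightarrow> ('c \<Rightarrow> complex) topology \<Rightarrow>
     (('a \<Rightarrow> complex) \<Rightarrow> ('b \<Rightarrow> complex) \<Rightarrow> ('c \<Rightarrow> complex)) \<Rightarrow> bool" where
  "separately_continuous E F G b \<longleftrightarrow>
     (\<forall>x\<in>topspace E. continuous_map F G (b x)) \<and>
     (\<forall>y\<in>topspace F. continuous_map E G (\<lambda>x. b x y))"

text \<open>Equicontinuity of a set of continuous linear maps; by linearity it is a condition at zero.\<close>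

definition equicontinuous_in ::
    "('a \<Rightarrow> complex) topology \<Rightarrow> ('b \<Rightarrow> complex) topology \<Rightarrow>
     (('a \<Rightarrow> complex) \<Rightarrow> ('b \<Rightarrow> complex)) set \<Rightarrow> bool" where
  "equicontinuous_in E F H \<longleftrightarrow>
     (\<forall>h\<in>H. linear_map_on E F h \<and> continuous_map E F h) \<and>
     (\<forall>V. openin F V \<and> 0 \<in> V \<longrightarrow> (\<exists>U. openin E U \<and> 0 \<in> U \<and> (\<forall>h\<in>H. h ` U \<subseteq> V)))"

definition hypocontinuous ::
    "('a \<Rightarrow> complex) topology \<Rightarrow> ('b \<Rightarrow> complex) topology \<Rightarrow> ('c \<Rightarrow> complex) topology \<Rightarrow>
     (('a \<Rightarrow> complex) \<Rightarrow> ('b \<Rightarrow> complex) \<Rightarrow> ('c \<Rightarrow> complex)) \<Rightarrow> bool" where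
  "hypocontinuous E F G b \<longleftrightarrow>
     (\<forall>A. tvs_bounded E A \<longrightarrow> equicontinuous_in F G (b ` A)) \<and>
     (\<forall>B. tvs_bounded F B \<longrightarrow> equicontinuous_in E G ((\<lambda>y x. b x y) ` B))"

lemma openin_seminorm_topology:
  "openin (seminorm_topology E P) U \<longleftrightarrow> U \<subseteq> E \<and>
     (\<forall>x\<in>U. \<exists>Q \<epsilon>. finite Q \<and> Q \<subseteq> P \<and> (0::real) < \<epsilon> \<and>
        {y\<in>E. \<forall>p\<in>Q. p (y - x) < ennreal \<epsilon>} \<subseteq> U)"
proof -
  have "istopology (\<lambda>U. U \<subseteq> E \<and>
     (\<forall>x\<in>U. \<exists>Q \<epsilon>. finite Q \<and> Q \<subseteq> P \<and> (0::real) < \<epsilon> \<and>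
        {y\<in>E. \<forall>p\<in>Q. p (y - x) < ennreal \<epsilon>} \<subseteq> U))" (is "istopology ?O")
    unfolding istopology_def
  proof (intro conjI allI impI)
    fix S T assume S: "?O S" and T: "?O T"
    show "S \<inter> T \<subseteq> E" using S by auto
    show "\<forall>x\<in>S \<inter> T. \<exists>Q \<epsilon>. finite Q \<and> Q \<subseteq> P \<and> (0::real) < \<epsilon> \<and>
        {y\<in>E. \<forall>p\<in>Q. p (y - x) < ennreal \<epsilon>} \<subseteq> S \<inter> T"
    proof
      fix x assume x: "x \<in> S \<inter> T"
      obtain Q1 e1 where 1: "finite Q1" "Q1 \<subseteq> P" "(0::real) < e1"
        "{y\<in>E. \<forall>p\<in>Q1. p (y - x) < ennreal e1} \<subseteq> S" using S x by blast
      obtain Q2 e2 where 2: "finite Q2" "Q2 \<subseteq> P" "(0::real) < e2"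
        "{y\<in>E. \<forall>p\<in>Q2. p (y - x) < ennreal e2} \<subseteq> T" using T x by blast
      have *: "z < ennreal e1" "z < ennreal e2" if "z < ennreal (min e1 e2)" for z
        using that by (meson ennreal_leI min.cobounded1 min.cobounded2 order_less_le_trans)+
      have "{y\<in>E. \<forall>p\<in>Q1 \<union> Q2. p (y - x) < ennreal (min e1 e2)} \<subseteq> S \<inter> T"
        using 1(4) 2(4) * by blast
      then show "\<exists>Q \<epsilon>. finite Q \<and> Q \<subseteq> P \<and> (0::real) < \<epsilon> \<and>
        {y\<in>E. \<forall>p\<in>Q. p (y - x) < ennreal \<epsilon>} \<subseteq> S \<inter> T"
        using 1 2 by (intro exI[of _ "Q1 \<union> Q2"] exI[of _ "min e1 e2"]) auto
    qed
  next
    fix \<K> assume K: "\<forall>S\<in>\<K>. ?O S"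
    show "\<Union>\<K> \<subseteq> E" using K by auto
    show "\<forall>x\<in>\<Union>\<K>. \<exists>Q \<epsilon>. finite Q \<and> Q \<subseteq> P \<and> (0::real) < \<epsilon> \<and>
        {y\<in>E. \<forall>p\<in>Q. p (y - x) < ennreal \<epsilon>} \<subseteq> \<Union>\<K>"
      using K by (meson Union_iff Union_upper order_trans)
  qed
  then show ?thesis by (simp add: seminorm_topology_def)
qed

lemma absolutely_convex_Int:
  "absolutely_convex V \<Longrightarrow> absolutely_convex W \<Longrightarrow> absolutely_convex (V \<inter> W)"
  by (simp add: absolutely_convex_def)

lemma openin_ind_limit_topology:
  "openin (ind_limit_topology I T) U \<longleftrightarrow> U \<subseteq> (\<Union>n\<in>I. topspace (T n)) \<and>
     (\<forall>x\<in>U. \<exists>V. V \<subseteq> (\<Union>n\<in>I. topspace (T n)) \<and> absolutely_convex V \<and>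
        (\<forall>n\<in>I. \<exists>W. openin (T n) W \<and> 0 \<in> W \<and> W \<subseteq> V) \<and> (\<lambda>v. x + v) ` V \<subseteq> U)"
proof -
  define E where "E = (\<Union>n\<in>I. topspace (T n))"
  define N where "N V \<longleftrightarrow> V \<subseteq> E \<and> absolutely_convex V \<and>
    (\<forall>n\<in>I. \<exists>W. openin (T n) W \<and> 0 \<in> W \<and> W \<subseteq> V)" for V
  have N_Int: "N (V \<inter> W)" if V: "N V" and W: "N W" for V W
    unfolding N_def
  proof (intro conjI ballI)
    show "V \<inter> W \<subseteq> E" "absolutely_convex (V \<inter> W)"
      using V W by (auto simp: N_def intro: absolutely_convex_Int)
    fix n assume n: "n \<in> I"
    obtain A where A: "openin (T n) A" "0 \<in> A" "A \<subseteq> V" using V n unfolding N_def by blast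
    obtain B where B: "openin (T n) B" "0 \<in> B" "B \<subseteq> W" using W n unfolding N_def by blast
    show "\<exists>C. openin (T n) C \<and> 0 \<in> C \<and> C \<subseteq> V \<inter> W"
      using A B by (intro exI[of _ "A \<inter> B"]) auto
  qed
  have "istopology (\<lambda>U. U \<subseteq> E \<and> (\<forall>x\<in>U. \<exists>V. N V \<and> (\<lambda>v. x + v) ` V \<subseteq> U))"
    (is "istopology ?O")
    unfolding istopology_def
  proof (intro conjI allI impI)
    fix A B assume A: "?O A" and B: "?O B"
    show "A \<inter> B \<subseteq> E" using A by auto
    show "\<forall>x\<in>A \<inter> B. \<exists>V. N V \<and> (\<lambda>v. x + v) ` V \<subseteq> A \<inter> B"
    proof
      fix x assume x: "x \<in> A \<inter> B"
      obtain V where V: "N V" "(\<lambda>v. x + v) ` V \<subseteq> A" using A x by blast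
      obtain W where W: "N W" "(\<lambda>v. x + v) ` W \<subseteq> B" using B x by blast
      show "\<exists>V. N V \<and> (\<lambda>v. x + v) ` V \<subseteq> A \<inter> B"
        using V W N_Int by (intro exI[of _ "V \<inter> W"]) auto
    qed
  next
    fix \<K> assume K: "\<forall>S\<in>\<K>. ?O S"
    show "\<Union>\<K> \<subseteq> E" using K by auto
    show "\<forall>x\<in>\<Union>\<K>. \<exists>V. N V \<and> (\<lambda>v. x + v) ` V \<subseteq> \<Union>\<K>"
      using K by (meson Union_iff Union_upper order_trans)
  qed
  then show ?thesis
    by (simp add: ind_limit_topology_def E_def N_def conj_assoc)
qed


section \<open>The spaces\<close>

text \<open>Since the functions concerned are continuous, \<open>L\<close>-infinity norms are plain suprema. The
  extended nonnegative reals are used for all norms, so that finiteness is meaningful. The indices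
  \<open>m\<close> and \<open>n\<close> of the norms range over the positive integers.\<close>

definition wsup :: "(real \<Rightarrow> real) \<Rightarrow> real \<Rightarrow> (real^'n::finite \<Rightarrow> complex) \<Rightarrow> ennreal" where
  "wsup \<omega> l f = (SUP x. ennreal (exp (l * \<omega> (norm x)) * norm (f x)))"

definition S_space :: "(real \<Rightarrow> real) \<Rightarrow> (real^'n::finite \<Rightarrow> complex) set" where
  "S_space \<omega> = {f. integrable lborel f \<and> smooth f \<and> smooth (fourier f) \<and>
     (\<forall>l>0. \<forall>\<alpha>. wsup \<omega> l (multi_deriv \<alpha> f) < \<infinity> \<and> wsup \<omega> l (multi_deriv \<alpha> (fourier f)) < \<infinity>)}"

definition q_norm :: "(real \<Rightarrow> real) \<Rightarrow> nat \<Rightarrow> nat \<Rightarrow> (real^'n::finite \<Rightarrow> complex) \<Rightarrow> ennreal" where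
  "q_norm \<omega> m n f = (SUP \<alpha>. wsup \<omega> (real n) (multi_deriv \<alpha> f) *
     exp_ereal (- (ereal (real m) * young_conj \<omega> (real (mi_length \<alpha>) / real m))))"

definition S_top :: "(real \<Rightarrow> real) \<Rightarrow> (real^'n::finite \<Rightarrow> complex) topology" where
  "S_top \<omega> = seminorm_topology (S_space \<omega>) {q_norm \<omega> m n |m n. 1 \<le> m \<and> 1 \<le> n}"

definition r_norm :: "(real \<Rightarrow> real) \<Rightarrow> nat \<Rightarrow> nat \<Rightarrow> (real^'n::finite \<Rightarrow> complex) \<Rightarrow> ennreal" where
  "r_norm \<omega> m n f = (SUP \<alpha>. SUP x. ennreal (norm (multi_deriv \<alpha> f x)) *
     exp_ereal (- ereal (real n * \<omega> (norm x))
       - ereal (real m) * young_conj \<omega> (real (mi_length \<alpha>) / real m)))"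

definition O_step_space ::
    "(real \<Rightarrow> real) \<Rightarrow> nat \<Rightarrow> nat \<Rightarrow> (real^'n::finite \<Rightarrow> complex) set" where
  "O_step_space \<omega> m n = {f. smooth f \<and> r_norm \<omega> m n f < \<infinity>}"

definition O_step_top ::
    "(real \<Rightarrow> real) \<Rightarrow> nat \<Rightarrow> nat \<Rightarrow> (real^'n::finite \<Rightarrow> complex) topology" where
  "O_step_top \<omega> m n = seminorm_topology (O_step_space \<omega> m n) {r_norm \<omega> m n}"

definition OM_top :: "(real \<Rightarrow> real) \<Rightarrow> (real^'n::finite \<Rightarrow> complex) topology" where
  "OM_top \<omega> = proj_limit_topology {1..} (\<lambda>m. ind_limit_topology {1..} (O_step_top \<omega> m))"

definition mult_op :: "(real \<Rightarrow> real) \<Rightarrow> (real^'n::finite \<Rightarrow> complex) \<Rightarrow>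
    ((real^'n \<Rightarrow> complex) \<Rightarrow> complex) \<Rightarrow> (real^'n \<Rightarrow> complex) \<Rightarrow> complex" where
  "mult_op \<omega> f T = (\<lambda>g. if g \<in> S_space \<omega> then T (f * g) else 0)"

end

theory Submission
  imports Defs "HOL-Library.Sublist" "HOL-Probability.Characteristic_Functions"
begin

text \<open>The Young conjugate enters only through \<open>W\<^sub>m(k) = exp (- m \<phi>\<^sup>*(k / m)) = inf\<^bsub>t \<ge> 1\<^esub> exp (m
  \<omega>(t)) / t\<^sup>k\<close>, for which \<open>W\<^sub>m(j + k) \<le> W\<^sub>m(j) W\<^sub>m(k)\<close> and \<open>2\<^sup>k W\<^sub>m(k) \<le> C W\<^bsub>m'\<^esub>(k)\<close>; with the
  Leibniz rule these give \<open>q\<^bsub>m,n\<^esub>(f g) \<le> C r\<^bsub>m',n'\<^esub>(f) q\<^bsub>m',n + n'\<^esub>(g)\<close> with \<open>m'\<close> independent of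
  \<open>n'\<close>. To make use of this, \<open>S\<^sub>\<omega>\<close> has to be identified with the smooth functions all of whose norms
  \<open>q\<^bsub>m,n\<^esub>\<close> are finite. That these norms control the Fourier transform follows by integration by
  parts. Conversely, Fourier inversion bounds \<open>W\<^sub>m(|\<alpha>|) \<partial>\<^sup>\<alpha>g\<close> globally, and Landau's inequality on
  half-lines interpolates this with the decay of \<open>g\<close>.

  By the product estimate \<open>f \<mapsto> sup\<^bsub>g \<in> X\<^esub> q\<^bsub>m,n\<^esub>(f g)\<close> is a continuous seminorm on the multipliers
  for every bounded set \<open>X\<close> of test functions. So the product of two bounded sets is bounded, which
  settles uniformity in \<open>f\<close>, and, as strongly bounded sets of functionals on a metrizable space are
  equicontinuous, uniformity in \<open>T\<close>.\<close>

section \<open>Weights\<close>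

text \<open>Membership in the space of test functions bounds each derivative separately, with
  constants that may depend on the multi-index in any way, whereas \<open>q_norm\<close> takes a
  supremum over all multi-indices against weights. The product estimate is of no use before that gap
  is closed. The only slack in the weights is a change of \<open>m\<close>, which is guaranteed to
  absorb factors \<open>C ^ k\<close> only; hence every constant on the way, from the number of
  Leibniz terms to the interpolation inequality, has to be geometric in the order of
  differentiation.

  Deducing hypocontinuity from separate continuity would call for barrelledness of both factors,
  which is delicate for a projective limit of inductive limits. Equicontinuity is therefore proved
  directly from neighbourhood estimates, and separate continuity from the same estimates with
  singletons in place of bounded sets. A basic neighbourhood in the projective limit restricts
  finitely many \<open>m\<close>, but for each of them it has to be a neighbourhood in every step
  \<open>n'\<close>; this dictates the order of quantifiers in the product estimate.\<close>

locale weight =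
  fixes \<omega> :: "real \<Rightarrow> real"
  assumes nonquasianalytic: "nonquasianalytic_weight \<omega>"
begin

section \<open>Growth properties of the weight\<close>

lemma weight_nonneg: "0 \<le> t \<Longrightarrow> 0 \<le> \<omega> t"
  using nonquasianalytic by (auto simp: nonquasianalytic_weight_def)

lemma weight_mono: "0 \<le> s \<Longrightarrow> s \<le> t \<Longrightarrow> \<omega> s \<le> \<omega> t"
  using nonquasianalytic by (auto simp: nonquasianalytic_weight_def mono_on_def)

lemma weight_zero: "0 \<le> t \<Longrightarrow> t \<le> 1 \<Longrightarrow> \<omega> t = 0"
  using nonquasianalytic by (auto simp: nonquasianalytic_weight_def)

text \<open>The constant is rounded up to a natural number so that expressions such as
  \<open>m + m * K\<close> are again admissible indices of the norms.\<close>

lemma weight_double: "\<exists>K::nat. \<forall>t\<ge>0. \<omega> (2 * t) \<le> real K * (1 + \<omega> t)"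
proof -
  obtain K where K: "\<And>t. 0 \<le> t \<Longrightarrow> \<omega> (2 * t) \<le> K * (1 + \<omega> t)"
    using nonquasianalytic by (auto simp: nonquasianalytic_weight_def)
  show ?thesis
  proof (intro exI[of _ "nat \<lceil>K\<rceil>"] allI impI)
    fix t :: real assume t: "0 \<le> t"
    have "K * (1 + \<omega> t) \<le> real (nat \<lceil>K\<rceil>) * (1 + \<omega> t)"
      using weight_nonneg[OF t] by (intro mult_right_mono) linarith+
    with K[OF t] show "\<omega> (2 * t) \<le> real (nat \<lceil>K\<rceil>) * (1 + \<omega> t)" by linarith
  qed
qed

lemma weight_dilate: "\<exists>C::nat. \<forall>t\<ge>0. \<omega> (2 ^ r * t) \<le> real C * (1 + \<omega> t)"
proof (induction r)
  case 0
  then show ?case by (intro exI[of _ 1]) auto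
next
  case (Suc r)
  obtain K :: nat where K: "\<And>t. 0 \<le> t \<Longrightarrow> \<omega> (2 * t) \<le> real K * (1 + \<omega> t)"
    using weight_double by blast
  from Suc obtain C :: nat where C: "\<And>t. 0 \<le> t \<Longrightarrow> \<omega> (2 ^ r * t) \<le> real C * (1 + \<omega> t)" by auto
  show ?case
  proof (intro exI[of _ "K + K * C"] allI impI)
    fix t :: real assume t: "0 \<le> t"
    have "\<omega> (2 ^ Suc r * t) = \<omega> (2 * (2 ^ r * t))" by (simp add: mult.assoc)
    also have "\<dots> \<le> real K * (1 + \<omega> (2 ^ r * t))" using K t by simp
    also have "\<dots> \<le> real K * (1 + real C * (1 + \<omega> t))"
      using C[OF t] by (intro mult_left_mono) auto
    also have "\<dots> \<le> real (K + K * C) * (1 + \<omega> t)"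
      using weight_nonneg[OF t] by (simp add: algebra_simps)
    finally show "\<omega> (2 ^ Suc r * t) \<le> real (K + K * C) * (1 + \<omega> t)" .
  qed
qed

text \<open>Condition (\<gamma>) in exponential form: polynomial factors cost no more than an
  increase of the index of the exponential weight.\<close>

lemma weight_log: obtains p :: nat and C :: real
  where "0 < C" "\<And>t. 0 \<le> t \<Longrightarrow> 1 + t \<le> C * exp (real p * \<omega> t)"
proof -
  obtain a b where ab: "b > 0" "\<And>t. 0 \<le> t \<Longrightarrow> a + b * ln (1 + t) \<le> \<omega> t"
    using nonquasianalytic by (auto simp: nonquasianalytic_weight_def)
  define p where "p = nat \<lceil>1 / b\<rceil>"
  have p: "1 / b \<le> real p" unfolding p_def by linarith
  show ?thesis
  proof
    show "0 < exp (- a / b)" by simp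
    fix t :: real assume t: "0 \<le> t"
    have "ln (1 + t) \<le> - a / b + (1 / b) * \<omega> t"
      using ab(2)[OF t] ab(1) by (simp add: field_simps)
    also have "\<dots> \<le> - a / b + real p * \<omega> t"
      using mult_right_mono[OF p weight_nonneg[OF t]] by simp
    finally have "exp (ln (1 + t)) \<le> exp (- a / b + real p * \<omega> t)" by simp
    then show "1 + t \<le> exp (- a / b) * exp (real p * \<omega> t)"
      using t unfolding exp_add by simp
  qed
qed

lemma weight_log_power: "\<exists>p::nat. \<exists>C>0. \<forall>t\<ge>0. (1 + t) ^ k \<le> C * exp (real p * \<omega> t)"
proof -
  obtain p C where pC: "0 < C" "\<And>t. 0 \<le> t \<Longrightarrow> 1 + t \<le> C * exp (real p * \<omega> t)"
    by (rule weight_log) blast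
  show ?thesis
  proof (intro exI[of _ "p * k"] exI[of _ "C ^ k"] conjI allI impI)
    show "C ^ k > 0" using pC by simp
    fix t :: real assume t: "0 \<le> t"
    have "(1 + t) ^ k \<le> (C * exp (real p * \<omega> t)) ^ k"
      using pC(2)[OF t] t by (intro power_mono) auto
    also have "\<dots> = C ^ k * exp (real (p * k) * \<omega> t)"
      by (simp add: power_mult_distrib exp_of_nat_mult[symmetric] mult_ac)
    finally show "(1 + t) ^ k \<le> C ^ k * exp (real (p * k) * \<omega> t)" .
  qed
qed

text \<open>\<open>winf m k\<close> is \<open>exp (- m \<phi>\<^sup>*(k / m))\<close>, which unlike the Young conjugate is always finite; the
  substitution \<open>t = exp \<tau>\<close> turns the supremum over \<open>\<tau>\<close> into an infimum over \<open>t\<close>.\<close>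

definition winf :: "nat \<Rightarrow> nat \<Rightarrow> real" where
  "winf m k = (INF t\<in>{1..}. exp (real m * \<omega> t) / t ^ k)"

lemma winf_le: "1 \<le> t \<Longrightarrow> winf m k \<le> exp (real m * \<omega> t) / t ^ k"
  unfolding winf_def by (rule cINF_lower) (auto intro!: bdd_belowI2[of _ 0])

lemma winf_ge: "(\<And>t. 1 \<le> t \<Longrightarrow> c \<le> exp (real m * \<omega> t) / t ^ k) \<Longrightarrow> c \<le> winf m k"
  unfolding winf_def by (rule cINF_greatest) auto

lemma winf_nonneg: "0 \<le> winf m k"
  by (rule winf_ge) auto

lemma winf_le_1: "winf m k \<le> 1"
  using winf_le[of 1 m k] weight_zero[of 1] by simp

lemma winf_0 [simp]: "winf m 0 = 1"
  using weight_nonneg by (intro antisym winf_le_1 winf_ge) auto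

lemma winf_mono: "m \<le> m' \<Longrightarrow> winf m k \<le> winf m' k"
proof (rule winf_ge)
  fix t :: real assume t: "1 \<le> t" and m: "m \<le> m'"
  have "exp (real m * \<omega> t) \<le> exp (real m' * \<omega> t)"
    using m weight_nonneg[of t] t by (simp add: mult_right_mono)
  then show "winf m k \<le> exp (real m' * \<omega> t) / t ^ k"
    using t by (intro order_trans[OF winf_le[OF t]] divide_right_mono) auto
qed

text \<open>The infimum on the left is tested at \<open>max s t\<close>: there the weight is at most
  \<open>\<omega> t + \<omega> s\<close>, while the power is at least \<open>t ^ j * s ^ k\<close>.
  In the Leibniz rule this distributes the weight of a word over its two parts.\<close>

lemma winf_add_le: "winf m (j + k) \<le> winf m j * winf m k"
proof -
  have *: "winf m (j + k) \<le> (exp (real m * \<omega> t) / t ^ j) * (exp (real m * \<omega> s) / s ^ k)"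
    if t: "1 \<le> t" and s: "1 \<le> s" for t s
  proof -
    define u where "u = max s t"
    have u: "1 \<le> u" using t s by (auto simp: u_def)
    have "exp (real m * \<omega> u) \<le> exp (real m * \<omega> t) * exp (real m * \<omega> s)"
      using t s weight_nonneg[of t] weight_nonneg[of s]
      by (auto simp: u_def max_def exp_add[symmetric])
    moreover have "t ^ j * s ^ k \<le> u ^ (j + k)"
      unfolding power_add using t s by (intro mult_mono power_mono) (auto simp: u_def)
    moreover have "0 < t ^ j * s ^ k" using t s by auto
    ultimately have "exp (real m * \<omega> u) / u ^ (j + k) \<le>
        (exp (real m * \<omega> t) * exp (real m * \<omega> s)) / (t ^ j * s ^ k)"
      by (intro frac_le) auto
    then show ?thesis using winf_le[OF u, of m "j + k"] by simp
  qed
  \<comment> \<open>The infima over \<open>s\<close> and over \<open>t\<close> are taken one after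
    the other, each time after dividing by the factor that is kept fixed.\<close>
  have **: "winf m (j + k) \<le> (exp (real m * \<omega> t) / t ^ j) * winf m k" if t: "1 \<le> t" for t
  proof -
    have pos: "0 < exp (real m * \<omega> t) / t ^ j" using t by simp
    have "winf m (j + k) / (exp (real m * \<omega> t) / t ^ j) \<le> winf m k"
    proof (rule winf_ge)
      fix s :: real assume "1 \<le> s"
      from *[OF t this] show "winf m (j + k) / (exp (real m * \<omega> t) / t ^ j) \<le> exp (real m * \<omega> s) / s ^ k"
        using pos by (subst pos_divide_le_eq) (simp_all add: mult_ac)
    qed
    then show ?thesis using pos by (subst (asm) pos_divide_le_eq) (simp_all add: mult_ac)
  qed
  show ?thesis
  \<comment> \<open>The value zero does occur, namely where the Young conjugate is infinite, so the
    division needs this case distinction.\<close>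
  proof (cases "winf m k = 0")
    case True
    then show ?thesis using **[of 1] by simp
  next
    case False
    then have pos: "0 < winf m k" using winf_nonneg[of m k] by simp
    have "winf m (j + k) / winf m k \<le> winf m j"
      by (rule winf_ge) (use pos ** in \<open>simp add: pos_divide_le_eq\<close>)
    then show ?thesis using pos by (simp add: pos_divide_le_eq)
  qed
qed

text \<open>The partner of the square root in Landau's inequality: doubling \<open>m\<close> makes
  up for taking a geometric mean of two weighted bounds.\<close>

lemma winf_square_le: "(winf m k)\<^sup>2 \<le> winf (2 * m) (2 * k)"
proof (rule winf_ge)
  fix t :: real assume t: "1 \<le> t"
  have "(winf m k)\<^sup>2 \<le> (exp (real m * \<omega> t) / t ^ k)\<^sup>2"
    by (intro power_mono winf_le t winf_nonneg)
  also have "\<dots> = exp (real (2 * m) * \<omega> t) / t ^ (2 * k)"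
    by (simp add: power_divide power_mult[symmetric] exp_of_nat_mult[symmetric] mult_ac
        exp_double[symmetric])
  finally show "(winf m k)\<^sup>2 \<le> exp (real (2 * m) * \<omega> t) / t ^ (2 * k)" .
qed

text \<open>Testing the infimum at \<open>2 * t\<close> gains the factor \<open>2 ^ k\<close>, and
  condition (\<alpha>) bounds \<open>\<omega> (2 * t)\<close> by a multiple of
  \<open>1 + \<omega> t\<close>, which enlarges \<open>m\<close> and produces the constant.\<close>

lemma winf_pow2: "\<exists>C>0. \<exists>m'\<ge>m. \<forall>k. 2 ^ k * winf m k \<le> C * winf m' k"
proof -
  obtain K :: nat where K: "\<And>t. 0 \<le> t \<Longrightarrow> \<omega> (2 * t) \<le> real K * (1 + \<omega> t)"
    using weight_double by blast
  have "2 ^ k * winf m k \<le> exp (real (m * K)) * winf (m + m * K) k" for k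
  proof -
    have "2 ^ k * winf m k / exp (real (m * K)) \<le> winf (m + m * K) k"
    proof (rule winf_ge)
      fix t :: real assume t: "1 \<le> t"
      have "2 ^ k * winf m k \<le> 2 ^ k * (exp (real m * \<omega> (2 * t)) / (2 * t) ^ k)"
        using t by (intro mult_left_mono winf_le) auto
      also have "\<dots> = exp (real m * \<omega> (2 * t)) / t ^ k" using t by (simp add: power_mult_distrib)
      also have "\<dots> \<le> exp (real m * (real K * (1 + \<omega> t))) / t ^ k"
        using t K[of t] by (intro divide_right_mono) (auto intro!: mult_left_mono)
      also have "\<dots> \<le> exp (real (m * K) + real (m + m * K) * \<omega> t) / t ^ k"
        using t weight_nonneg[of t] by (intro divide_right_mono) (auto simp: algebra_simps)
      finally show "2 ^ k * winf m k / exp (real (m * K)) \<le> exp (real (m + m * K) * \<omega> t) / t ^ k"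
        unfolding exp_add using t by (simp add: field_simps)
    qed
    then show ?thesis by (simp add: field_simps)
  qed
  then show ?thesis by (intro exI[of _ "exp (real (m * K))"] conjI exI[of _ "m + m * K"]) auto
qed

text \<open>Iterating \<open>winf_pow2\<close> absorbs any geometric factor, in particular the one
  from Landau's inequality.\<close>

lemma winf_power:
  fixes c :: real
  assumes "0 \<le> c"
  shows "\<exists>C>0. \<exists>m'\<ge>m. \<forall>k. c ^ k * winf m k \<le> C * winf m' k"
proof -
  have *: "\<exists>C>0. \<exists>m'\<ge>m. \<forall>k. (2 ^ r) ^ k * winf m k \<le> C * winf m' k" for r
  proof (induction r)
    case 0
    then show ?case by (intro exI[of _ 1] conjI exI[of _ m]) auto
  next
    case (Suc r)
    then obtain C m' where C: "0 < C" "m \<le> m'" "\<And>k. (2 ^ r) ^ k * winf m k \<le> C * winf m' k"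
      by auto
    obtain D m'' where D: "0 < D" "m' \<le> m''" "\<And>k. 2 ^ k * winf m' k \<le> D * winf m'' k"
      using winf_pow2[of m'] by auto
    have "(2 ^ Suc r) ^ k * winf m k \<le> (C * D) * winf m'' k" for k
    proof -
      have "(2 ^ Suc r) ^ k * winf m k = 2 ^ k * ((2 ^ r) ^ k * winf m k)"
        by (simp add: power_mult_distrib)
      also have "\<dots> \<le> 2 ^ k * (C * winf m' k)" by (intro mult_left_mono C) auto
      also have "\<dots> = C * (2 ^ k * winf m' k)" by simp
      also have "\<dots> \<le> C * (D * winf m'' k)" using C by (intro mult_left_mono D) auto
      finally show ?thesis by simp
    qed
    then show ?case using C D by (intro exI[of _ "C * D"] conjI exI[of _ m'']) auto
  qed
  obtain r :: nat where r: "c \<le> 2 ^ r" using real_arch_pow[of 2 c] by (auto intro: less_imp_le)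
  obtain C m' where C: "0 < C" "m \<le> m'" "\<And>k. (2 ^ r) ^ k * winf m k \<le> C * winf m' k"
    using *[of r] by auto
  have "c ^ k * winf m k \<le> C * winf m' k" for k
    using assms r by (intro order_trans[OF mult_right_mono C(3)] power_mono winf_nonneg)
  then show ?thesis using C by auto
qed

text \<open>A bound weighted by \<open>winf m k\<close> says nothing about derivatives of order
  \<open>k\<close> if this number vanishes. By the logarithmic lower bound on the weight it is
  positive once \<open>m\<close> is large in comparison with \<open>k\<close>.\<close>

lemma winf_pos: "\<exists>m0. \<forall>m\<ge>m0. 0 < winf m k"
proof -
  obtain p C where pC: "C > 0" "\<And>t. 0 \<le> t \<Longrightarrow> (1 + t) ^ k \<le> C * exp (real p * \<omega> t)"
    using weight_log_power[of k] by blast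
  have "0 < winf m k" if m: "p \<le> m" for m
  proof -
    have "1 / C \<le> winf p k"
    proof (rule winf_ge)
      fix t :: real assume t: "1 \<le> t"
      have "t ^ k \<le> (1 + t) ^ k" using t by (intro power_mono) auto
      also have "\<dots> \<le> C * exp (real p * \<omega> t)" using pC(2)[of t] t by simp
      finally show "1 / C \<le> exp (real p * \<omega> t) / t ^ k" using pC(1) t by (simp add: field_simps)
    qed
    with winf_mono[OF m, of k] pC(1) show ?thesis
      by (meson less_le_trans zero_less_divide_1_iff)
  qed
  then show ?thesis by blast
qed

lemma power_winf_le: "0 \<le> t \<Longrightarrow> t ^ k * winf m k \<le> exp (real m * \<omega> t)"
proof (cases "1 \<le> t")
  case True
  then show ?thesis using winf_le[OF True, of m k] by (simp add: field_simps)
next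
  case False
  assume t: "0 \<le> t"
  have "t ^ k * winf m k \<le> 1 * 1"
    using False t by (intro mult_mono power_le_one winf_le_1 winf_nonneg) auto
  then show ?thesis using False t weight_zero[of t] by simp
qed

text \<open>Biconjugation. The loss of one factor \<open>t\<close> comes from replacing a subgradient of \<open>m \<phi>\<close> by its
  integer part.\<close>

lemma weight_le_power_winf:
  assumes t: "1 \<le> t"
  shows "\<exists>k. exp (real m * \<omega> t) / t \<le> t ^ k * winf m k"
proof -
  define \<phi> where "\<phi> = (\<lambda>x. real m * \<omega> (exp x))"
  \<comment> \<open>The infimum of the difference quotients to the right of \<open>ln t\<close> is a
    subgradient of the convex function \<open>\<phi>\<close> at \<open>ln t\<close>; it is
    nonnegative because \<open>\<phi>\<close> is increasing.\<close>
  define A where "A = Inf ((\<lambda>y. (\<phi> (ln t) - \<phi> y) / (ln t - y)) ` ({ln t<..} \<inter> UNIV))"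
  have "convex_on UNIV (\<lambda>x. \<omega> (exp x))"
    using nonquasianalytic by (simp add: nonquasianalytic_weight_def)
  then have "convex_on UNIV \<phi>" unfolding \<phi>_def by (intro convex_on_cmul) auto
  then have A: "\<phi> y \<ge> \<phi> (ln t) + A * (y - ln t)" for y
    unfolding A_def by (rule convex_le_Inf_differential) auto
  have "0 \<le> A"
  proof (rule ccontr)
    assume "\<not> 0 \<le> A"
    with A[of "ln t - 1"] have "\<phi> (ln t) < \<phi> (ln t - 1)" by simp
    moreover have "\<phi> (ln t - 1) \<le> \<phi> (ln t)"
      unfolding \<phi>_def by (intro mult_left_mono weight_mono) auto
    ultimately show False by simp
  qed
  define k where "k = nat \<lfloor>A\<rfloor>"
  have k: "real k \<le> A" "A \<le> real k + 1" using \<open>0 \<le> A\<close> unfolding k_def by linarith+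
  have "exp (real m * \<omega> t) / t / t ^ k \<le> winf m k"
  proof (rule winf_ge)
    fix s :: real assume s: "1 \<le> s"
    \<comment> \<open>Replacing \<open>A\<close> by \<open>k\<close> costs at most one
      \<open>ln t\<close> at the base point, and at \<open>s\<close> the error has the favourable
      sign because \<open>ln s\<close> is nonnegative.\<close>
    have "(A - k) * ln t \<le> 1 * ln t" "0 \<le> (A - k) * ln s"
      using k t s by (intro mult_right_mono mult_nonneg_nonneg; simp)+
    then have "\<phi> (ln t) - ln t - k * ln t \<le> \<phi> (ln s) - k * ln s"
      using A[of "ln s"] by (simp add: algebra_simps)
    then have "exp (\<phi> (ln t) - ln t - k * ln t) \<le> exp (\<phi> (ln s) - k * ln s)" by simp
    then show "exp (real m * \<omega> t) / t / t ^ k \<le> exp (real m * \<omega> s) / s ^ k"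
      using t s by (simp add: \<phi>_def exp_diff exp_of_nat_mult)
  qed
  then have "exp (real m * \<omega> t) / t \<le> t ^ k * winf m k"
    using t by (simp add: field_simps)
  then show ?thesis by blast
qed

section \<open>The Young conjugate in terms of \<open>winf\<close>\<close>

lemma young_conj_nonneg: "0 \<le> young_conj \<omega> s"
proof -
  have "ereal (s * 0 - \<omega> (exp 0)) \<le> young_conj \<omega> s"
    unfolding young_conj_def by (rule SUP_upper) auto
  then show ?thesis using weight_zero[of 1] by (simp add: zero_ereal_def)
qed

lemma young_conj_le:
  assumes m: "1 \<le> m" and pos: "0 < winf m k"
  shows "young_conj \<omega> (real k / real m) \<le> ereal (- ln (winf m k) / m)"
  unfolding young_conj_def
proof (rule SUP_least)
  fix \<tau> :: real assume "\<tau> \<in> {0..}"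
  then have "winf m k \<le> exp (m * \<omega> (exp \<tau>)) / exp \<tau> ^ k" by (intro winf_le) auto
  also have "\<dots> = exp (m * \<omega> (exp \<tau>) - k * \<tau>)" by (simp add: exp_diff exp_of_nat_mult)
  finally have "ln (winf m k) \<le> m * \<omega> (exp \<tau>) - k * \<tau>"
    using pos by (metis exp_gt_zero ln_exp ln_le_cancel_iff)
  then have "(k * \<tau> - m * \<omega> (exp \<tau>)) / m \<le> - ln (winf m k) / m"
    using m by (intro divide_right_mono) auto
  then show "ereal (real k / real m * \<tau> - \<omega> (exp \<tau>)) \<le> ereal (- ln (winf m k) / m)"
    using m by (simp add: diff_divide_distrib)
qed

lemma winf_young_finite:
  assumes m: "1 \<le> m" and r: "young_conj \<omega> (real k / real m) = ereal r"
  shows "winf m k = exp (- (real m * r))"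
proof (rule antisym)
  have ub: "real k / real m * \<tau> - \<omega> (exp \<tau>) \<le> r" if "0 \<le> \<tau>" for \<tau>
  proof -
    have "ereal (real k / real m * \<tau> - \<omega> (exp \<tau>)) \<le> ereal r"
      unfolding r[symmetric] young_conj_def using that by (intro SUP_upper) auto
    then show ?thesis by simp
  qed
  show "exp (- (real m * r)) \<le> winf m k"
  proof (rule winf_ge)
    fix t :: real assume t: "1 \<le> t"
    have "k * ln t - m * \<omega> t \<le> m * r"
      using ub[of "ln t"] t m by (simp add: field_simps)
    then have "exp (- (real m * r)) \<le> exp (m * \<omega> t - k * ln t)" by simp
    then show "exp (- (real m * r)) \<le> exp (real m * \<omega> t) / t ^ k"
      using t by (simp add: exp_diff exp_of_nat_mult)
  qed
  show "winf m k \<le> exp (- (real m * r))"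
  proof (cases "winf m k = 0")
    case False
    then have pos: "0 < winf m k" using winf_nonneg[of m k] by simp
    have "young_conj \<omega> (real k / real m) \<le> ereal (- ln (winf m k) / m)"
      using m pos by (rule young_conj_le)
    then have "ln (winf m k) \<le> - (m * r)" unfolding r using m by (simp add: field_simps)
    then show ?thesis using pos by (metis exp_le_cancel_iff exp_ln)
  qed simp
qed

lemma winf_young_infinite:
  assumes m: "1 \<le> m" and r: "young_conj \<omega> (real k / real m) = \<infinity>"
  shows "winf m k = 0"
proof (rule ccontr)
  assume "winf m k \<noteq> 0"
  then have pos: "0 < winf m k" using winf_nonneg[of m k] by simp
  have "young_conj \<omega> (real k / real m) \<le> ereal (- ln (winf m k) / m)"
    using m pos by (rule young_conj_le)
  then show False using r by simp
qed

text \<open>Covers the factors of both families of norms: \<open>c = 0\<close> for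
  \<open>q_norm\<close> and \<open>c = n * \<omega> (norm x)\<close> for \<open>r_norm\<close>. The
  convention that the exponential of minus infinity is zero corresponds to
  \<open>winf m k = 0\<close>.\<close>

lemma exp_ereal_young_conj:
  assumes m: "1 \<le> m"
  shows "exp_ereal (- ereal c - ereal (real m) * young_conj \<omega> (real k / real m)) =
    ennreal (exp (- c) * winf m k)"
proof (cases "young_conj \<omega> (real k / real m)")
  case (real r)
  then show ?thesis
    using winf_young_finite[OF m real] by (simp add: exp_ereal_def exp_add[symmetric])
next
  case PInf
  then show ?thesis
    using winf_young_infinite[OF m PInf] m
    by (simp add: exp_ereal_def)
next
  case MInf
  then show ?thesis using young_conj_nonneg[of "real k / real m"] by simp
qed

end

section \<open>Smooth functions and iterated partial derivatives\<close>

lemma has_derivative_line: "((\<lambda>t. x + t *\<^sub>R v) has_derivative (\<lambda>t. t *\<^sub>R v)) (at t)"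
  by (auto intro!: derivative_eq_intros)

lemma partial_deriv_eq:
  assumes "(f has_derivative D) (at x)"
  shows "partial_deriv i f x = D (axis i 1)"
proof -
  have f: "(f has_derivative D) (at (x + 0 *\<^sub>R axis i 1))" using assms by simp
  have "((\<lambda>t. f (x + t *\<^sub>R axis i 1)) has_derivative (\<lambda>t. D (t *\<^sub>R axis i 1))) (at 0)"
    by (rule has_derivative_compose[OF has_derivative_line f])
  then have "((\<lambda>t. f (x + t *\<^sub>R axis i 1)) has_vector_derivative D (axis i 1)) (at 0)"
    using linear_scale[OF has_derivative_linear[OF assms]] by (simp add: has_vector_derivative_def)
  then show ?thesis by (simp add: partial_deriv_def vector_derivative_at)
qed

lemma has_vector_derivative_line:
  assumes "f differentiable at (x + t *\<^sub>R axis i 1)"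
  shows "((\<lambda>s. f (x + s *\<^sub>R axis i 1)) has_vector_derivative partial_deriv i f (x + t *\<^sub>R axis i 1))
    (at t)"
proof -
  obtain D where f: "(f has_derivative D) (at (x + t *\<^sub>R axis i 1))"
    using assms by (auto simp: differentiable_def)
  have "((\<lambda>s. f (x + s *\<^sub>R axis i 1)) has_derivative (\<lambda>s. D (s *\<^sub>R axis i 1))) (at t)"
    by (rule has_derivative_compose[OF has_derivative_line f])
  then show ?thesis
    using linear_scale[OF has_derivative_linear[OF f]] partial_deriv_eq[OF f]
    by (simp add: has_vector_derivative_def)
qed

lemma partial_deriv_add:
  "f differentiable at x \<Longrightarrow> g differentiable at x \<Longrightarrow>
    partial_deriv i (f + g) x = partial_deriv i f x + partial_deriv i g x"
proof -
  assume "f differentiable at x" "g differentiable at x"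
  then obtain F G where FG: "(f has_derivative F) (at x)" "(g has_derivative G) (at x)"
    by (auto simp: differentiable_def)
  then have "(f + g has_derivative (\<lambda>h. F h + G h)) (at x)"
    unfolding plus_fun_def by (rule has_derivative_add)
  then show ?thesis using FG by (simp add: partial_deriv_eq)
qed

lemma partial_deriv_mult:
  "f differentiable at x \<Longrightarrow> g differentiable at x \<Longrightarrow>
    partial_deriv i (f * g) x = partial_deriv i f x * g x + f x * partial_deriv i g x"
proof -
  assume "f differentiable at x" "g differentiable at x"
  then obtain F G where FG: "(f has_derivative F) (at x)" "(g has_derivative G) (at x)"
    by (auto simp: differentiable_def)
  then have "(f * g has_derivative (\<lambda>h. f x * G h + F h * g x)) (at x)"
    unfolding times_fun_def by (rule has_derivative_mult)
  then show ?thesis using FG by (simp add: partial_deriv_eq add.commute)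
qed

lemma differentiable_fun_add:
  "f differentiable at x \<Longrightarrow> g differentiable at x \<Longrightarrow> (f + g) differentiable at x"
  unfolding plus_fun_def by (rule differentiable_add)

lemma differentiable_fun_mult:
  fixes f g :: "'a::real_normed_vector \<Rightarrow> complex"
  shows "f differentiable at x \<Longrightarrow> g differentiable at x \<Longrightarrow> (f * g) differentiable at x"
  unfolding times_fun_def by (rule differentiable_mult)

lemma C_times_0_if_differentiable: "(\<And>x. f differentiable at x) \<Longrightarrow> C_times 0 f"
  by (auto intro!: continuous_at_imp_continuous_on differentiable_imp_continuous_within)

lemma C_times_SucD: "C_times (Suc k) f \<Longrightarrow> C_times k f"
  by (induction k arbitrary: f) (auto simp del: C_times.simps(1) intro: C_times_0_if_differentiable)

lemma smooth_differentiable: "smooth f \<Longrightarrow> f differentiable at x"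
  unfolding smooth_def by (metis C_times.simps(2))

lemma smooth_partial_deriv: "smooth f \<Longrightarrow> smooth (partial_deriv i f)"
  unfolding smooth_def by (metis C_times.simps(2))

lemma smooth_continuous: "smooth f \<Longrightarrow> continuous_on UNIV f"
  unfolding smooth_def by (metis C_times.simps(1))

text \<open>Smoothness by coinduction: a class of differentiable functions that is closed under
  partial derivatives consists of smooth functions. It serves for families such as the oscillatory
  integrals, whose derivatives are again members of the family.\<close>

lemma smooth_coinduct:
  assumes f: "X f"
    and diff: "\<And>g x. X g \<Longrightarrow> g differentiable at x"
    and step: "\<And>g i. X g \<Longrightarrow> X (partial_deriv i g)"
  shows "smooth f"
proof -
  have "C_times k g" if "X g" for k g
    using that
  proof (induction k arbitrary: g)
    case 0
    then show ?case by (intro C_times_0_if_differentiable diff)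
  next
    case (Suc k)
    then show ?case using diff step by simp
  qed
  then show ?thesis using f by (simp add: smooth_def)
qed

lemma C_times_add: "C_times k f \<Longrightarrow> C_times k g \<Longrightarrow> C_times k (f + g)"
proof (induction k arbitrary: f g)
  case 0
  then show ?case by (auto simp: plus_fun_def intro: continuous_on_add)
next
  case (Suc k)
  then have "partial_deriv i (f + g) = partial_deriv i f + partial_deriv i g" for i
    by (auto simp: partial_deriv_add)
  moreover have "C_times k (partial_deriv i f + partial_deriv i g)" for i
    using Suc.prems by (intro Suc.IH) auto
  ultimately show ?case using Suc.prems by (auto intro!: differentiable_fun_add simp del: plus_fun_apply)
qed

lemma C_times_mult: "C_times k f \<Longrightarrow> C_times k g \<Longrightarrow> C_times k (f * g)"
proof (induction k arbitrary: f g)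
  case 0
  then show ?case by (auto simp: times_fun_def intro: continuous_on_mult)
next
  case (Suc k)
  then have "partial_deriv i (f * g) = partial_deriv i f * g + f * partial_deriv i g" for i
    by (auto simp: partial_deriv_mult)
  moreover have "C_times k (partial_deriv i f * g + f * partial_deriv i g)" for i
    using Suc.prems C_times_SucD[OF Suc.prems(1)] C_times_SucD[OF Suc.prems(2)]
    by (intro C_times_add Suc.IH) auto
  ultimately show ?case using Suc.prems by
      (auto intro!: differentiable_fun_mult simp del: times_fun_apply)
qed

lemma smooth_add: "smooth f \<Longrightarrow> smooth g \<Longrightarrow> smooth (f + g)"
  by (simp add: smooth_def C_times_add)

lemma smooth_mult: "smooth f \<Longrightarrow> smooth g \<Longrightarrow> smooth (f * g)"
  by (simp add: smooth_def C_times_mult)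

lemma partial_deriv_const: "partial_deriv i (\<lambda>x. c) = (\<lambda>x. 0)"
  by (rule ext) (simp add: partial_deriv_eq[OF has_derivative_const])

lemma smooth_const: "smooth (\<lambda>x. c)"
  by (rule smooth_coinduct[where X = "\<lambda>f. \<exists>c. f = (\<lambda>x. c)"]) (auto simp: partial_deriv_const)

lemma cscale_eq_mult: "cscale c f = (\<lambda>x. c) * f"
  by (simp add: cscale_def fun_eq_iff)

lemma smooth_cscale: "smooth f \<Longrightarrow> smooth (cscale c f)"
  unfolding cscale_eq_mult by (intro smooth_mult smooth_const)

lemma partial_deriv_cscale:
  "smooth f \<Longrightarrow> partial_deriv i (cscale c f) = cscale c (partial_deriv i f)"
  unfolding cscale_eq_mult
  by (rule ext) (simp add: partial_deriv_mult smooth_differentiable smooth_const partial_deriv_const)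

text \<open>Indexing by words turns the splitting of derivatives between two factors, and the
  addition of further derivatives in one coordinate, into operations on lists.\<close>

definition word_deriv :: "'n::finite list \<Rightarrow> (real^'n \<Rightarrow> complex) \<Rightarrow> real^'n \<Rightarrow> complex" where
  "word_deriv w f = foldr partial_deriv w f"

lemma word_deriv_Nil [simp]: "word_deriv [] f = f"
  and word_deriv_Cons [simp]: "word_deriv (i # w) f = partial_deriv i (word_deriv w f)"
  and word_deriv_append: "word_deriv (u @ w) f = word_deriv u (word_deriv w f)"
  by (simp_all add: word_deriv_def)

lemma smooth_word_deriv: "smooth f \<Longrightarrow> smooth (word_deriv w f)"
  by (induction w) (auto intro: smooth_partial_deriv)

lemma word_deriv_add: "smooth f \<Longrightarrow> smooth g \<Longrightarrow> word_deriv w (f + g) = word_deriv w f + word_deriv w g"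
  by (induction w) (auto simp: partial_deriv_add smooth_word_deriv smooth_differentiable)

lemma word_deriv_cscale: "smooth f \<Longrightarrow> word_deriv w (cscale c f) = cscale c (word_deriv w f)"
  by (induction w) (auto simp: partial_deriv_cscale smooth_word_deriv)

text \<open>The words of the form \<open>index_word L \<alpha>\<close> are those that occur in \<^const>\<open>multi_deriv\<close>. They are closed
  under subsequences, so that the Leibniz rule needs no interchange of derivatives.\<close>

definition index_word :: "'n list \<Rightarrow> ('n \<Rightarrow> nat) \<Rightarrow> 'n list" where
  "index_word L \<alpha> = concat (map (\<lambda>i. replicate (\<alpha> i) i) L)"

lemma index_word_Nil [simp]: "index_word [] \<alpha> = []"
  and index_word_Cons: "index_word (i # L) \<alpha> = replicate (\<alpha> i) i @ index_word L \<alpha>"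
  by (simp_all add: index_word_def)

lemma word_deriv_replicate: "word_deriv (replicate k i) f = (partial_deriv i ^^ k) f"
  by (induction k) auto

lemma foldr_partial_deriv: "foldr (\<lambda>i. partial_deriv i ^^ \<alpha> i) L f = word_deriv (index_word L \<alpha>) f"
  by (induction L) (auto simp: index_word_Cons word_deriv_append word_deriv_replicate)

lemma coord_list: "set coord_list = (UNIV :: 'n::finite set)" "distinct (coord_list :: 'n list)"
  using someI_ex[OF finite_distinct_list[OF finite_class.finite_UNIV[where 'a = 'n]]]
  by (auto simp: coord_list_def)

lemma multi_deriv_eq: "multi_deriv \<alpha> f = word_deriv (index_word coord_list \<alpha>) f"
  by (simp add: multi_deriv_def foldr_partial_deriv)

lemma length_index_word: "distinct L \<Longrightarrow> length (index_word L \<alpha>) = sum \<alpha> (set L)"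
  by (induction L) (auto simp: index_word_Cons)

lemma length_index_word_coord_list: "length (index_word coord_list \<alpha>) = mi_length \<alpha>"
  by (simp add: length_index_word coord_list mi_length_def)

lemma subseq_replicate: "subseq u (replicate k i) \<Longrightarrow> u = replicate (length u) i"
  using subseq_order.order_trans subseq_singleton_left
  by (metis in_set_replicate replicate_eqI)

lemma index_word_cong: "(\<And>i. i \<in> set L \<Longrightarrow> \<alpha> i = \<beta> i) \<Longrightarrow> index_word L \<alpha> = index_word L \<beta>"
  by (induction L) (auto simp: index_word_Cons)

lemma subseq_index_word:
  "distinct L \<Longrightarrow> subseq u (index_word L \<alpha>) \<Longrightarrow> \<exists>\<beta>. u = index_word L \<beta>"
proof (induction L arbitrary: u)
  case Nil
  then show ?case by auto
next
  case (Cons i L)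
  from Cons.prems(2) obtain u1 u2 where u: "u = u1 @ u2" "subseq u1 (replicate (\<alpha> i) i)"
    "subseq u2 (index_word L \<alpha>)"
    unfolding index_word_Cons by (rule subseq_appendE)
  obtain \<beta> where \<beta>: "u2 = index_word L \<beta>" using Cons u by auto
  \<comment> \<open>Distinctness keeps \<open>i\<close> out of \<open>L\<close>, so the exponent at
    \<open>i\<close> can be set freely without affecting the rest of the word.\<close>
  have "index_word L (\<beta>(i := length u1)) = index_word L \<beta>"
    using Cons.prems(1) by (intro index_word_cong) auto
  then have "u = index_word (i # L) (\<beta>(i := length u1))"
    using u subseq_replicate[OF u(2)] \<beta> by (simp add: index_word_Cons)
  then show ?case by blast
qed

text \<open>Each letter goes to one of the two factors, so repeated letters produce repeated pairs:
  the multiplicities take the place of binomial coefficients, and there are exactly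
  \<open>2 ^ length w\<close> terms.\<close>

fun splits :: "'a list \<Rightarrow> ('a list \<times> 'a list) list" where
  "splits [] = [([], [])]"
| "splits (x # w) = map (\<lambda>(u, v). (x # u, v)) (splits w) @ map (\<lambda>(u, v). (u, x # v)) (splits w)"

lemma length_splits: "length (splits w) = 2 ^ length w"
  by (induction w) auto

lemma in_splits:
  "(u, v) \<in> set (splits w) \<Longrightarrow> subseq u w \<and> subseq v w \<and> length u + length v = length w"
  by (induction w arbitrary: u v) auto

lemma word_deriv_mult:
  assumes f: "smooth f" and g: "smooth g"
  shows "word_deriv w (f * g) = (\<Sum>(u, v)\<leftarrow>splits w. word_deriv u f * word_deriv v g)"
proof (induction w)
  case Nil
  show ?case by simp
next
  case (Cons i w)
  \<comment> \<open>Smoothness of the partial sums is carried through the induction because the sum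
    rule for \<open>partial_deriv\<close> asks for differentiable summands.\<close>
  have sm: "smooth (\<Sum>(u, v)\<leftarrow>L. word_deriv u f * word_deriv v g) \<and>
      partial_deriv i (\<Sum>(u, v)\<leftarrow>L. word_deriv u f * word_deriv v g) =
      (\<Sum>(u, v)\<leftarrow>L. word_deriv (i # u) f * word_deriv v g) +
      (\<Sum>(u, v)\<leftarrow>L. word_deriv u f * word_deriv (i # v) g)" for L
  proof (induction L)
    case Nil
    show ?case using smooth_const[of 0] partial_deriv_const[of i 0] by (simp add: zero_fun_def)
  next
    case (Cons p L)
    obtain u v where p: "p = (u, v)" by (cases p)
    have "smooth (word_deriv u f)" "smooth (word_deriv v g)"
      using f g by (auto intro: smooth_word_deriv)
    then have "partial_deriv i (word_deriv u f * word_deriv v g) =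
        word_deriv (i # u) f * word_deriv v g + word_deriv u f * word_deriv (i # v) g"
      by (auto simp: partial_deriv_mult smooth_differentiable)
    moreover have "smooth (word_deriv u f * word_deriv v g)"
      using f g by (intro smooth_mult smooth_word_deriv)
    ultimately show ?case
      using Cons.IH p smooth_add[of "word_deriv u f * word_deriv v g" "\<Sum>(u,
          v)\<leftarrow>L. word_deriv u f * word_deriv v g"]
        partial_deriv_add[of "word_deriv u f * word_deriv v g" _ "\<Sum>(u,
            v)\<leftarrow>L. word_deriv u f * word_deriv v g" i]
      by (simp add: smooth_differentiable fun_eq_iff del: times_fun_apply plus_fun_apply)
        (simp add: algebra_simps)
  qed
  have "word_deriv (i # w) (f * g) = partial_deriv i (\<Sum>(u, v)\<leftarrow>splits w. word_deriv u f * word_deriv v g)"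
    unfolding word_deriv_Cons Cons.IH ..
  also have "\<dots> = (\<Sum>(u, v)\<leftarrow>splits (i # w). word_deriv u f * word_deriv v g)"
    using sm[of "splits w"] by (simp add: case_prod_unfold o_def)
  finally show ?case .
qed

lemma norm_word_deriv_mult_le:
  assumes f: "smooth f" and g: "smooth g"
    and B: "\<And>u v. subseq u w \<Longrightarrow> subseq v w \<Longrightarrow> length u + length v = length w \<Longrightarrow>
      norm (word_deriv u f x) * norm (word_deriv v g x) \<le> B"
  shows "norm (word_deriv w (f * g) x) \<le> 2 ^ length w * B"
proof -
  have "norm ((\<Sum>(u, v)\<leftarrow>L. word_deriv u f * word_deriv v g) x) \<le> length L * B"
    if "\<And>u v. (u, v) \<in> set L \<Longrightarrow> norm (word_deriv u f x) * norm (word_deriv v g x) \<le> B" for L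
    using that
  proof (induction L)
    case (Cons p L)
    obtain u v where p: "p = (u, v)" by (cases p)
    let ?r = "(\<Sum>(u, v)\<leftarrow>L. word_deriv u f * word_deriv v g) x"
    have "norm ((\<Sum>(u, v)\<leftarrow>p # L. word_deriv u f * word_deriv v g) x) \<le>
        norm (word_deriv u f x * word_deriv v g x) + norm ?r"
      unfolding p by (simp add: norm_triangle_ineq)
    also have "\<dots> \<le> B + length L * B"
      using Cons.prems p Cons.IH unfolding norm_mult
      by (intro add_mono) (auto simp del: times_fun_apply)
    finally show ?case by (simp add: algebra_simps del: times_fun_apply)
  qed simp
  moreover have "norm (word_deriv u f x) * norm (word_deriv v g x) \<le> B"
    if "(u, v) \<in> set (splits w)" for u v
    using in_splits[OF that] B by blast
  ultimately have "norm ((\<Sum>(u, v)\<leftarrow>splits w. word_deriv u f * word_deriv v g) x) \<le> length (splits w) * B"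
    by blast
  then show ?thesis by (simp add: word_deriv_mult[OF f g] length_splits del: times_fun_apply)
qed

section \<open>A Landau-Kolmogorov inequality\<close>

text \<open>Lagrange interpolation at \<open>0, s, \<dots>, (n - 1) s\<close> recovers the \<open>k\<close>-th derivative at \<open>0\<close> of every
  polynomial of degree less than \<open>n\<close>, with coefficients that grow only geometrically in \<open>n\<close>. Applied
  to a Taylor polynomial of degree \<open>2 k - 1\<close>, with the optimal step \<open>s\<close>, this yields a constant of
  the form \<open>C\<^sup>k\<close>, which the weights can absorb; iterating the case \<open>k = 1\<close> only gives \<open>C\<close> to
  the power \<open>k\<^sup>2\<close>.\<close>

lemma coeff_prod_linear_le:
  fixes c :: "'a \<Rightarrow> real"
  assumes "finite A" "0 \<le> r"
  shows "\<bar>poly.coeff (\<Prod>i\<in>A. [:- c i, 1:]) k\<bar> * r ^ k \<le> (\<Prod>i\<in>A. r + \<bar>c i\<bar>)"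
  using assms(1)
proof (induction A arbitrary: k)
  case empty
  show ?case by (cases k) (auto simp: one_pCons)
next
  case (insert a A)
  let ?p = "\<Prod>i\<in>A. [:- c i, 1:]" and ?P = "\<Prod>i\<in>A. r + \<bar>c i\<bar>"
  have P: "0 \<le> ?P" using assms by (intro prod_nonneg) auto
  have "\<bar>poly.coeff ([:- c a, 1:] * ?p) k\<bar> * r ^ k \<le> (r + \<bar>c a\<bar>) * ?P"
  proof (cases k)
    case 0
    have "\<bar>c a\<bar> * \<bar>poly.coeff ?p 0\<bar> \<le> \<bar>c a\<bar> * ?P"
      using insert.IH[of 0] by (intro mult_left_mono) auto
    also have "\<dots> \<le> (r + \<bar>c a\<bar>) * ?P" using P assms by (intro mult_right_mono) auto
    finally show ?thesis using 0 by (simp add: abs_mult)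
  next
    case (Suc j)
    have eq: "poly.coeff ([:- c a, 1:] * ?p) k = poly.coeff ?p j - c a * poly.coeff ?p k"
      using Suc by simp
    have "\<bar>poly.coeff ([:- c a, 1:] * ?p) k\<bar> * r ^ k
        \<le> (\<bar>c a\<bar> * \<bar>poly.coeff ?p k\<bar> + \<bar>poly.coeff ?p j\<bar>) * r ^ k"
      unfolding eq abs_mult[symmetric] using assms
      by (intro mult_right_mono order_trans[OF abs_triangle_ineq4]) simp_all
    also have "\<dots> = \<bar>c a\<bar> * (\<bar>poly.coeff ?p k\<bar> * r ^ k) + r * (\<bar>poly.coeff ?p j\<bar> * r ^ j)"
      using Suc by (simp add: algebra_simps)
    also have "\<dots> \<le> \<bar>c a\<bar> * ?P + r * ?P"
      using insert.IH assms by (intro add_mono mult_left_mono) auto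
    finally show ?thesis by (simp add: algebra_simps)
  qed
  then show ?case using insert by simp
qed

lemma power_div_fact_le_exp: "0 \<le> x \<Longrightarrow> x ^ n / fact n \<le> exp (x :: real)"
proof -
  assume x: "0 \<le> x"
  have "(\<Sum>k<Suc n. x ^ k /\<^sub>R fact k) \<le> exp x"
    unfolding exp_def using x by (intro sum_le_suminf summable_exp_generic) auto
  moreover have "0 \<le> (\<Sum>k<n. x ^ k /\<^sub>R fact k)" using x by (intro sum_nonneg) auto
  ultimately show ?thesis by (simp add: divide_inverse mult.commute)
qed

section \<open>Interpolation at integer nodes and Landau's inequality\<close>

definition lagrange :: "nat \<Rightarrow> nat \<Rightarrow> real poly" where
  "lagrange n j = smult (1 / (\<Prod>i\<in>{..<n} - {j}. real j - real i)) (\<Prod>i\<in>{..<n} - {j}. [:- real i, 1:])"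

lemma poly_lagrange:
  assumes "j < n" "l < n"
  shows "poly (lagrange n j) (real l) = (if l = j then 1 else 0)"
proof (cases "l = j")
  case False
  then have "(\<Prod>i\<in>{..<n} - {j}. real l - real i) = 0" using assms by (intro prod_zero) auto
  then show ?thesis using False by (simp add: lagrange_def poly_prod)
qed (simp add: lagrange_def poly_prod)

lemma degree_lagrange: "j < n \<Longrightarrow> degree (lagrange n j) < n"
proof -
  assume j: "j < n"
  have "degree (\<Prod>i\<in>{..<n} - {j}. [:- real i, 1:]) \<le> (\<Sum>i\<in>{..<n} - {j}. degree [:- real i, 1:])"
    by (rule order_trans[OF degree_prod_sum_le]) auto
  also have "\<dots> = n - 1" using j by (simp add: card_Diff_singleton)
  finally have "degree (\<Prod>i\<in>{..<n} - {j}. [:- real i, 1:]) \<le> n - 1" .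
  then have "degree (lagrange n j) \<le> n - 1"
    unfolding lagrange_def by (rule order_trans[OF degree_smult_le])
  then show ?thesis using j by simp
qed

text \<open>Two polynomials of degree below \<open>n\<close> that agree at \<open>n\<close> nodes
  are equal. Comparing coefficients of order \<open>k\<close> yields the moment conditions of the
  differentiation formula in \<open>landau_real\<close>.\<close>

lemma monom_eq_lagrange:
  assumes "m < n"
  shows "monom 1 m = (\<Sum>j<n. smult (real j ^ m) (lagrange n j))"
proof (rule poly_eqI_degree[where A = "real ` {..<n}"])
  have card: "card (real ` {..<n}) = n" by (simp add: card_image)
  show "poly (monom 1 m) x = poly (\<Sum>j<n. smult (real j ^ m) (lagrange n j)) x"
    if x: "x \<in> real ` {..<n}" for x
  proof -
    obtain l where l: "l < n" "x = real l" using x by auto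
    have "poly (\<Sum>j<n. smult (real j ^ m) (lagrange n j)) x = (\<Sum>j<n. if l = j then real j ^ m else 0)"
      unfolding poly_sum using l by (intro sum.cong) (auto simp: poly_lagrange)
    then show ?thesis using l by (simp add: poly_monom)
  qed
  show "degree (monom (1::real) m) < card (real ` {..<n})"
    using assms by (simp add: card degree_monom_eq)
  have "degree (\<Sum>j<n. smult (real j ^ m) (lagrange n j)) < n"
    using assms degree_lagrange
    by (intro degree_sum_less) (auto intro: le_less_trans[OF degree_smult_le])
  then show "degree (\<Sum>j<n. smult (real j ^ m) (lagrange n j)) < card (real ` {..<n})"
    by (simp add: card)
qed

lemma prod_node_differences:
  assumes "j < n"
  shows "\<bar>\<Prod>i\<in>{..<n} - {j}. real j - real i\<bar> = fact j * fact (n - 1 - j)"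
proof -
  have split: "{..<n} - {j} = {0..<j} \<union> {Suc j..<n}" using assms by auto
  have "(\<Prod>i\<in>{..<n} - {j}. \<bar>real j - real i\<bar>) =
      (\<Prod>i\<in>{0..<j}. \<bar>real j - real i\<bar>) * (\<Prod>i\<in>{Suc j..<n}. \<bar>real j - real i\<bar>)"
    unfolding split by (rule prod.union_disjoint) auto
  also have "(\<Prod>i\<in>{0..<j}. \<bar>real j - real i\<bar>) = (\<Prod>i\<in>{0..<j}. real (j - i))"
    by (intro prod.cong) (auto simp: of_nat_diff)
  also have "\<dots> = fact j" unfolding fact_prod_rev[of j] by simp
  also have "(\<Prod>i\<in>{Suc j..<n}. \<bar>real j - real i\<bar>) = (\<Prod>i\<in>{0..<n - 1 - j}. real (Suc i))"
    using assms by (intro prod.reindex_bij_witness[of _ "\<lambda>i. i + Suc j" "\<lambda>i. i - Suc j"]) auto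
  also have "\<dots> = fact (n - 1 - j)" unfolding fact_prod_Suc by simp
  finally show ?thesis by (simp add: abs_prod)
qed

text \<open>The numerator is at most \<open>(2 * n) ^ (n - 1)\<close>. The denominator
  \<open>fact j * fact (n - 1 - j)\<close> is at least \<open>fact (n - 1) / 2 ^ (n - 1)\<close>, a
  binomial coefficient being at most a power of two. With
  \<open>n ^ (n - 1) / fact (n - 1) \<le> exp n \<le> 3 ^ n\<close> this gives
  \<open>12 = 4 * 3\<close>.\<close>

lemma abs_coeff_lagrange_le:
  assumes j: "j < n" and k: "k < n"
  shows "fact k * \<bar>poly.coeff (lagrange n j) k\<bar> \<le> 12 ^ n"
proof -
  have n: "0 < n" using j by simp
  define P where "P = (\<Prod>i\<in>{..<n} - {j}. [:- real i, 1:])"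
  \<comment> \<open>Radius \<open>n\<close> is comparable with the nodes, so every linear factor
    contributes at most \<open>2 * n\<close>, and \<open>n ^ k\<close> dominates
    \<open>fact k\<close>.\<close>
  have "\<bar>poly.coeff P k\<bar> * real n ^ k \<le> (\<Prod>i\<in>{..<n} - {j}. real n + \<bar>real i\<bar>)"
    unfolding P_def by (rule coeff_prod_linear_le) auto
  also have "\<dots> \<le> (\<Prod>i\<in>{..<n} - {j}. 2 * real n)" by (intro prod_mono) auto
  also have "\<dots> = (2 * real n) ^ (n - 1)" using j by (simp add: card_Diff_singleton)
  finally have P: "\<bar>poly.coeff P k\<bar> * real n ^ k \<le> (2 * real n) ^ (n - 1)" .
  have "fact k * \<bar>poly.coeff P k\<bar> \<le> real n ^ k * \<bar>poly.coeff P k\<bar>"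
  proof (intro mult_right_mono)
    have "fact k \<le> real k ^ k" using fact_le_power[of k, where 'a = real] by simp
    also have "\<dots> \<le> real n ^ k" using k by (intro power_mono) auto
    finally show "fact k \<le> real n ^ k" .
  qed simp
  with P have P: "fact k * \<bar>poly.coeff P k\<bar> \<le> (2 * real n) ^ (n - 1)" by (simp add: mult.commute)
  have "real ((n - 1) choose j) \<le> 2 ^ (n - 1)"
    using binomial_le_pow2[of "n - 1" j] by (metis of_nat_le_iff of_nat_numeral of_nat_power)
  moreover have "fact j * fact (n - 1 - j) * real ((n - 1) choose j) = fact (n - 1)"
    using j binomial_fact_lemma[of j "n - 1"]
        by (metis Suc_pred' less_Suc_eq_le n of_nat_fact of_nat_mult)
  ultimately have F: "fact (n - 1) \<le> fact j * fact (n - 1 - j) * (2 :: real) ^ (n - 1)"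
    by (metis fact_ge_zero mult_left_mono mult_nonneg_nonneg)
  have "fact k * \<bar>poly.coeff (lagrange n j) k\<bar> =
      fact k * \<bar>poly.coeff P k\<bar> / (fact j * fact (n - 1 - j))"
    unfolding lagrange_def prod_node_differences[OF j, symmetric] P_def[symmetric] by
        (simp add: abs_mult)
  also have "\<dots> \<le> (2 * real n) ^ (n - 1) / (fact j * fact (n - 1 - j))"
    using P by (intro divide_right_mono) auto
  also have "\<dots> \<le> (2 * real n) ^ (n - 1) * 2 ^ (n - 1) / fact (n - 1)"
    using mult_left_mono[OF F, of "(2 * real n) ^ (n - 1)"] by (simp add: field_simps)
  also have "\<dots> = 4 ^ (n - 1) * (real n ^ (n - 1) / fact (n - 1))"
  proof -
    have "(4 :: real) ^ (n - 1) = 2 ^ (n - 1) * 2 ^ (n - 1)" by (simp flip: power_mult_distrib)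
    then show ?thesis by (simp add: power_mult_distrib)
  qed
  also have "\<dots> \<le> 4 ^ (n - 1) * exp (real n)"
    by (intro mult_left_mono power_div_fact_le_exp) auto
  also have "\<dots> \<le> 4 ^ n * 3 ^ n"
  proof (intro mult_mono)
    have "exp (real n) = exp 1 ^ n" by (simp add: exp_of_nat_mult[symmetric])
    also have "\<dots> \<le> 3 ^ n" by (intro power_mono exp_le) auto
    finally show "exp (real n) \<le> 3 ^ n" .
  qed auto
  finally show ?thesis by (simp flip: power_mult_distrib)
qed

text \<open>The weights \<open>c j\<close> express the \<open>k\<close>-th derivative at
  \<open>0\<close> through the values at \<open>j * s\<close>, exactly up to Taylor remainders of
  order \<open>n\<close>. The base is \<open>72 = 2 * 12 * 3\<close>: the number \<open>n\<close> of
  nodes is at most \<open>2 ^ n\<close>, the weights are at most \<open>12 ^ n\<close>, and the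
  remainders bring \<open>n ^ n / fact n \<le> 3 ^ n\<close>.\<close>

lemma landau_real:
  fixes D :: "nat \<Rightarrow> real \<Rightarrow> real"
  assumes D: "\<And>m t. (D m has_real_derivative D (Suc m) t) (at t)"
    and A: "\<And>t. 0 \<le> t \<Longrightarrow> \<bar>D 0 t\<bar> \<le> A" and B: "\<And>t. 0 \<le> t \<Longrightarrow> \<bar>D n t\<bar> \<le> B"
    and k: "k < n" and s: "0 < s"
  shows "\<bar>D k 0\<bar> * s ^ k \<le> 72 ^ n * (A + B * s ^ n)"
proof -
  define c where "c j = fact k * poly.coeff (lagrange n j) k" for j
  have taylor: "\<exists>t. 0 \<le> t \<and> D 0 x = (\<Sum>m<n. D m 0 / fact m * x ^ m) + D n t / fact n * x ^ n"
    if "0 \<le> x" for x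
  \<comment> \<open>Maclaurin's theorem places the intermediate point strictly between
    \<open>0\<close> and \<open>x\<close>; the node \<open>j = 0\<close> therefore needs its own
    argument.\<close>
  proof (cases "x = 0")
    case True
    have "D 0 0 = (\<Sum>m<n. D m 0 / fact m * 0 ^ m)"
      using k by (cases n) (simp_all add: sum.lessThan_Suc_shift del: sum.lessThan_Suc)
    moreover have "(0 :: real) ^ n = 0" using k by simp
    ultimately show ?thesis
      unfolding True by (intro exI[of _ 0] conjI order_refl) (simp only: mult_zero_right add_0_right)
  next
    case False
    then have "\<exists>t>0. t < x \<and> D 0 x = (\<Sum>m<n. D m 0 / fact m * x ^ m) + D n t / fact n * x ^ n"
      using that k D by (intro Maclaurin[where diff = D]) auto
    then obtain t where t: "0 < t" "D 0 x = (\<Sum>m<n. D m 0 / fact m * x ^ m) + D n t / fact n * x ^ n"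
        by blast
    show ?thesis by (rule exI[of _ t], rule conjI[OF less_imp_le[OF t(1)] t(2)])
  qed
  have "\<forall>j. \<exists>t. 0 \<le> t \<and> D 0 (real j * s) =
      (\<Sum>m<n. D m 0 / fact m * (real j * s) ^ m) + D n t / fact n * (real j * s) ^ n"
    using s by (intro allI taylor) simp
  from choice[OF this] obtain \<tau> where \<tau>: "\<And>j. 0 \<le> \<tau> j"
    "\<And>j. D 0 (real j * s) = (\<Sum>m<n. D m 0 / fact m * (real j * s) ^ m) + D n (\<tau> j) / fact n * (real j
        * s) ^ n"
    by blast
  \<comment> \<open>Summation against the weights eliminates all Taylor coefficients except the
    \<open>k\<close>-th.\<close>
  have moments: "(\<Sum>j<n. c j * real j ^ m) = (if m = k then fact k else 0)" if "m < n" for m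
  proof -
    have "(\<Sum>j<n. c j * real j ^ m) = fact k * poly.coeff (\<Sum>j<n. smult (real j ^ m) (lagrange n j)) k"
      by (simp add: coeff_sum c_def sum_distrib_left mult_ac)
    also have "\<dots> = fact k * poly.coeff (monom 1 m) k" using monom_eq_lagrange[OF that] by simp
    finally show ?thesis by simp
  qed
  have "(\<Sum>j<n. c j * D 0 (real j * s)) =
      (\<Sum>j<n. c j * (\<Sum>m<n. D m 0 / fact m * (real j * s) ^ m)) + (\<Sum>j<n. c j * (D n (\<tau> j) / fact n *
          (real j * s) ^ n))"
    unfolding sum.distrib[symmetric] distrib_left[symmetric] \<tau>(2)[symmetric] ..
  also have "(\<Sum>j<n. c j * (\<Sum>m<n. D m 0 / fact m * (real j * s) ^ m)) =
      (\<Sum>m<n. D m 0 / fact m * s ^ m * (\<Sum>j<n. c j * real j ^ m))"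
    unfolding sum_distrib_left by (subst sum.swap) (simp add: power_mult_distrib mult_ac)
  also have "\<dots> = (\<Sum>m<n. if m = k then D k 0 * s ^ k else 0)"
    by (intro sum.cong) (auto simp: moments)
  also have "\<dots> = D k 0 * s ^ k" using k by simp
  finally have eq: "D k 0 * s ^ k =
      (\<Sum>j<n. c j * (D 0 (real j * s) - D n (\<tau> j) / fact n * (real j * s) ^ n))"
    by (simp add: right_diff_distrib sum_subtractf)
  have "\<bar>c j * (D 0 (real j * s) - D n (\<tau> j) / fact n * (real j * s) ^ n)\<bar> \<le>
      12 ^ n * (3 ^ n * (A + B * s ^ n))"
    if j: "j < n" for j
  proof -
    have "\<bar>D n (\<tau> j) / fact n * (real j * s) ^ n\<bar> \<le> B / fact n * (real n * s) ^ n"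
    proof -
      have "\<bar>D n (\<tau> j) / fact n * (real j * s) ^ n\<bar> = \<bar>D n (\<tau> j)\<bar> / fact n * (real j * s) ^ n"
        using s by (simp add: abs_mult)
      also have "\<dots> \<le> B / fact n * (real n * s) ^ n"
        using s j B[OF \<tau>(1)[of j]] B[of 0]
        by (intro mult_mono divide_right_mono power_mono mult_right_mono) auto
      finally show ?thesis .
    qed
    also have "\<dots> = (B * s ^ n) * (real n ^ n / fact n)" by (simp add: power_mult_distrib)
    also have "\<dots> \<le> (B * s ^ n) * exp (real n)"
      using B[of 0] s by (intro mult_left_mono power_div_fact_le_exp mult_nonneg_nonneg) auto
    also have "\<dots> \<le> (B * s ^ n) * 3 ^ n"
    proof (intro mult_left_mono)
      have "exp (real n) = exp 1 ^ n" by (simp add: exp_of_nat_mult[symmetric])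
      also have "\<dots> \<le> 3 ^ n" by (intro power_mono exp_le) auto
      finally show "exp (real n) \<le> 3 ^ n" .
    qed (use B[of 0] s in auto)
    finally have R: "\<bar>D n (\<tau> j) / fact n * (real j * s) ^ n\<bar> \<le> 3 ^ n * (B * s ^ n)"
      by (simp add: mult_ac)
    have "A \<le> 3 ^ n * A" using A[of 0] mult_right_mono[of 1 "3 ^ n" A] by simp
    then have "\<bar>D 0 (real j * s)\<bar> \<le> 3 ^ n * A" using A[of "real j * s"] s by simp
    with R have "\<bar>D 0 (real j * s) - D n (\<tau> j) / fact n * (real j * s) ^ n\<bar> \<le> 3 ^ n * (A + B * s ^ n)"
      unfolding distrib_left by linarith
    then show ?thesis
      unfolding abs_mult[of "c j"] using abs_coeff_lagrange_le[OF j k]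
      by (intro mult_mono) (simp_all add: c_def abs_mult)
  qed
  then have "\<bar>D k 0 * s ^ k\<bar> \<le> real n * (12 ^ n * (3 ^ n * (A + B * s ^ n)))"
    unfolding eq using sum_norm_bound[of "{..<n}" "\<lambda>j. c j * (D 0 (real j * s) - D n (\<tau> j) / fact n
        * (real j * s) ^ n)"]
    by simp
  also have "\<dots> \<le> 2 ^ n * (12 ^ n * (3 ^ n * (A + B * s ^ n)))"
    using A[of 0] B[of 0] s by (intro mult_right_mono) (auto simp: less_imp_le)
  also have "\<dots> = 72 ^ n * (A + B * s ^ n)" by (simp flip: mult.assoc power_mult_distrib)
  finally show ?thesis using s by (simp add: abs_mult)
qed

text \<open>\<open>landau_real\<close> of order \<open>2 * k\<close>, with the step for which both
  terms on the right are equal; this accounts for the factor \<open>2\<close>, and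
  \<open>5184 = 72 ^ 2\<close>. The order \<open>2 * k\<close> makes the bound the geometric mean of
  \<open>A\<close> and \<open>B\<close>.\<close>

lemma landau:
  fixes D :: "nat \<Rightarrow> real \<Rightarrow> complex"
  assumes D: "\<And>m t. (D m has_vector_derivative D (Suc m) t) (at t)"
    and A: "\<And>t. 0 \<le> t \<Longrightarrow> norm (D 0 t) \<le> A" and B: "\<And>t. 0 \<le> t \<Longrightarrow> norm (D (2 * k) t) \<le> B"
    and pos: "0 < A" "0 < B"
  shows "norm (D k 0) \<le> 2 * 5184 ^ k * sqrt (A * B)"
proof (cases "k = 0")
  \<comment> \<open>Here \<open>landau_real\<close> does not apply, since it requires
    \<open>k < 2 * k\<close>; but \<open>A\<close> and \<open>B\<close> then bound the same
    function.\<close>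
  case True
  have "norm (D 0 0) = sqrt (norm (D 0 0) * norm (D 0 0))" by simp
  also have "\<dots> \<le> sqrt (A * B)"
    using A[of 0] B[of 0] True pos by (intro real_sqrt_le_mono mult_mono) auto
  also have "\<dots> \<le> 2 * sqrt (A * B)" using pos by simp
  finally show ?thesis using True by simp
next
  case False
  \<comment> \<open>Rotating by \<open>u\<close> makes the derivative to be estimated real and
    nonnegative, so that the real inequality for the real parts suffices. If this derivative is
    zero, then so is \<open>u\<close>, and all estimates remain valid.\<close>
  define u where "u = cnj (sgn (D k 0))"
  have u: "norm u \<le> 1" by (simp add: u_def norm_sgn)
  define E where "E m t = Re (u * D m t)" for m t
  have E: "\<bar>E m t\<bar> \<le> norm (D m t)" for m t
  proof -
    have "\<bar>E m t\<bar> \<le> norm u * norm (D m t)" unfolding E_def by (metis abs_Re_le_cmod norm_mult)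
    also have "\<dots> \<le> norm (D m t)" using u by (simp add: mult_left_le_one_le)
    finally show ?thesis .
  qed
  have "u * D k 0 = complex_of_real (norm (D k 0))"
  proof (cases "D k 0 = 0")
    case False
    have "u * D k 0 = D k 0 * cnj (D k 0) / complex_of_real (norm (D k 0))"
      by (simp add: u_def sgn_eq)
    also have "\<dots> = complex_of_real ((norm (D k 0))\<^sup>2 / norm (D k 0))"
      unfolding of_real_divide complex_norm_square ..
    finally show ?thesis using False by (simp add: power2_eq_square)
  qed simp
  then have Ek: "E k 0 = norm (D k 0)" by (simp add: E_def)
  \<comment> \<open>Solves \<open>A = B * s ^ (2 * k)\<close>.\<close>
  define s where "s = root (2 * k) (A / B)"
  have s: "0 < s" "s ^ (2 * k) = A / B" using False pos by (simp_all add: s_def real_root_pow_pos2)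
  have "\<bar>E k 0\<bar> * s ^ k \<le> 72 ^ (2 * k) * (A + B * s ^ (2 * k))"
  proof (rule landau_real)
    fix m t
    have "((\<lambda>t. Re (u * D m t)) has_vector_derivative Re (u * D (Suc m) t)) (at t)"
      by (rule bounded_linear.has_vector_derivative[OF bounded_linear_compose[OF bounded_linear_Re
          bounded_linear_mult_right] D])
    then show "(E m has_real_derivative E (Suc m) t) (at t)"
      by (simp add: E_def[abs_def] has_real_derivative_iff_has_vector_derivative)
  next
    show "\<bar>E 0 t\<bar> \<le> A" "\<bar>E (2 * k) t\<bar> \<le> B" if "0 \<le> t" for t
      using order_trans[OF E A[OF that]] order_trans[OF E B[OF that]] .
  qed (use False s in simp_all)
  then have "norm (D k 0) * s ^ k \<le> 5184 ^ k * (2 * A)"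
    using s pos by (simp add: Ek power_mult)
  moreover have "s ^ k = sqrt (A / B)"
  proof (rule real_sqrt_unique[symmetric])
    show "(s ^ k)\<^sup>2 = A / B" using s(2) by (simp add: power_mult[symmetric] mult.commute)
  qed (use s in simp)
  ultimately have "norm (D k 0) \<le> 5184 ^ k * (2 * A) / sqrt (A / B)"
    using pos by (simp add: pos_le_divide_eq)
  also have "A / sqrt (A / B) = sqrt (A * B)"
    using pos by (simp add: real_sqrt_divide real_sqrt_mult field_simps)
  then have "5184 ^ k * (2 * A) / sqrt (A / B) = 2 * 5184 ^ k * sqrt (A * B)"
    by (metis (no_types, opaque_lifting) mult.assoc mult.commute times_divide_eq_right)
  finally show ?thesis .
qed

section \<open>Rapidly decreasing functions and their Fourier transforms\<close>

text \<open>A point whose norm has integer part \<open>k\<close> lies in the cube \<open>S k\<close>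
  of side \<open>2 * (k + 1)\<close>, where the integrand is compared with
  \<open>1 / (k + 1) ^ (d + 2)\<close>. As the volume of the cube grows like the power
  \<open>d\<close>, the exponent \<open>d + 2\<close> leaves the convergent series of inverse
  squares.\<close>

lemma integrable_inverse_power_norm:
  "integrable lborel (\<lambda>x::'a::euclidean_space. 1 / (1 + norm x) ^ (DIM('a) + 2))"
proof (rule integrableI_nonneg)
  let ?d = "DIM('a)"
  define S :: "nat \<Rightarrow> 'a set" where "S k = cbox (- (\<Sum>b\<in>Basis. real (Suc k) *\<^sub>R b)) (\<Sum>b\<in>Basis. real
      (Suc k) *\<^sub>R b)" for k
  have "1 / (1 + norm x) ^ (?d + 2) \<le> (\<Sum>k. ennreal (1 / real (Suc k) ^ (?d + 2)) * indicator (S k)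
      x)" for x :: 'a
  proof -
    define k where "k = nat \<lfloor>norm x\<rfloor>"
    have k: "real k \<le> norm x" "norm x \<le> real (Suc k)"
      unfolding k_def using norm_ge_zero[of x] by linarith+
    have "\<bar>x \<bullet> b\<bar> \<le> real (Suc k)" if "b \<in> Basis" for b
      using Basis_le_norm[OF that, of x] k by linarith
    then have "x \<in> S k" unfolding S_def mem_box by
        (auto simp: abs_le_iff inner_sum_left_Basis) (force simp: abs_le_iff)
    have "ennreal (1 / (1 + norm x) ^ (?d + 2)) \<le> ennreal (1 / real (Suc k) ^ (?d + 2))"
      using k by (intro ennreal_leI divide_left_mono power_mono mult_pos_pos zero_less_power) auto
    also have "\<dots> = (\<Sum>j\<in>{k}. ennreal (1 / real (Suc j) ^ (?d + 2)) * indicator (S j) x)"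
      using \<open>x \<in> S k\<close> by simp
    also have "\<dots> \<le> (\<Sum>j. ennreal (1 / real (Suc j) ^ (?d + 2)) * indicator (S j) x)"
      by (rule sum_le_suminf) auto
    finally show ?thesis .
  qed
  then have "(\<integral>\<^sup>+x. ennreal (1 / (1 + norm x) ^ (?d + 2)) \<partial>(lborel :: 'a measure)) \<le>
      (\<integral>\<^sup>+x. (\<Sum>k. ennreal (1 / real (Suc k) ^ (?d + 2)) * indicator (S k) x) \<partial>lborel)"
    by (intro nn_integral_mono) auto
  also have "\<dots> = (\<Sum>k. \<integral>\<^sup>+x. ennreal (1 / real (Suc k) ^ (?d + 2)) * indicator (S k) x \<partial>lborel)"
    by (rule nn_integral_suminf) (auto simp: S_def)
  also have "\<dots> = (\<Sum>k. ennreal (2 ^ ?d * (1 / real (Suc k) ^ 2)))"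
  proof (rule suminf_cong)
    fix k
    have "emeasure lborel (S k) = ennreal ((2 * real (Suc k)) ^ ?d)"
    proof -
      have "((\<Sum>b\<in>Basis. real (Suc k) *\<^sub>R b) - - (\<Sum>b\<in>Basis. real (Suc k) *\<^sub>R b)) \<bullet> b = 2 * real (Suc k)"
        if "b \<in> (Basis :: 'a set)" for b
        using that by (simp add: inner_add_left inner_sum_left_Basis del: sum_constant)
      then have "(\<Prod>b\<in>(Basis :: 'a set). ((\<Sum>b\<in>Basis. real (Suc k) *\<^sub>R b) - - (\<Sum>b\<in>Basis. real (Suc k)
          *\<^sub>R b)) \<bullet> b)
          = (\<Prod>b\<in>(Basis :: 'a set). 2 * real (Suc k))"
        by (intro prod.cong) auto
      then show ?thesis
        unfolding S_def emeasure_lborel_cbox_eq by (simp add: inner_sum_left_Basis)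
    qed
    then have "(\<integral>\<^sup>+x. ennreal (1 / real (Suc k) ^ (?d + 2)) * indicator (S k) x \<partial>lborel) =
        ennreal (1 / real (Suc k) ^ (?d + 2)) * ennreal ((2 * real (Suc k)) ^ ?d)"
      by (simp add: nn_integral_cmult_indicator S_def)
    also have "\<dots> = ennreal (1 / real (Suc k) ^ (?d + 2) * (2 * real (Suc k)) ^ ?d)"
      by (intro ennreal_mult[symmetric]) auto
    also have "1 / real (Suc k) ^ (?d + 2) * (2 * real (Suc k)) ^ ?d = 2 ^ ?d * (1 / real (Suc k) ^ 2)"
      by (simp add: power_mult_distrib power_add power2_eq_square del: of_nat_Suc)
    finally show "(\<integral>\<^sup>+x. ennreal (1 / real (Suc k) ^ (?d + 2)) * indicator (S k) x \<partial>lborel) =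
        ennreal (2 ^ ?d * (1 / real (Suc k) ^ 2))" .
  qed
  also have "\<dots> = ennreal (\<Sum>k. 2 ^ ?d * (1 / real (Suc k) ^ 2))"
  proof (rule suminf_ennreal2)
    have "summable (\<lambda>k. 1 / real k ^ 2)" using inverse_power_summable[of 2, where 'a = real] by
        (simp add: inverse_eq_divide)
    then show "summable (\<lambda>k. 2 ^ ?d * (1 / real (Suc k) ^ 2))"
      by (intro summable_mult) (subst summable_Suc_iff)
  qed auto
  also have "\<dots> < \<infinity>" by simp
  finally show "(\<integral>\<^sup>+x. ennreal (1 / (1 + norm x) ^ (?d + 2)) \<partial>(lborel :: 'a measure)) < \<infinity>" .
qed auto

text \<open>Decay of the function alone, without its derivatives. This class is closed under
  multiplication by coordinates, which is what differentiation under the Fourier integral calls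
  for.\<close>

definition rapid :: "(real^'n::finite \<Rightarrow> complex) \<Rightarrow> bool" where
  "rapid u \<longleftrightarrow> continuous_on UNIV u \<and> (\<forall>p::nat. \<exists>C. \<forall>x. (1 + norm x) ^ p * norm (u x) \<le> C)"

lemma rapid_bound:
  assumes "rapid u"
  obtains C where "0 \<le> C" "\<And>x. norm (u x) \<le> C / (1 + norm x) ^ p"
proof -
  obtain C where C: "\<And>x. (1 + norm x) ^ p * norm (u x) \<le> C"
    using assms by (auto simp: rapid_def)
  show ?thesis
  proof
    show "0 \<le> C" using order_trans[OF _ C[of 0]] by simp
    show "norm (u x) \<le> C / (1 + norm x) ^ p" for x
      using C[of x] by (subst pos_le_divide_eq) (auto simp: mult.commute add_pos_nonneg)
  qed
qed

lemma rapid_measurable: "rapid u \<Longrightarrow> u \<in> borel_measurable borel"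
  by (auto simp: rapid_def intro: borel_measurable_continuous_onI)

lemma rapid_integrable: "rapid u \<Longrightarrow> integrable lborel u"
proof -
  assume u: "rapid u"
  obtain C where C: "0 \<le> C" "\<And>x. norm (u x) \<le> C / (1 + norm x) ^ (DIM(real^'a) + 2)"
    using rapid_bound[OF u] by blast
  show ?thesis
  proof (rule Bochner_Integration.integrable_bound)
    show "integrable lborel (\<lambda>x::real^'a. C * (1 / (1 + norm x) ^ (DIM(real^'a) + 2)))"
      by (intro integrable_mult_right integrable_inverse_power_norm)
    show "AE x in lborel. norm (u x) \<le> norm (C * (1 / (1 + norm x) ^ (DIM(real^'a) + 2)))"
      using C by (intro AE_I2) (auto simp: abs_mult intro: order_trans)
  qed (use rapid_measurable[OF u] in simp)
qed

lemma rapid_dominated: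
  assumes u: "rapid u" and v: "continuous_on UNIV v"
    and le: "\<And>x. norm (v x) \<le> C * (1 + norm x) ^ q * norm (u x)"
  shows "rapid v"
  unfolding rapid_def
proof (intro conjI allI v)
  fix p :: nat
  obtain D where D: "\<And>x. (1 + norm x) ^ (p + q) * norm (u x) \<le> D"
    using u by (auto simp: rapid_def)
  have "(1 + norm x) ^ p * norm (v x) \<le> \<bar>C\<bar> * D" for x
  proof -
    have "(1 + norm x) ^ p * norm (v x) \<le> (1 + norm x) ^ p * (C * (1 + norm x) ^ q * norm (u x))"
      by (intro mult_left_mono le) auto
    also have "\<dots> = C * ((1 + norm x) ^ (p + q) * norm (u x))" by (simp add: power_add mult_ac)
    also have "\<dots> \<le> \<bar>C\<bar> * ((1 + norm x) ^ (p + q) * norm (u x))"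
      by (intro mult_right_mono) auto
    also have "\<dots> \<le> \<bar>C\<bar> * D" by (intro mult_left_mono D) auto
    finally show ?thesis .
  qed
  then show "\<exists>C. \<forall>x. (1 + norm x) ^ p * norm (v x) \<le> C" by blast
qed

lemma rapid_mult_coord:
  assumes u: "rapid u"
  shows "rapid (\<lambda>x. c * of_real (x $ i) * u x)"
proof (rule rapid_dominated[OF u, where C = "norm c" and q = 1])
  show "continuous_on UNIV (\<lambda>x. c * of_real (x $ i) * u x)"
    using u by (auto simp: rapid_def intro!: continuous_intros)
  fix x :: "real^'a"
  have "\<bar>x $ i\<bar> \<le> 1 + norm x" using component_le_norm_cart[of x i] by simp
  then show "norm (c * of_real (x $ i) * u x) \<le> norm c * (1 + norm x) ^ 1 * norm (u x)"
    by (auto simp: norm_mult intro!: mult_right_mono mult_left_mono)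
qed

text \<open>Both the Fourier transform (\<open>s = - 1\<close>) and its inverse up to a constant (\<open>s = 1\<close>).\<close>

definition osc_integral :: "real \<Rightarrow> (real^'n::finite \<Rightarrow> complex) \<Rightarrow> real^'n \<Rightarrow> complex" where
  "osc_integral s u \<xi> = (LINT x|lborel. u x * exp (\<i> * of_real (s * (x \<bullet> \<xi>))))"

lemma fourier_eq_osc_integral: "fourier = osc_integral (- 1)"
  by (simp add: fun_eq_iff fourier_def osc_integral_def)

lemma norm_mult_exp_i: "norm (z * exp (\<i> * of_real t)) = norm z"
  by (simp add: norm_mult)

lemma integrable_mult_exp_i:
  fixes u :: "real^'n::finite \<Rightarrow> complex"
  assumes "integrable lborel u"
  shows "integrable lborel (\<lambda>x. u x * exp (\<i> * of_real (s * (x \<bullet> \<xi>))))"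
  by (rule Bochner_Integration.integrable_bound[OF assms])
    (use borel_measurable_integrable[OF assms] in \<open>auto simp: norm_mult intro!:
        borel_measurable_times borel_measurable_continuous_onI continuous_intros\<close>)

lemma norm_osc_integral_le:
  assumes "integrable lborel u"
  shows "norm (osc_integral s u \<xi>) \<le> (LINT x|lborel. norm (u x))"
  unfolding osc_integral_def by (rule order_trans[OF integral_norm_bound]) (simp only: norm_mult_exp_i)

lemma norm_exp_i_taylor: "norm (exp (\<i> * of_real t) - 1 - \<i> * of_real t) \<le> t\<^sup>2"
proof -
  have "norm (exp (\<i> * of_real t) - 1 - \<i> * of_real t) \<le> t\<^sup>2 / 2"
    using iexp_approx1[of t 1] by (simp add: power2_eq_square algebra_simps)
  also have "\<dots> \<le> t\<^sup>2" by simp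
  finally show ?thesis .
qed

text \<open>Instead of a general theorem on differentiation under the integral sign, the
  second-order remainder of the exponential is integrated directly: it is at most the square of the
  increment times the integral \<open>J\<close>, which is finite by rapid decay.\<close>

lemma osc_integral_has_derivative:
  assumes u: "rapid u"
  shows "(osc_integral s u has_derivative
    (\<lambda>h. \<Sum>i\<in>UNIV. h $ i *\<^sub>R osc_integral s (\<lambda>x. \<i> * of_real s * of_real (x $ i) * u x) \<xi>)) (at \<xi>)"
proof (rule has_derivativeI_sandwich[where e = 1])
  let ?e = "\<lambda>\<xi> x. exp (\<i> * complex_of_real (s * (x \<bullet> \<xi>)))"
  let ?v = "\<lambda>i x. \<i> * of_real s * of_real (x $ i) * u x"
  let ?D = "\<lambda>h. \<Sum>i\<in>UNIV. h $ i *\<^sub>R osc_integral s (?v i) \<xi>"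
  define J where "J = (LINT x|lborel. s\<^sup>2 * (norm x)\<^sup>2 * norm (u x))"
  show "bounded_linear ?D"
    by (intro bounded_linear_sum bounded_linear_scaleR_left[THEN bounded_linear_compose]
        bounded_linear_vec_nth)
  have "rapid (\<lambda>x. of_real (s\<^sup>2 * (norm x)\<^sup>2) * u x)"
  proof (rule rapid_dominated[OF u, where C = "s\<^sup>2" and q = 2])
    show "norm (of_real (s\<^sup>2 * (norm x)\<^sup>2) * u x) \<le> s\<^sup>2 * (1 + norm x) ^ 2 * norm (u x)" for x
      by (auto simp: norm_mult abs_mult norm_power intro!: mult_right_mono mult_left_mono power_mono)
  qed (use u in \<open>auto simp: rapid_def intro!: continuous_intros\<close>)
  from integrable_norm[OF rapid_integrable[OF this]]
  have intJ: "integrable lborel (\<lambda>x. s\<^sup>2 * (norm x)\<^sup>2 * norm (u x))"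
    by (simp add: norm_mult norm_power power_mult_distrib)
  fix y
  assume y: "y \<noteq> \<xi>"
  let ?h = "y - \<xi>"
  have int: "integrable lborel (\<lambda>x. u x * ?e y x)" "integrable lborel (\<lambda>x. u x * ?e \<xi> x)"
    "\<And>i. integrable lborel (\<lambda>x. ?v i x * ?e \<xi> x)"
    by (rule integrable_mult_exp_i[OF rapid_integrable[OF u]]
        integrable_mult_exp_i[OF rapid_integrable[OF rapid_mult_coord[OF u]]])+
  have D: "?D ?h = (LINT x|lborel. (\<Sum>i\<in>UNIV. ?h $ i *\<^sub>R (?v i x * ?e \<xi> x)))"
    unfolding osc_integral_def using int(3) by (simp add: integral_sum integrable_scaleR_right)
  have intD: "integrable lborel (\<lambda>x. \<Sum>i\<in>UNIV. ?h $ i *\<^sub>R (?v i x * ?e \<xi> x))"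
    using int(3) by (intro Bochner_Integration.integrable_sum integrable_scaleR_right) auto
  have sumD: "(\<Sum>i\<in>UNIV. ?h $ i *\<^sub>R (?v i x * ?e \<xi> x)) = u x * ?e \<xi> x * (\<i> * of_real (s * (x \<bullet> ?h)))"
      for x
  proof -
    have "(\<Sum>i\<in>UNIV. ?h $ i *\<^sub>R (?v i x * ?e \<xi> x)) = u x * ?e \<xi> x * (\<i> * of_real s * (\<Sum>i\<in>UNIV.
        of_real (x $ i * ?h $ i)))"
      unfolding sum_distrib_left by (intro sum.cong) (simp_all add: scaleR_conv_of_real mult_ac)
    also have "(\<Sum>i\<in>UNIV. of_real (x $ i * ?h $ i)) = complex_of_real (x \<bullet> ?h)"
      by (simp add: inner_vec_def)
    finally show ?thesis by (simp add: mult_ac)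
  qed
  have "norm (osc_integral s u y - osc_integral s u \<xi> - ?D ?h) =
      norm (LINT x|lborel. u x * ?e y x - u x * ?e \<xi> x - (\<Sum>i\<in>UNIV. ?h $ i *\<^sub>R (?v i x * ?e \<xi> x)))"
    unfolding D osc_integral_def using int intD
    by (simp del: sum_subtractf scaleR_conv_of_real)
  also have "\<dots> \<le> (LINT x|lborel. (norm ?h)\<^sup>2 * (s\<^sup>2 * (norm x)\<^sup>2 * norm (u x)))"
  proof (rule Bochner_Integration.integral_norm_bound_integral)
    fix x
    have "u x * ?e y x - u x * ?e \<xi> x - (\<Sum>i\<in>UNIV. ?h $ i *\<^sub>R (?v i x * ?e \<xi> x)) =
        u x * ?e \<xi> x * (?e ?h x - 1 - \<i> * of_real (s * (x \<bullet> ?h)))"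
    proof -
      have "?e y x = ?e \<xi> x * ?e ?h x"
        by (simp add: exp_add[symmetric] inner_diff_right algebra_simps)
      then show ?thesis unfolding sumD by (simp add: algebra_simps)
    qed
    then have "norm (u x * ?e y x - u x * ?e \<xi> x - (\<Sum>i\<in>UNIV. ?h $ i *\<^sub>R (?v i x * ?e \<xi> x))) =
        norm (u x) * norm (?e ?h x - 1 - \<i> * of_real (s * (x \<bullet> ?h)))"
      by (simp only: norm_mult norm_exp_i_times[of 1, simplified]) simp
    also have "\<dots> \<le> norm (u x) * (s * (x \<bullet> ?h))\<^sup>2"
      by (intro mult_left_mono norm_exp_i_taylor) auto
    also have "\<dots> = norm (u x) * (s\<^sup>2 * (x \<bullet> ?h)\<^sup>2)" by (simp add: power_mult_distrib)
    also have "\<dots> \<le> norm (u x) * (s\<^sup>2 * ((norm x)\<^sup>2 * (norm ?h)\<^sup>2))"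
      using Cauchy_Schwarz_ineq[of x ?h] by (intro mult_left_mono) (auto simp: power2_norm_eq_inner)
    finally show "norm (u x * ?e y x - u x * ?e \<xi> x - (\<Sum>i\<in>UNIV. ?h $ i *\<^sub>R (?v i x * ?e \<xi> x)))
        \<le> (norm ?h)\<^sup>2 * (s\<^sup>2 * (norm x)\<^sup>2 * norm (u x))"
      by (simp add: mult_ac)
  qed (use int intD intJ in \<open>auto intro!: Bochner_Integration.integrable_diff integrable_mult_right\<close>)
  also have "\<dots> = (norm ?h)\<^sup>2 * J" unfolding J_def by simp
  finally show "norm (osc_integral s u y - osc_integral s u \<xi> - ?D ?h) / norm ?h \<le> norm ?h * J"
    using y by (simp add: field_simps power2_eq_square)
next
  show "((\<lambda>y. norm (y - \<xi>) * (LINT x|lborel. s\<^sup>2 * (norm x)\<^sup>2 * norm (u x))) \<longlongrightarrow> 0) (at \<xi>)"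
    by (rule tendsto_eq_intros refl)+ simp
qed simp

lemma partial_deriv_osc_integral:
  assumes "rapid u"
  shows "partial_deriv i (osc_integral s u) = osc_integral s (\<lambda>x. \<i> * of_real s * of_real (x $ i) * u x)"
  by (rule ext) (simp add: partial_deriv_eq[OF osc_integral_has_derivative[OF assms]] axis_def
      if_distrib[of "\<lambda>c. c *\<^sub>R _"]
    sum.delta cong: if_cong)

lemma osc_integral_differentiable: "rapid u \<Longrightarrow> osc_integral s u differentiable at \<xi>"
  using osc_integral_has_derivative by (rule differentiableI)

lemma smooth_osc_integral: "rapid u \<Longrightarrow> smooth (osc_integral s u)"
proof (rule smooth_coinduct[where X = "\<lambda>f. \<exists>u. rapid u \<and> f = osc_integral s u"])
  fix f i assume "\<exists>u. rapid u \<and> f = osc_integral s u"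
  then obtain u where "rapid u" "f = osc_integral s u" by blast
  then show "\<exists>u. rapid u \<and> partial_deriv i f = osc_integral s u"
    using partial_deriv_osc_integral rapid_mult_coord by blast
qed (auto intro: osc_integral_differentiable)

text \<open>Each derivative multiplies the density by a coordinate, up to a constant. Only the size
  of the new density matters later on, so it is merely bounded and not written out.\<close>

lemma word_deriv_osc_integral:
  assumes u: "rapid u"
  shows "\<exists>v. rapid v \<and> word_deriv w (osc_integral s u) = osc_integral s v \<and>
    (\<forall>x. norm (v x) \<le> (\<bar>s\<bar> * norm x) ^ length w * norm (u x))"
proof (induction w)
  case Nil
  show ?case using u by (intro exI[of _ u]) auto
next
  case (Cons i w)
  then obtain v where v: "rapid v" "word_deriv w (osc_integral s u) = osc_integral s v"
    "\<And>x. norm (v x) \<le> (\<bar>s\<bar> * norm x) ^ length w * norm (u x)" by blast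
  have "norm (\<i> * of_real s * of_real (x $ i) * v x) \<le> (\<bar>s\<bar> * norm x) ^ length (i # w) * norm (u x)"
      for x
  proof -
    have "norm (\<i> * of_real s * of_real (x $ i) * v x) = (\<bar>s\<bar> * \<bar>x $ i\<bar>) * norm (v x)"
      by (simp add: norm_mult)
    also have "\<dots> \<le> (\<bar>s\<bar> * norm x) * ((\<bar>s\<bar> * norm x) ^ length w * norm (u x))"
      by (intro mult_mono mult_left_mono v component_le_norm_cart) auto
    finally show ?thesis by (simp add: mult.assoc)
  qed
  then show ?case
    using v rapid_mult_coord[OF v(1), of "\<i> * of_real s" i]
    by (intro exI[of _ "\<lambda>x. \<i> * of_real s * of_real (x $ i) * v x"])
      (simp add: partial_deriv_osc_integral)
qed

section \<open>Affine substitution and integration by parts\<close>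

lemma lborel_integral_affine:
  fixes f :: "'a::euclidean_space \<Rightarrow> complex"
  assumes c: "c \<noteq> 0" and f[measurable]: "f \<in> borel_measurable borel"
  shows "(LINT x|lborel. f x) = \<bar>c\<bar> ^ DIM('a) *\<^sub>R (LINT x|lborel. f (t + c *\<^sub>R x))"
proof -
  have "(LINT x|lborel. f x) = (LINT x|density (distr lborel borel (\<lambda>x. t + c *\<^sub>R x)) (\<lambda>_. \<bar>c\<bar> ^
      DIM('a)). f x)"
    using lborel_affine[OF c, of t] by simp
  also have "\<dots> = (LINT x|distr lborel borel (\<lambda>x. t + c *\<^sub>R x). \<bar>c\<bar> ^ DIM('a) *\<^sub>R f x)"
    by (rule integral_density) auto
  also have "\<dots> = (LINT x|lborel. \<bar>c\<bar> ^ DIM('a) *\<^sub>R f (t + c *\<^sub>R x))"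
    by (rule integral_distr) auto
  finally show ?thesis by simp
qed

lemma rapid_add: "rapid u \<Longrightarrow> rapid v \<Longrightarrow> rapid (\<lambda>x. u x + v x)"
  unfolding rapid_def
proof (intro conjI allI; (elim conjE)?)
  fix p :: nat
  assume "\<forall>p. \<exists>C. \<forall>x. (1 + norm x) ^ p * norm (u x) \<le> C" "\<forall>p. \<exists>C. \<forall>x. (1 + norm x) ^ p * norm (v x) \<le> C"
  then obtain C D where C: "\<And>x. (1 + norm x) ^ p * norm (u x) \<le>
      C" and D: "\<And>x. (1 + norm x) ^ p * norm (v x) \<le> D"
    by metis
  have "(1 + norm x) ^ p * norm (u x + v x) \<le> C + D" for x
  proof -
    have "(1 + norm x) ^ p * norm (u x + v x) \<le> (1 + norm x) ^ p * (norm (u x) + norm (v x))"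
      by (intro mult_left_mono norm_triangle_ineq) auto
    then show ?thesis using C[of x] D[of x] by (simp add: distrib_left)
  qed
  then show "\<exists>C. \<forall>x. (1 + norm x) ^ p * norm (u x + v x) \<le> C" by blast
qed (auto intro: continuous_on_add)

lemma rapid_norm_eq: "rapid u \<Longrightarrow> continuous_on UNIV v \<Longrightarrow> (\<And>x. norm (v x) \<le> C * norm (u x)) \<Longrightarrow> rapid v"
  by (rule rapid_dominated[where C = C and q = 0]) auto

text \<open>By translation invariance every difference quotient \<open>\<phi> n\<close> has integral
  zero, and dominated convergence passes this on to the derivative. No iterated integration in a
  single coordinate is involved.\<close>

lemma integral_partial_deriv_eq_0:
  fixes u :: "real^'n::finite \<Rightarrow> complex"
  assumes diff: "\<And>x. u differentiable at x" and u: "rapid u" and du: "rapid (partial_deriv i u)"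
  shows "(LINT x|lborel. partial_deriv i u x) = 0"
proof -
  let ?e = "axis i 1 :: real^'n" and ?p = "DIM(real^'n) + 2"
  \<comment> \<open>Compares \<open>1 + norm\<close> at two points at distance at most one; it is
    the source of the factor \<open>2 ^ ?p\<close> in the majorant \<open>w\<close>.\<close>
  have aux: "1 + a \<le> 2 * (1 + b)" if "a \<le> b + c" "c \<le> 1" "0 \<le> b" for a b c :: real
  proof -
    have "a \<le> 1 + 2 * b" using that by linarith
    then show ?thesis by simp
  qed
  define \<phi> where "\<phi> n x = of_real (real (Suc n)) * (u (x + (1 / real (Suc n)) *\<^sub>R ?e) - u x)" for n x
  have um[measurable]: "u \<in> borel_measurable borel" using rapid_measurable[OF u] .
  obtain C where C: "0 \<le> C" "\<And>x. norm (partial_deriv i u x) \<le> C / (1 + norm x) ^ ?p"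
    using rapid_bound[OF du] by blast
  define w where "w x = C * 2 ^ ?p * (1 / (1 + norm x) ^ ?p)" for x :: "real^'n"
  have "(\<lambda>n. LINT x|lborel. \<phi> n x) \<longlonglongrightarrow> (LINT x|lborel. partial_deriv i u x)"
  proof (rule integral_dominated_convergence[where w = w])
    show "integrable lborel w"
      unfolding w_def by (intro integrable_mult_right integrable_inverse_power_norm)
    show "\<phi> n \<in> borel_measurable lborel" for n
      unfolding \<phi>_def by measurable
    show "partial_deriv i u \<in> borel_measurable lborel"
      using rapid_measurable[OF du] by simp
    show "AE x in lborel. norm (\<phi> n x) \<le> w x" for n
    proof (rule AE_I2)
      fix x :: "real^'n"
      let ?t = "1 / real (Suc n)" and ?B = "C * 2 ^ ?p * (1 / (1 + norm x) ^ ?p)"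
      \<comment> \<open>The mean value inequality on a segment of length at most one bounds the
        difference quotient by the decay of the derivative nearby, uniformly in
        \<open>n\<close>.\<close>
      have "norm (u (x + ?t *\<^sub>R ?e) - u (x + 0 *\<^sub>R ?e)) \<le> ?B * norm (?t - 0)"
      proof (rule differentiable_bound[where S = "{0..?t}" and f = "\<lambda>s. u (x + s *\<^sub>R ?e)" and f' =
          "\<lambda>s h. h *\<^sub>R partial_deriv i u (x + s *\<^sub>R ?e)"])
        fix s assume s: "s \<in> {0..?t}"
        show "((\<lambda>s. u (x + s *\<^sub>R ?e)) has_derivative (\<lambda>h. h *\<^sub>R partial_deriv i u (x + s *\<^sub>R ?e)))
            (at s within {0..?t})"
          using has_vector_derivative_line[OF diff, where x = x and t = s and i = i]
          by (auto simp: has_vector_derivative_def intro: has_derivative_at_withinI)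
        have "norm x \<le> norm (x + s *\<^sub>R ?e) + norm (s *\<^sub>R ?e)"
          by (metis add_diff_cancel norm_triangle_ineq4)
        moreover have "norm (s *\<^sub>R ?e) \<le> 1" 
        proof -
          have "?t \<le> 1" by simp
          moreover have "s \<le> ?t" "0 \<le> s" using s by auto
          ultimately have "0 \<le> s" "s \<le> 1" by (blast intro: order_trans)+
          then show ?thesis by simp
        qed
        ultimately have "1 + norm x \<le> 2 * (1 + norm (x + s *\<^sub>R ?e))"
          by (rule aux[OF _ _ norm_ge_zero])
        then have "(1 + norm x) ^ ?p \<le> (2 * (1 + norm (x + s *\<^sub>R ?e))) ^ ?p"
          by (intro power_mono) auto
        then have "(1 + norm x) ^ ?p \<le> 2 ^ ?p * (1 + norm (x + s *\<^sub>R ?e)) ^ ?p"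
          unfolding power_mult_distrib .
        then have "1 / (1 + norm (x + s *\<^sub>R ?e)) ^ ?p \<le> 2 ^ ?p * (1 / (1 + norm x) ^ ?p)"
          by (simp add: divide_simps add_pos_nonneg mult_ac)
        then have "C * (1 / (1 + norm (x + s *\<^sub>R ?e)) ^ ?p) \<le> C * (2 ^ ?p * (1 / (1 + norm x) ^ ?p))"
          using C(1) by (rule mult_left_mono)
        then have B: "norm (partial_deriv i u (x + s *\<^sub>R ?e)) \<le> ?B"
          using C(2)[of "x + s *\<^sub>R ?e"] by simp
        show "onorm (\<lambda>h. h *\<^sub>R partial_deriv i u (x + s *\<^sub>R ?e)) \<le> ?B"
          by (rule onorm_le) (use mult_left_mono[OF B] in \<open>simp add: mult.commute\<close>)
      qed auto
      then have "real (Suc n) * norm (u (x + ?t *\<^sub>R ?e) - u x) \<le> real (Suc n) * (?B * ?t)"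
        by (intro mult_left_mono) auto
      also have "\<dots> = ?B" by simp
      finally show "norm (\<phi> n x) \<le> w x"
        unfolding \<phi>_def w_def norm_mult norm_of_real by simp
    qed
    show "AE x in lborel. (\<lambda>n. \<phi> n x) \<longlonglongrightarrow> partial_deriv i u x"
    proof (rule AE_I2)
      fix x :: "real^'n"
      have "((\<lambda>h. norm (u (x + h *\<^sub>R ?e) - u x - h *\<^sub>R partial_deriv i u x) / norm h) \<longlongrightarrow> 0) (at 0)"
        using has_vector_derivative_line[OF diff, where x = x and t = 0 and i = i]
        by (simp add: has_vector_derivative_def has_derivative_at)
      moreover have "filterlim (\<lambda>n. 1 / real (Suc n)) (at 0) sequentially"
        unfolding filterlim_at using LIMSEQ_inverse_real_of_nat by (simp add: inverse_eq_divide)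
      ultimately have "(\<lambda>n. norm (u (x + (1 / real (Suc n)) *\<^sub>R ?e) - u x - (1 / real (Suc n)) *\<^sub>R
          partial_deriv i u x) / norm (1 / real (Suc n))) \<longlonglongrightarrow> 0"
        by (rule filterlim_compose)
      moreover have "norm (u (x + (1 / real (Suc n)) *\<^sub>R ?e) - u x - (1 / real (Suc n)) *\<^sub>R
          partial_deriv i u x) / norm (1 / real (Suc n)) =
          norm (\<phi> n x - partial_deriv i u x)" for n
      proof -
        have "\<phi> n x - partial_deriv i u x =
            of_real (real (Suc n)) * (u (x + (1 / real (Suc n)) *\<^sub>R ?e) - u x - (1 / real (Suc n))
                *\<^sub>R partial_deriv i u x)"
          by (simp add: \<phi>_def right_diff_distrib scaleR_conv_of_real del: of_nat_Suc)
        then show ?thesis by (simp add: norm_mult del: of_nat_Suc)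
      qed
      ultimately have "(\<lambda>n. norm (\<phi> n x - partial_deriv i u x)) \<longlonglongrightarrow> 0" by simp
      then show "(\<lambda>n. \<phi> n x) \<longlonglongrightarrow> partial_deriv i u x"
        by (rule LIM_zero_cancel[OF tendsto_norm_zero_cancel])
    qed
  qed
  moreover have "(LINT x|lborel. \<phi> n x) = 0" for n
  proof -
    have int: "integrable lborel u" "integrable lborel (\<lambda>x. u (x + (1 / real (Suc n)) *\<^sub>R ?e))"
    proof -
      show 1: "integrable lborel u" using u by (rule rapid_integrable)
      then have "integrable (distr lborel borel ((+) ((1 / real (Suc n)) *\<^sub>R ?e))) u"
        by (simp add: lborel_distr_plus)
      then show "integrable lborel (\<lambda>x. u (x + (1 / real (Suc n)) *\<^sub>R ?e))"
        by (subst (asm) integrable_distr_eq) (auto simp: add.commute)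
    qed
    have "(LINT x|lborel. u (x + (1 / real (Suc n)) *\<^sub>R ?e)) = (LINT x|lborel. u x)"
      using lborel_integral_affine[of 1 u "(1 / real (Suc n)) *\<^sub>R ?e"] by (simp add: add.commute)
    then show ?thesis using int by (simp add: \<phi>_def del: of_nat_Suc)
  qed
  ultimately show ?thesis using LIMSEQ_unique[OF tendsto_const] by fastforce
qed

text \<open>Integration by parts: \<open>integral_partial_deriv_eq_0\<close> is applied to the
  product of \<open>h\<close> and the oscillating factor \<open>e\<close>, which has modulus one and
  thus preserves rapid decay.\<close>

lemma osc_integral_partial_deriv:
  fixes h :: "real^'n::finite \<Rightarrow> complex"
  assumes diff: "\<And>x. h differentiable at x" and h: "rapid h" and dh: "rapid (partial_deriv i h)"
  shows "osc_integral s (partial_deriv i h) \<xi> = - (\<i> * of_real (s * \<xi> $ i)) * osc_integral s h \<xi>"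
proof -
  define e where "e x = exp (\<i> * complex_of_real (s * (x \<bullet> \<xi>)))" for x :: "real^'n"
  have e: "(e has_derivative (\<lambda>v. \<i> * complex_of_real (s * (v \<bullet> \<xi>)) * e x)) (at x)" for x
  proof -
    have 1: "((\<lambda>x. \<i> * complex_of_real (s * (x \<bullet> \<xi>))) has_derivative (\<lambda>v. \<i> * complex_of_real (s *
        (v \<bullet> \<xi>)))) (at x)"
      by (auto intro!: derivative_eq_intros has_derivative_of_real)
    have 2: "(exp has_derivative (\<lambda>w. exp z * w)) (at z)" for z :: complex
      using DERIV_exp[of z] by (simp add: has_field_derivative_def)
    show ?thesis
      using has_derivative_compose[OF 1 2] unfolding e_def by (simp add: mult_ac)
  qed
  have ec: "continuous_on UNIV e" unfolding e_def by (intro continuous_intros)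
  have de: "partial_deriv i e x = \<i> * of_real (s * \<xi> $ i) * e x" for x
    using partial_deriv_eq[OF e] by (simp add: inner_axis' )
  have ed: "e differentiable at x" for x using e by (rule differentiableI)
  have ne: "norm (e x) = 1" for x by (simp add: e_def)
  have 1: "rapid (\<lambda>x. partial_deriv i h x * e x)" "rapid (\<lambda>x. \<i> * of_real (s * \<xi> $ i) * (h x * e
      x))" "rapid (h * e)"
    by (rule rapid_norm_eq[OF dh, where C = 1] rapid_norm_eq[OF h, where C =
        "\<bar>s * \<xi> $ i\<bar>"] rapid_norm_eq[OF h, where C = 1];
        use h dh ec ne in \<open>auto simp: rapid_def norm_mult abs_mult times_fun_def intro!:
            continuous_intros\<close>)+
  have eq: "partial_deriv i (h * e) = (\<lambda>x. partial_deriv i h x * e x + \<i> * of_real (s * \<xi> $ i) * (h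
      x * e x))"
    by (rule ext) (simp add: partial_deriv_mult diff ed de)
  have "(LINT x|lborel. partial_deriv i (h * e) x) = 0"
  proof (rule integral_partial_deriv_eq_0)
    show "rapid (partial_deriv i (h * e))" unfolding eq using 1 by (intro rapid_add)
  qed (use 1 in \<open>auto intro: differentiable_fun_mult diff ed\<close>)
  then have "(LINT x|lborel. partial_deriv i h x * e x) + (LINT x|lborel. \<i> * of_real (s * \<xi> $ i) *
      (h x * e x)) = 0"
    unfolding eq using 1 by (simp add: rapid_integrable)
  then show ?thesis
    unfolding osc_integral_def e_def[symmetric] by (simp add: eq_neg_iff_add_eq_0)
qed

subsection \<open>The Gaussian and Fourier inversion\<close>

definition gauss :: "real^'n::finite \<Rightarrow> complex" where
  "gauss x = of_real (exp (- (x \<bullet> x) / 2))"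

lemma gauss_has_derivative: "(gauss has_derivative (\<lambda>h. of_real (- (x \<bullet> h)) * gauss x)) (at x)"
  unfolding gauss_def
  by (auto intro!: derivative_eq_intros has_derivative_of_real simp: inner_commute mult_ac)

lemma continuous_gauss: "continuous_on UNIV gauss"
  unfolding gauss_def by (intro continuous_intros) auto

lemma rapid_gauss: "rapid (gauss :: real^'n::finite \<Rightarrow> complex)"
  unfolding rapid_def
proof (intro conjI continuous_gauss allI exI)
  fix p :: nat and x :: "real^'n"
  have "(1 + norm x) ^ p / fact p \<le> exp (1 + norm x)"
    by (rule power_div_fact_le_exp) simp
  then have "(1 + norm x) ^ p \<le> fact p * exp (1 + norm x)" by (simp add: field_simps)
  then have "(1 + norm x) ^ p * exp (- (x \<bullet> x) / 2) \<le> fact p * exp (1 + norm x) * exp (- (x \<bullet> x) / 2)"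
    by (intro mult_right_mono) auto
  also have "\<dots> = fact p * exp (1 + norm x - (norm x)\<^sup>2 / 2)"
    by (simp add: exp_add[symmetric] power2_norm_eq_inner mult.assoc)
  also have "\<dots> \<le> fact p * exp 2"
  proof -
    have "0 \<le> (norm x - 1)\<^sup>2" by simp
    then have "1 + norm x - (norm x)\<^sup>2 / 2 \<le> 2" by (simp add: power2_eq_square algebra_simps)
    then show ?thesis by simp
  qed
  finally show "(1 + norm x) ^ p * norm (gauss x) \<le> fact p * exp 2" by (simp add: gauss_def)
qed

lemma partial_deriv_gauss: "partial_deriv i gauss = (\<lambda>x. - of_real (x $ i) * gauss x)"
  by (rule ext) (simp add: partial_deriv_eq[OF gauss_has_derivative] inner_axis)

text \<open>The transform \<open>K\<close> of the Gaussian satisfies \<open>\<partial>\<^sub>i K = - z\<^sub>i K\<close>, so that \<open>K \<cdot> exp (|z|\<^sup>2 / 2)\<close>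
  is constant.\<close>

lemma osc_integral_gauss:
  fixes z :: "real^'n::finite"
  shows "osc_integral 1 gauss z = osc_integral 1 gauss (0 :: real^'n) * gauss z"
proof -
  let ?K = "osc_integral 1 (gauss :: real^'n \<Rightarrow> complex)"
  define E where "E z = complex_of_real (exp ((z \<bullet> z) / 2))" for z :: "real^'n"
  have E: "(E has_derivative (\<lambda>h. of_real (z \<bullet> h) * E z)) (at z)" for z
    unfolding E_def by (auto intro!: derivative_eq_intros has_derivative_of_real simp: inner_commute
        mult_ac)
  have rap: "rapid (\<lambda>x. - of_real (x $ i) * gauss x)" for i :: 'n
    using rapid_mult_coord[OF rapid_gauss, of "- 1" i] by simp
  \<comment> \<open>Since \<open>x $ i * gauss x\<close> is minus a derivative of the Gaussian,
    integration by parts turns the factor \<open>x $ i\<close> under the integral into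
    \<open>z $ i\<close> in front of it.\<close>
  have i: "osc_integral 1 (\<lambda>x. \<i> * of_real 1 * of_real (x $ i) * gauss x) z =
      - of_real (z $ i) * ?K z" for i z
  proof -
    have "osc_integral 1 (\<lambda>x. \<i> * of_real 1 * of_real (x $ i) * gauss x) z =
        - \<i> * osc_integral 1 (partial_deriv i gauss) z"
      unfolding osc_integral_def partial_deriv_gauss by (subst integral_mult_right_zero[symmetric])
          (simp add: mult_ac)
    also have "\<dots> = - \<i> * (- (\<i> * of_real (1 * z $ i)) * ?K z)"
      by (subst osc_integral_partial_deriv)
        (use gauss_has_derivative rap rapid_gauss in \<open>auto simp: partial_deriv_gauss intro:
            differentiableI\<close>)
    finally show ?thesis by (simp add: mult.assoc[symmetric])
  qed
  have K: "(?K has_derivative (\<lambda>h. - of_real (z \<bullet> h) * ?K z)) (at z)" for z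
  proof -
    have "(\<Sum>i\<in>UNIV. h $ i *\<^sub>R (- of_real (z $ i) * ?K z)) = - of_real (z \<bullet> h) * ?K z" for h
      by (simp add: inner_vec_def scaleR_conv_of_real sum_distrib_right sum_distrib_left sum_negf
          mult_ac)
    then show ?thesis
      using osc_integral_has_derivative[OF rapid_gauss, of 1 z] unfolding i by simp
  qed
  have "((\<lambda>z. ?K z * E z) has_derivative (\<lambda>h. 0)) (at z)" for z
    using has_derivative_mult[OF K E, of z] by (simp add: algebra_simps)
  then obtain c where c: "\<And>z. ?K z * E z = c"
    using has_derivative_zero_constant[of UNIV "\<lambda>z. ?K z * E z"] by auto
  have "E z * gauss z = 1" by (simp add: E_def gauss_def exp_minus field_simps flip: of_real_mult)
  then have "?K z = (?K z * E z) * gauss z" by (simp add: mult.assoc)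
  also have "\<dots> = (?K 0 * E 0) * gauss z" by (simp add: c)
  also have "\<dots> = ?K 0 * gauss z" by (simp add: E_def)
  finally show ?thesis .
qed

text \<open>Inversion divides by the square of this constant, so it has to be nonzero: it is the
  integral of a positive function. Its numerical value is never computed.\<close>

lemma osc_integral_gauss_0: "osc_integral 1 (gauss :: real^'n::finite \<Rightarrow> complex) 0 \<noteq> 0"
proof
  let ?g = "\<lambda>x::real^'n. exp (- (x \<bullet> x) / 2)"
  assume "osc_integral 1 (gauss :: real^'n \<Rightarrow> complex) 0 = 0"
  then have 0: "(LINT x|lborel. ?g x) = 0"
    by (simp add: osc_integral_def gauss_def)
  have "integrable lborel ?g"
    using integrable_norm[OF rapid_integrable[OF rapid_gauss, where 'a = 'n]] by (simp add: gauss_def)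
  then have "AE x in lborel. ?g x = 0"
    using 0 by (subst (asm) integral_nonneg_eq_0_iff_AE) auto
  then have "AE x in (lborel :: (real^'n) measure). False" by simp
  then show False
    by (simp add: AE_iff_null null_sets_def)
qed

text \<open>Fubini's theorem and the symmetry of the kernel. In the inversion formula it moves the
  transform from \<open>g\<close> to a modulated Gaussian, whose transform is explicit.\<close>

lemma osc_integral_multiplication:
  fixes u v :: "real^'n::finite \<Rightarrow> complex"
  assumes u: "integrable lborel u" and v: "integrable lborel v"
  shows "(LINT \<xi>|lborel. osc_integral s u \<xi> * v \<xi>) = (LINT x|lborel. u x * osc_integral s v x)"
proof -
  let ?f = "\<lambda>x \<xi>. u x * v \<xi> * exp (\<i> * complex_of_real (s * (x \<bullet> \<xi>)))"
  have [measurable]: "u \<in> borel_measurable borel" "v \<in> borel_measurable borel"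
    using borel_measurable_integrable[OF u] borel_measurable_integrable[OF v] by auto
  have "integrable (lborel \<Otimes>\<^sub>M lborel) (case_prod ?f)"
  proof (rule lborel_pair.Fubini_integrable)
    show "case_prod ?f \<in> borel_measurable (lborel \<Otimes>\<^sub>M lborel)" by measurable
    show "integrable lborel (\<lambda>x. LINT y|lborel. norm (case (x, y) of (x, \<xi>) \<Rightarrow> ?f x \<xi>))"
      using integrable_norm[OF u] by (simp add: norm_mult)
    show "AE x in lborel. integrable lborel (\<lambda>y. case (x, y) of (x, \<xi>) \<Rightarrow> ?f x \<xi>)"
    proof (rule AE_I2)
      fix x :: "real^'n"
      have "integrable lborel (\<lambda>y. u x * (v y * exp (\<i> * of_real (s * (y \<bullet> x)))))"
        using v by (intro integrable_mult_right integrable_mult_exp_i)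
      then show "integrable lborel (\<lambda>y. case (x, y) of (x, \<xi>) \<Rightarrow> ?f x \<xi>)"
        by (simp add: inner_commute mult_ac)
    qed
  qed
  from lborel_pair.Fubini_integral[OF this]
  have "(LINT \<xi>|lborel. LINT x|lborel. ?f x \<xi>) = (LINT x|lborel. LINT \<xi>|lborel. ?f x \<xi>)" .
  moreover have "(LINT x|lborel. ?f x \<xi>) = osc_integral s u \<xi> * v \<xi>" for \<xi>
    unfolding osc_integral_def by (subst integral_mult_left_zero[symmetric]) (simp add: mult_ac)
  moreover have "(LINT \<xi>|lborel. ?f x \<xi>) = u x * osc_integral s v x" for x
    unfolding osc_integral_def by (subst integral_mult_right_zero[symmetric])
        (simp add: mult_ac inner_commute)
  ultimately show ?thesis by simp
qed

text \<open>The integral of the transform is regularized by Gaussians of growing width and its limit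
  is evaluated twice: directly, and after the transform has been moved to the Gaussians, where they
  form an approximate identity at \<open>x\<close>. One factor \<open>c\<close> comes from the
  transform of the Gaussian, the other from its integral.\<close>

lemma fourier_inversion:
  fixes g :: "real^'n::finite \<Rightarrow> complex"
  assumes g: "rapid g" and G: "rapid (osc_integral (- 1) g)"
  shows "osc_integral 1 (osc_integral (- 1) g) x = (osc_integral 1 (gauss :: real^'n \<Rightarrow> complex) 0)\<^sup>2
      * g x"
proof -
  let ?G = "osc_integral (- 1) g" and ?N = "DIM(real^'n)"
  define c where "c = osc_integral 1 (gauss :: real^'n \<Rightarrow> complex) 0"
  define \<epsilon> where "\<epsilon> n = 1 / real (Suc n)" for n
  have \<epsilon>: "0 < \<epsilon> n" for n by (simp add: \<epsilon>_def)
  have \<epsilon>0: "\<epsilon> \<longlonglongrightarrow> 0" unfolding \<epsilon>_def using LIMSEQ_inverse_real_of_nat by (simp add: inverse_eq_divide)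
  have [measurable]: "gauss \<in> borel_measurable (borel :: (real^'n) measure)" "g \<in> borel_measurable borel"
    "?G \<in> borel_measurable borel"
    using rapid_measurable g G rapid_gauss by auto
  have gauss_le: "norm (gauss y) \<le> 1" for y :: "real^'n" by (simp add: gauss_def)
  have gauss_tendsto: "(\<lambda>n. gauss (\<epsilon> n *\<^sub>R y)) \<longlonglongrightarrow> 1" for y :: "real^'n"
  proof -
    have "(\<lambda>n. gauss (\<epsilon> n *\<^sub>R y)) \<longlonglongrightarrow> gauss (0 *\<^sub>R y)"
      using continuous_gauss \<epsilon>0 
      by (intro continuous_on_tendsto_compose[of UNIV gauss] tendsto_intros) auto
    then show ?thesis by (simp add: gauss_def)
  qed
  \<comment> \<open>The Gaussian factor makes \<open>v n\<close> integrable, as the multiplication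
    formula demands, and tends to one pointwise as \<open>n\<close> grows.\<close>
  define v where "v n \<xi> = gauss (\<epsilon> n *\<^sub>R \<xi>) * exp (\<i> * of_real (1 * (\<xi> \<bullet> x)))" for n and \<xi> :: "real^'n"
  have lim1: "(\<lambda>n. LINT \<xi>|lborel. ?G \<xi> * v n \<xi>) \<longlonglongrightarrow> osc_integral 1 ?G x"
    unfolding osc_integral_def[of 1 ?G]
  proof (rule integral_dominated_convergence[where w = "\<lambda>\<xi>. norm (?G \<xi>)"])
    show "AE \<xi> in lborel. norm (?G \<xi> * v n \<xi>) \<le> norm (?G \<xi>)" for n
      using gauss_le by (auto simp: v_def norm_mult mult_le_cancel_left1 mult_left_le)
    show "AE \<xi> in lborel. (\<lambda>n. ?G \<xi> * v n \<xi>) \<longlonglongrightarrow> ?G \<xi> * exp (\<i> * of_real (1 * (\<xi> \<bullet> x)))"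
    proof (rule AE_I2)
      fix \<xi> :: "real^'n"
      have "(\<lambda>n. ?G \<xi> * v n \<xi>) \<longlonglongrightarrow> ?G \<xi> * (1 * exp (\<i> * of_real (1 * (\<xi> \<bullet> x))))"
        unfolding v_def by (intro tendsto_intros gauss_tendsto)
      then show "(\<lambda>n. ?G \<xi> * v n \<xi>) \<longlonglongrightarrow> ?G \<xi> * exp (\<i> * of_real (1 * (\<xi> \<bullet> x)))" by simp
    qed
    show "integrable lborel (\<lambda>\<xi>. norm (?G \<xi>))" using G by (intro integrable_norm rapid_integrable)
    show "(\<lambda>\<xi>. ?G \<xi> * v n \<xi>) \<in> borel_measurable lborel" for n unfolding v_def by measurable
  qed measurable
  have int_gauss: "integrable lborel (\<lambda>\<xi> :: real^'n. gauss (\<epsilon> n *\<^sub>R \<xi>))" for n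
  proof -
    have "integrable lborel (gauss :: real^'n \<Rightarrow> complex)" by (intro rapid_integrable rapid_gauss)
    then have "integrable (density (distr lborel borel (\<lambda>x::real^'n. 0 + \<epsilon> n *\<^sub>R x)) (\<lambda>_. \<bar>\<epsilon> n\<bar> ^
        ?N)) gauss"
      using lborel_affine[of "\<epsilon> n" "0 :: real^'n"] \<epsilon>[of n] by simp
    then have "integrable (distr lborel borel (\<lambda>x::real^'n. 0 + \<epsilon> n *\<^sub>R x)) (\<lambda>x. \<bar>\<epsilon> n\<bar> ^ ?N *\<^sub>R gauss x)"
      by (subst (asm) integrable_density) auto
    then have "integrable lborel (\<lambda>x::real^'n. \<bar>\<epsilon> n\<bar> ^ ?N *\<^sub>R gauss (0 + \<epsilon> n *\<^sub>R x))"
      by (subst (asm) integrable_distr_eq) auto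
    then have "integrable lborel (\<lambda>x::real^'n. (1 / \<bar>\<epsilon> n\<bar> ^ ?N) *\<^sub>R (\<bar>\<epsilon> n\<bar> ^ ?N *\<^sub>R gauss (0 + \<epsilon> n
        *\<^sub>R x)))"
      by (rule integrable_scaleR_right)
    then show ?thesis using \<epsilon>[of n] by simp
  qed
  have osc_v: "osc_integral (- 1) (v n) y = (1 / \<epsilon> n) ^ ?N *\<^sub>R (c * gauss ((1 / \<epsilon> n) *\<^sub>R (x - y)))"
      for n y
  proof -
    let ?f = "\<lambda>\<xi>. gauss (\<epsilon> n *\<^sub>R \<xi>) * exp (\<i> * of_real (1 * (\<xi> \<bullet> (x - y))))"
    have "osc_integral (- 1) (v n) y = (LINT \<xi>|lborel. ?f \<xi>)"
      unfolding osc_integral_def v_def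
      by (intro Bochner_Integration.integral_cong)
          (auto simp: mult.assoc exp_add[symmetric] inner_diff_right algebra_simps)
    also have "\<dots> = \<bar>1 / \<epsilon> n\<bar> ^ ?N *\<^sub>R (LINT \<xi>|lborel. ?f (0 + (1 / \<epsilon> n) *\<^sub>R \<xi>))"
      using \<epsilon>[of n] by (intro lborel_integral_affine) auto
    also have "(LINT \<xi>|lborel. ?f (0 + (1 / \<epsilon> n) *\<^sub>R \<xi>)) = osc_integral 1 gauss ((1 / \<epsilon> n) *\<^sub>R (x - y))"
      unfolding osc_integral_def using \<epsilon>[of n] by (intro Bochner_Integration.integral_cong) auto
    also have "\<dots> = c * gauss ((1 / \<epsilon> n) *\<^sub>R (x - y))"
      unfolding c_def by (rule osc_integral_gauss)
    finally show ?thesis using \<epsilon>[of n] by simp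
  qed
  have "(LINT \<xi>|lborel. ?G \<xi> * v n \<xi>) = (LINT w|lborel. c * (g (x + \<epsilon> n *\<^sub>R w) * gauss w))" for n
  proof -
    let ?f = "\<lambda>y. g y * ((1 / \<epsilon> n) ^ ?N *\<^sub>R (c * gauss ((1 / \<epsilon> n) *\<^sub>R (x - y))))"
    have "(LINT \<xi>|lborel. ?G \<xi> * v n \<xi>) = (LINT y|lborel. g y * osc_integral (- 1) (v n) y)"
      unfolding v_def by (intro osc_integral_multiplication integrable_mult_exp_i int_gauss
          rapid_integrable g)
    also have "\<dots> = (LINT y|lborel. ?f y)" unfolding osc_v ..
    also have "\<dots> = \<bar>\<epsilon> n\<bar> ^ ?N *\<^sub>R (LINT w|lborel. ?f (x + \<epsilon> n *\<^sub>R w))"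
      using \<epsilon>[of n] by (intro lborel_integral_affine) auto
    also have "\<dots> = (LINT w|lborel. \<bar>\<epsilon> n\<bar> ^ ?N *\<^sub>R ?f (x + \<epsilon> n *\<^sub>R w))"
      by (simp only: integral_scaleR_right)
    also have "\<dots> = (LINT w|lborel. c * (g (x + \<epsilon> n *\<^sub>R w) * gauss w))"
    proof (intro Bochner_Integration.integral_cong refl)
      fix w :: "real^'n"
      have "gauss (- w) = gauss w" by (simp add: gauss_def)
      moreover have "(1 / \<epsilon> n) *\<^sub>R (x - (x + \<epsilon> n *\<^sub>R w)) = - w" using \<epsilon>[of n] by simp
      moreover have "\<epsilon> n ^ ?N * (1 / \<epsilon> n) ^ ?N = 1" using \<epsilon>[of n] by (simp flip: power_mult_distrib)
      ultimately show "\<bar>\<epsilon> n\<bar> ^ ?N *\<^sub>R ?f (x + \<epsilon> n *\<^sub>R w) = c * (g (x + \<epsilon> n *\<^sub>R w) * gauss w)"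
        using \<epsilon>[of n] by (simp add: mult_ac del: DIM_cart)
    qed
    finally show ?thesis .
  qed
  moreover have "(\<lambda>n. LINT w|lborel. c * (g (x + \<epsilon> n *\<^sub>R w) * gauss w)) \<longlonglongrightarrow> (LINT w|(lborel ::
      (real^'n) measure). c * (g x * gauss w))"
  proof -
    obtain B where B: "\<And>y. norm (g y) \<le> B" using rapid_bound[OF g, of 0] by auto
    show ?thesis
    proof (rule integral_dominated_convergence[where w = "\<lambda>w::real^'n. norm c * B * norm (gauss w)"])
      show "integrable lborel (\<lambda>w::real^'n. norm c * B * norm (gauss w))"
        by (intro integrable_mult_right integrable_norm rapid_integrable rapid_gauss)
      show "AE w in lborel. norm (c * (g (x + \<epsilon> n *\<^sub>R w) * gauss w)) \<le> norm c * B * norm (gauss w)" for n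
        using B by (auto simp: norm_mult mult.assoc intro!: mult_left_mono mult_right_mono)
      show "AE w in lborel. (\<lambda>n. c * (g (x + \<epsilon> n *\<^sub>R w) * gauss w)) \<longlonglongrightarrow> c * (g x * gauss w)"
      proof (rule AE_I2)
        fix w :: "real^'n"
        have "(\<lambda>n. g (x + \<epsilon> n *\<^sub>R w)) \<longlonglongrightarrow> g (x + 0 *\<^sub>R w)"
          using g \<epsilon>0 by (intro continuous_on_tendsto_compose[of UNIV g] tendsto_intros)
              (auto simp: rapid_def)
        then show "(\<lambda>n. c * (g (x + \<epsilon> n *\<^sub>R w) * gauss w)) \<longlonglongrightarrow> c * (g x * gauss w)"
          by (auto intro!: tendsto_intros)
      qed
    qed measurable
  qed
  ultimately have "osc_integral 1 ?G x = (LINT w|(lborel :: (real^'n) measure). c * (g x * gauss w))"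
    using lim1 LIMSEQ_unique by auto
  also have "\<dots> = c * g x * (LINT w|lborel. (gauss :: real^'n \<Rightarrow> complex) w)"
    by (simp only: mult.assoc integral_mult_right_zero)
  also have "(LINT w|lborel. (gauss :: real^'n \<Rightarrow> complex) w) = c"
    by (simp add: c_def osc_integral_def)
  finally show ?thesis by (simp add: c_def power2_eq_square mult_ac)
qed

section \<open>The space of test functions\<close>

definition index_words :: "'n::finite list set" where
  "index_words = range (index_word coord_list)"

lemma index_words_subseq: "w \<in> index_words \<Longrightarrow> subseq u w \<Longrightarrow> u \<in> index_words"
  using subseq_index_word[OF coord_list(2)] unfolding index_words_def by blast

lemma index_word_single: "distinct L \<Longrightarrow> i \<in> set L \<Longrightarrow> index_word L (\<lambda>j.
    if j = i then k else 0) = replicate k i"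
proof (induction L)
  case (Cons j L)
  have "index_word L (\<lambda>j. if j = i then k else 0) = []" if "i \<notin> set L"
    using that by (auto simp: index_word_def)
  then show ?case using Cons by (auto simp: index_word_Cons)
qed simp

text \<open>Pure derivatives in one coordinate are among the admissible words; they are the ones
  used to estimate the decay of Fourier transforms.\<close>

lemma replicate_in_index_words: "replicate k i \<in> index_words"
proof -
  have "replicate k i = index_word coord_list (\<lambda>j. if j = i then k else 0)"
    by (rule index_word_single[symmetric]) (simp_all add: coord_list)
  then show ?thesis by (simp add: index_words_def)
qed

lemma Nil_in_index_words: "[] \<in> index_words"
  using replicate_in_index_words[of 0] by simp

context weight
begin

text \<open>The positive weights \<open>l = n\<close> belong to the norms \<open>q\<^bsub>m,n\<^esub>\<close>, the negative ones \<open>l = - n\<close> to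
  \<open>r\<^bsub>m,n\<^esub>\<close>.\<close>

definition deriv_bounded :: "nat \<Rightarrow> real \<Rightarrow> real \<Rightarrow> (real^'n::finite \<Rightarrow> complex) \<Rightarrow> bool" where
  "deriv_bounded m l C f \<longleftrightarrow> (\<forall>w\<in>index_words. \<forall>x.
    exp (l * \<omega> (norm x)) * norm (word_deriv w f x) * winf m (length w) \<le> C)"

abbreviation q_bounded :: "nat \<Rightarrow> nat \<Rightarrow> real \<Rightarrow> (real^'n::finite \<Rightarrow> complex) \<Rightarrow> bool" where
  "q_bounded m n \<equiv> deriv_bounded m (real n)"

abbreviation r_bounded :: "nat \<Rightarrow> nat \<Rightarrow> real \<Rightarrow> (real^'n::finite \<Rightarrow> complex) \<Rightarrow> bool" where
  "r_bounded m n \<equiv> deriv_bounded m (- real n)"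

lemma r_bounded_iff:
  "r_bounded m n C f \<longleftrightarrow> (\<forall>w\<in>index_words. \<forall>x.
    norm (word_deriv w f x) * winf m (length w) \<le> C * exp (real n * \<omega> (norm x)))"
  by (simp add: deriv_bounded_def exp_minus field_simps)

text \<open>The bridge from norms with extended values to inequalities between reals. The sign
  condition on \<open>C\<close> matters because \<open>ennreal\<close> maps negative numbers to
  zero.\<close>

lemma q_norm_le_iff:
  assumes m: "1 \<le> m" and C: "0 \<le> C"
  shows "q_norm \<omega> m n f \<le> ennreal C \<longleftrightarrow> q_bounded m n C f"
proof -
  have "q_norm \<omega> m n f = (SUP \<alpha>. SUP x. ennreal (exp (real n * \<omega> (norm x)) *
      norm (multi_deriv \<alpha> f x) * winf m (mi_length \<alpha>)))"
    using exp_ereal_young_conj[OF m, of 0]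
    by (simp add: q_norm_def wsup_def SUP_mult_right_ennreal[symmetric] ennreal_mult winf_nonneg
        zero_ereal_def[symmetric] flip: SUP_mult_right_ennreal)
  then show ?thesis
    using C by (auto simp: SUP_le_iff deriv_bounded_def index_words_def multi_deriv_eq
        length_index_word_coord_list)
qed

lemma r_norm_le_iff:
  assumes m: "1 \<le> m" and C: "0 \<le> C"
  shows "r_norm \<omega> m n f \<le> ennreal C \<longleftrightarrow> r_bounded m n C f"
proof -
  have "r_norm \<omega> m n f = (SUP \<alpha>. SUP x. ennreal (norm (multi_deriv \<alpha> f x) *
      (exp (- (real n * \<omega> (norm x))) * winf m (mi_length \<alpha>))))"
    unfolding r_norm_def uminus_ereal.simps(1)[symmetric] exp_ereal_young_conj[OF m]
    by (simp add: ennreal_mult winf_nonneg)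
  then show ?thesis
    using C by (simp add: SUP_le_iff r_bounded_iff index_words_def multi_deriv_eq
        length_index_word_coord_list exp_minus field_simps)
qed

section \<open>The product estimate\<close>

lemma deriv_bounded_mono:
  fixes f :: "real^'n::finite \<Rightarrow> complex"
  assumes f: "deriv_bounded m l C f" and le: "m' \<le> m" "l' \<le> l" "C \<le> C'"
  shows "deriv_bounded m' l' C' f"
  unfolding deriv_bounded_def
proof (intro ballI allI)
  fix w :: "'n list" and x :: "real^'n" assume w: "w \<in> index_words"
  have "exp (l' * \<omega> (norm x)) * norm (word_deriv w f x) * winf m' (length w) \<le>
      exp (l * \<omega> (norm x)) * norm (word_deriv w f x) * winf m (length w)"
    using le weight_nonneg[of "norm x"] winf_nonneg
    by (intro mult_mono winf_mono) (auto intro!: mult_right_mono)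
  also have "\<dots> \<le> C" using f w by (simp add: deriv_bounded_def)
  finally show "exp (l' * \<omega> (norm x)) * norm (word_deriv w f x) * winf m' (length w) \<le> C'"
    using le by simp
qed

text \<open>\<open>D\<close> and \<open>m'\<close> are chosen before \<open>n\<close> and
  \<open>n'\<close>, so that one \<open>m'\<close> serves all steps of the inductive limit at once.
  The growth of \<open>f\<close> is paid for by the surplus \<open>n'\<close> in the weight of
  \<open>g\<close>.\<close>

lemma q_bounded_mult:
  "\<exists>D>0. \<exists>m'\<ge>m. \<forall>n n' R Q. \<forall>f g :: real^'n::finite \<Rightarrow> complex.
    smooth f \<longrightarrow> smooth g \<longrightarrow> 0 \<le> R \<longrightarrow> 0 \<le> Q \<longrightarrow> r_bounded m' n' R f \<longrightarrow> q_bounded m' (n + n') Q g \<longrightarrow>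
    q_bounded m n (D * R * Q) (f * g)"
proof -
  obtain D m' where D: "0 < D" "m \<le> m'" "\<And>k. 2 ^ k * winf m k \<le> D * winf m' k"
    using winf_pow2[of m] by auto
  have "q_bounded m n (D * R * Q) (f * g)"
    if f: "smooth f" "r_bounded m' n' R f" and g: "smooth g" "q_bounded m' (n + n') Q g" and RQ: "0
        \<le> R" "0 \<le> Q"
    for n n' R Q and f g :: "real^'n \<Rightarrow> complex"
    unfolding deriv_bounded_def
  proof (intro ballI allI)
    fix w :: "'n list" and x :: "real^'n" assume w: "w \<in> index_words"
    let ?k = "length w" and ?e = "\<lambda>n. exp (real n * \<omega> (norm x))"
    show "?e n * norm (word_deriv w (f * g) x) * winf m ?k \<le> D * R * Q"
    \<comment> \<open>The bounds with \<open>m'\<close> carry no information at this order, but then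
      the weight in the claim vanishes as well, since \<open>winf\<close> increases with
      \<open>m\<close>.\<close>
    proof (cases "winf m' ?k = 0")
      case True
      then have "winf m ?k = 0" using winf_mono[OF D(2), of ?k] winf_nonneg[of m ?k] by simp
      then show ?thesis using D RQ by simp
    next
      case False
      then have W: "0 < winf m' ?k" using winf_nonneg[of m' ?k] by simp
      define B where "B = R * Q / (?e n * winf m' ?k)"
      have "norm (word_deriv w (f * g) x) \<le> 2 ^ ?k * B"
      proof (rule norm_word_deriv_mult_le[OF f(1) g(1)])
        fix u v assume uv: "subseq u w" "subseq v w" "length u + length v = ?k"
        let ?f = "norm (word_deriv u f x)" and ?g = "norm (word_deriv v g x)"
        have "?f * winf m' (length u) \<le> R * ?e n'"
          using f(2) index_words_subseq[OF w uv(1)] by (simp add: r_bounded_iff)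
        moreover have "?e (n + n') * ?g * winf m' (length v) \<le> Q"
          using g(2) index_words_subseq[OF w uv(2)] by (simp add: deriv_bounded_def)
        ultimately have "(?f * winf m' (length u)) * (?e (n + n') * ?g * winf m' (length v)) \<le>
            (R * ?e n') * Q"
          using RQ by (intro mult_mono'[where b = "R * ?e n'"] mult_nonneg_nonneg winf_nonneg) auto
        then have "?e n' * (?f * ?g * ?e n * (winf m' (length u) * winf m' (length v))) \<le>
            ?e n' * (R * Q)"
          unfolding of_nat_add distrib_right exp_add by (simp only: mult_ac)
        then have "?f * ?g * ?e n * (winf m' (length u) * winf m' (length v)) \<le> R * Q" by simp
        moreover have "?f * ?g * ?e n * winf m' ?k \<le> ?f * ?g * ?e n * (winf m' (length u) * winf m'
            (length v))"
          unfolding uv(3)[symmetric] by (intro mult_left_mono winf_add_le) auto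
        ultimately have "?f * ?g * (?e n * winf m' ?k) \<le> R * Q" by (simp add: mult.assoc)
        then show "?f * ?g \<le> B" unfolding B_def using W by (simp add: pos_le_divide_eq)
      qed
      then have "?e n * norm (word_deriv w (f * g) x) * winf m ?k \<le> ?e n * (2 ^ ?k * B) * winf m ?k"
        by (intro mult_right_mono mult_left_mono winf_nonneg) auto
      also have "\<dots> = (R * Q / winf m' ?k) * (2 ^ ?k * winf m ?k)"
        by (simp add: B_def)
      also have "\<dots> \<le> (R * Q / winf m' ?k) * (D * winf m' ?k)"
        using RQ W by (intro mult_left_mono D) auto
      also have "\<dots> = D * R * Q" using W by simp
      finally show ?thesis .
    qed
  qed
  then show ?thesis using D by blast
qed

definition q_finite :: "(real^'n::finite \<Rightarrow> complex) \<Rightarrow> bool" where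
  "q_finite f \<longleftrightarrow> smooth f \<and> (\<forall>m n. \<exists>C\<ge>0. q_bounded m n C f)"

text \<open>For a fixed word the factor \<open>winf m\<close> can be divided out, provided that
  \<open>m\<close> is taken large enough for it to be positive.\<close>

lemma q_finite_decay:
  assumes f: "q_finite f" and w: "w \<in> index_words"
  shows "\<exists>C\<ge>0. \<forall>x. exp (real n * \<omega> (norm x)) * norm (word_deriv w f x) \<le> C"
proof -
  obtain m where m: "0 < winf m (length w)" using winf_pos[of "length w"] by blast
  obtain C where C: "0 \<le> C" "q_bounded m n C f" using f by (auto simp: q_finite_def)
  have "exp (real n * \<omega> (norm x)) * norm (word_deriv w f x) \<le> C / winf m (length w)" for x
    using C w m by (simp add: deriv_bounded_def pos_le_divide_eq)
  then show ?thesis using C m by (intro exI[of _ "C / winf m (length w)"]) auto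
qed

lemma rapid_if_weight_bounded:
  assumes "continuous_on UNIV u"
    and "\<And>n. \<exists>C\<ge>0. \<forall>x. exp (real n * \<omega> (norm x)) * norm (u x) \<le> C"
  shows "rapid u"
  unfolding rapid_def
proof (intro conjI allI assms(1))
  fix p :: nat
  obtain n D where n: "0 < D" "\<And>t. 0 \<le> t \<Longrightarrow> (1 + t) ^ p \<le> D * exp (real n * \<omega> t)"
    using weight_log_power[of p] by blast
  obtain C where C: "0 \<le> C" "\<And>x. exp (real n * \<omega> (norm x)) * norm (u x) \<le> C"
    using assms(2) by blast
  have "(1 + norm x) ^ p * norm (u x) \<le> D * C" for x
  proof -
    have "(1 + norm x) ^ p * norm (u x) \<le> (D * exp (real n * \<omega> (norm x))) * norm (u x)"
      by (intro mult_right_mono n) auto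
    also have "\<dots> = D * (exp (real n * \<omega> (norm x)) * norm (u x))" by simp
    also have "\<dots> \<le> D * C" using n by (intro mult_left_mono C) auto
    finally show ?thesis .
  qed
  then show "\<exists>C. \<forall>x. (1 + norm x) ^ p * norm (u x) \<le> C" by blast
qed

lemma q_finite_smooth: "q_finite f \<Longrightarrow> smooth f"
  by (simp add: q_finite_def)

lemma q_finite_rapid: "q_finite f \<Longrightarrow> w \<in> index_words \<Longrightarrow> rapid (word_deriv w f)"
  by (intro rapid_if_weight_bounded q_finite_decay smooth_continuous smooth_word_deriv q_finite_smooth)

text \<open>Applied to general multipliers and, in the Fourier estimates, to coordinate
  functions.\<close>

lemma q_finite_mult:
  assumes f: "smooth f" "\<And>m. \<exists>n R. 0 \<le> R \<and> r_bounded m n R f" and g: "q_finite g"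
  shows "q_finite (f * g)"
  unfolding q_finite_def
proof (intro conjI allI)
  show "smooth (f * g)" using f(1) q_finite_smooth[OF g] by (rule smooth_mult)
  fix m n
  obtain D m' where D: "0 < D" "\<And>n n' R Q f g. smooth f \<Longrightarrow> smooth g \<Longrightarrow> 0 \<le> R \<Longrightarrow> 0 \<le> Q \<Longrightarrow>
      r_bounded m' n' R f \<Longrightarrow> q_bounded m' (n + n') Q g \<Longrightarrow> q_bounded m n (D * R * Q) (f * (g :: real^'a
          \<Rightarrow> complex))"
    using q_bounded_mult[of m] by blast
  obtain n' R where R: "0 \<le> R" "r_bounded m' n' R f" using f by blast
  obtain Q where Q: "0 \<le> Q" "q_bounded m' (n + n') Q g" using g unfolding q_finite_def by blast
  show "\<exists>C\<ge>0. q_bounded m n C (f * g)"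
    using D(2)[OF f(1) q_finite_smooth[OF g] R(1) Q(1) R(2) Q(2)] D(1) R(1) Q(1)
    by (intro exI[of _ "D * R * Q"]) auto
qed

section \<open>Decay of Fourier transforms\<close>

lemma partial_deriv_coord:
  "partial_deriv j (\<lambda>x::real^'n::finite. c * of_real (x $ i)) = (\<lambda>x. if j = i then c else 0)"
proof
  fix x :: "real^'n"
  have "((\<lambda>x::real^'n. c * of_real (x $ i)) has_derivative (\<lambda>h. c * of_real (h $ i))) (at x)"
    by (intro has_derivative_mult_right has_derivative_of_real bounded_linear_imp_has_derivative
        bounded_linear_vec_nth)
  then show "partial_deriv j (\<lambda>x::real^'n. c * of_real (x $ i)) x = (if j = i then c else 0)"
    by (simp add: partial_deriv_eq axis_def)
qed

lemma word_deriv_coord: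
  "word_deriv w (\<lambda>x::real^'n::finite. c * of_real (x $ i)) = (\<lambda>x. c * of_real (x $ i)) \<or>
    (\<exists>d. norm d \<le> norm c \<and> word_deriv w (\<lambda>x::real^'n. c * of_real (x $ i)) = (\<lambda>x. d))"
proof (induction w)
  case (Cons j w)
  then have "word_deriv (j # w) (\<lambda>x::real^'n. c * of_real (x $ i)) = (\<lambda>x. if j = i then c else 0) \<or>
      word_deriv (j # w) (\<lambda>x::real^'n. c * of_real (x $ i)) = (\<lambda>x. 0)"
    by (auto simp: partial_deriv_coord partial_deriv_const)
  moreover have "norm (if j = i then c else 0) \<le> norm c" "norm (0 :: complex) \<le> norm c" by auto
  ultimately show ?case by blast
qed simp

lemma smooth_coord: "smooth (\<lambda>x::real^'n::finite. c * of_real (x $ i))"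
proof (rule smooth_coinduct[where X = "\<lambda>f. f = (\<lambda>x. c * of_real (x $ i)) \<or> (\<exists>d. f = (\<lambda>x. d))"])
  fix g :: "real^'n \<Rightarrow> complex" and x
  assume "g = (\<lambda>x. c * of_real (x $ i)) \<or> (\<exists>d. g = (\<lambda>x. d))"
  moreover have "(\<lambda>x::real^'n. c * of_real (x $ i)) differentiable at x"
    by (rule differentiableI, rule has_derivative_mult_right, rule has_derivative_of_real,
        rule bounded_linear_imp_has_derivative, rule bounded_linear_vec_nth)
  ultimately show "g differentiable at x" by auto
qed (auto simp: partial_deriv_coord partial_deriv_const)

text \<open>Linear functions are multipliers: their derivatives grow at most like
  \<open>1 + norm x\<close>, which is dominated by \<open>exp (p * \<omega> (norm x))\<close> with
  the same \<open>p\<close> for every \<open>m\<close>.\<close>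

lemma q_finite_mult_coord:
  assumes h: "q_finite h"
  shows "q_finite (\<lambda>x::real^'n::finite. c * of_real (x $ i) * h x)"
proof -
  let ?f = "\<lambda>x::real^'n. c * of_real (x $ i)"
  obtain p C where pC: "0 < C" "\<And>t. 0 \<le> t \<Longrightarrow> 1 + t \<le> C * exp (real p * \<omega> t)"
    by (rule weight_log) blast
  have "r_bounded m p (norm c * C) ?f" for m
    unfolding r_bounded_iff
  proof (intro ballI allI)
    fix w and x :: "real^'n"
    have "norm (word_deriv w ?f x) \<le> norm c * (1 + norm x)"
    proof -
      have "norm c * \<bar>x $ i\<bar> \<le> norm c * (1 + norm x)"
        using component_le_norm_cart[of x i] by (intro mult_left_mono) auto
      moreover have "norm c \<le> norm c * (1 + norm x)" by (simp add: distrib_left)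
      ultimately show ?thesis using word_deriv_coord[of w c i] by (auto simp: norm_mult)
    qed
    also have "\<dots> \<le> norm c * (C * exp (real p * \<omega> (norm x)))"
      by (intro mult_left_mono pC) auto
    finally have "norm (word_deriv w ?f x) * winf m (length w) \<le>
        (norm c * (C * exp (real p * \<omega> (norm x)))) * 1"
      using pC by (intro mult_mono winf_le_1 winf_nonneg) auto
    then show "norm (word_deriv w ?f x) * winf m (length w) \<le> norm c * C * exp (real p * \<omega> (norm x))"
      by (simp add: mult.assoc)
  qed
  then have "q_finite (?f * h)"
    using pC(1) by (intro q_finite_mult smooth_coord h exI[of _ p] exI[of _ "norm c * C"]) auto
  then show ?thesis by (simp add: times_fun_def)
qed

lemma q_finite_rapid_self: "q_finite f \<Longrightarrow> rapid f"
  using q_finite_rapid[OF _ Nil_in_index_words] by simp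

text \<open>Reduces the decay of all derivatives of a transform to the decay of undifferentiated
  transforms.\<close>

lemma word_deriv_osc_integral_q_finite:
  "q_finite h \<Longrightarrow> \<exists>h'. q_finite h' \<and> word_deriv w (osc_integral s h) = osc_integral s h'"
proof (induction w)
  case (Cons i w)
  then obtain h' where "q_finite h'" "word_deriv w (osc_integral s h) = osc_integral s h'" by blast
  then show ?case
    using q_finite_mult_coord[of h' "\<i> * of_real s" i]
    by (intro exI[of _ "\<lambda>x. \<i> * of_real s * of_real (x $ i) * h' x"])
      (simp add: partial_deriv_osc_integral q_finite_rapid_self)
qed auto

lemma weight_bounded_integral:
  "\<exists>n::nat. \<exists>J\<ge>0. \<forall>C\<ge>0. \<forall>u :: real^'n::finite \<Rightarrow> complex. integrable lborel u \<longrightarrow>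
    (\<forall>x. exp (real n * \<omega> (norm x)) * norm (u x) \<le> C) \<longrightarrow> (LINT x|lborel. norm (u x)) \<le> C * J"
proof -
  let ?p = "DIM(real^'n) + 2" and ?d = "\<lambda>x::real^'n. 1 / (1 + norm x) ^ (DIM(real^'n) + 2)"
  obtain n D where n: "0 < D" "\<And>t. 0 \<le> t \<Longrightarrow> (1 + t) ^ ?p \<le> D * exp (real n * \<omega> t)"
    using weight_log_power[of ?p] by blast
  have "(LINT x|lborel. norm (u x)) \<le> C * (D * (LINT x|lborel. ?d x))"
    if C: "0 \<le> C" "integrable lborel u" "\<And>x. exp (real n * \<omega> (norm x)) * norm (u x) \<le> C"
    for C and u :: "real^'n \<Rightarrow> complex"
  proof -
    have "(LINT x|lborel. norm (u x)) \<le> (LINT x|lborel. C * D * ?d x)"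
    proof (rule integral_mono)
      fix x :: "real^'n"
      have "(1 + norm x) ^ ?p * norm (u x) \<le> (D * exp (real n * \<omega> (norm x))) * norm (u x)"
        by (intro mult_right_mono n) auto
      also have "\<dots> \<le> D * C" using mult_left_mono[OF C(3)[of x], of D] n by (simp add: mult.assoc)
      finally show "norm (u x) \<le> C * D * ?d x"
        by (simp add: pos_le_divide_eq add_pos_nonneg mult_ac)
    next
      show "integrable lborel (\<lambda>x::real^'n. C * D * ?d x)"
        by (intro integrable_mult_right integrable_inverse_power_norm)
    qed (use C in simp)
    also have "\<dots> = C * (D * (LINT x|lborel. ?d x))"
      by (simp only: integral_mult_right_zero mult.assoc)
    finally show ?thesis .
  qed
  moreover have "0 \<le> D * (LINT x|lborel. ?d x)" using n(1)
      by (intro mult_nonneg_nonneg integral_nonneg) auto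
  ultimately show ?thesis by blast
qed

lemma norm_power_osc_integral:
  assumes h: "q_finite h"
  shows "\<bar>\<xi> $ i\<bar> ^ k * norm (osc_integral (- 1) h \<xi>) = norm (osc_integral (- 1) (word_deriv
      (replicate k i) h) \<xi>)"
proof (induction k)
  case (Suc k)
  have "osc_integral (- 1) (partial_deriv i (word_deriv (replicate k i) h)) \<xi> =
      - (\<i> * of_real (- 1 * \<xi> $ i)) * osc_integral (- 1) (word_deriv (replicate k i) h) \<xi>"
  proof (rule osc_integral_partial_deriv)
    show "rapid (partial_deriv i (word_deriv (replicate k i) h))"
      using q_finite_rapid[OF h replicate_in_index_words[of "Suc k" i]] by simp
  qed (use h in \<open>auto intro: smooth_differentiable smooth_word_deriv q_finite_smooth q_finite_rapid
      replicate_in_index_words\<close>)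
  then show ?case using Suc by (simp add: norm_mult mult.assoc)
qed simp

text \<open>Integration by parts in one coordinate bounds the transform times
  \<open>t ^ k * winf m k\<close> for every \<open>k\<close>, where \<open>t\<close> is the modulus
  of that coordinate. Choosing the best \<open>k\<close> recovers the exponential weight by
  biconjugation, and the largest coordinate is comparable with the norm.\<close>

lemma osc_integral_decay:
  assumes h: "q_finite (h :: real^'n::finite \<Rightarrow> complex)"
  shows "\<exists>C\<ge>0. \<forall>\<xi>. exp (real l * \<omega> (norm \<xi>)) * norm (osc_integral (- 1) h \<xi>) \<le> C"
proof -
  obtain n J where J: "0 \<le> J" "\<And>C u. 0 \<le> C \<Longrightarrow> integrable lborel u \<Longrightarrow>
    (\<And>x. exp (real n * \<omega> (norm x)) * norm (u x) \<le> C) \<Longrightarrow> (LINT x|lborel. norm ((u :: real^'n \<Rightarrow>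
        complex) x)) \<le> C * J"
    using weight_bounded_integral by metis
  obtain r :: nat where r: "real CARD('n) \<le> 2 ^ r" using real_arch_pow[of 2 "real CARD('n)"] by
      (auto intro: less_imp_le)
  obtain K :: nat where K: "\<And>t. 0 \<le> t \<Longrightarrow> \<omega> (2 ^ r * t) \<le> real K * (1 + \<omega> t)"
    using weight_dilate[of r] by blast
  obtain p D where D: "0 < D" "\<And>t. 0 \<le> t \<Longrightarrow> 1 + t \<le> D * exp (real p * \<omega> t)"
    by (rule weight_log) blast
  \<comment> \<open>The summand \<open>l * K\<close> pays for passing from the largest coordinate to
    the norm, the summand \<open>p\<close> for the factor \<open>t\<close> lost in
    biconjugation.\<close>
  define m where "m = p + l * K"
  obtain C where C: "0 \<le> C" "q_bounded m n C h" using h by (auto simp: q_finite_def)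
  have poly: "\<bar>\<xi> $ i\<bar> ^ k * winf m k * norm (osc_integral (- 1) h \<xi>) \<le> C * J" for \<xi> i k
  proof -
    let ?u = "word_deriv (replicate k i) h"
    have rap: "rapid ?u" by (rule q_finite_rapid[OF h replicate_in_index_words])
    have "\<bar>\<xi> $ i\<bar> ^ k * winf m k * norm (osc_integral (- 1) h \<xi>) =
        winf m k * norm (osc_integral (- 1) ?u \<xi>)"
      using norm_power_osc_integral[OF h, of \<xi> i k] by (simp add: mult_ac)
    also have "\<dots> \<le> winf m k * (LINT x|lborel. norm (?u x))"
      by (intro mult_left_mono norm_osc_integral_le rapid_integrable rap winf_nonneg)
    also have "\<dots> = (LINT x|lborel. norm (of_real (winf m k) * ?u x))"
      by (simp add: norm_mult winf_nonneg)
    also have "\<dots> \<le> C * J"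
    proof (rule J(2)[OF C(1)])
      fix x
      have "exp (real n * \<omega> (norm x)) * norm (?u x) * winf m (length (replicate k i)) \<le> C"
        using C(2) replicate_in_index_words unfolding deriv_bounded_def by blast
      then show "exp (real n * \<omega> (norm x)) * norm (of_real (winf m k) * ?u x) \<le> C"
        by (simp add: norm_mult winf_nonneg mult_ac)
    qed (intro integrable_mult_right rapid_integrable rap)
    finally show ?thesis .
  qed
  have "exp (real l * \<omega> (norm \<xi>)) * norm (osc_integral (- 1) h \<xi>) \<le>
      exp (real (l * K)) * D * (C * J)" for \<xi> :: "real^'n"
  proof -
    let ?F = "norm (osc_integral (- 1) h \<xi>)"
    obtain i where i: "\<And>j. \<bar>\<xi> $ j\<bar> \<le> \<bar>\<xi> $ i\<bar>"
    proof -
      have "Max (range (\<lambda>j. \<bar>\<xi> $ j\<bar>)) \<in> range (\<lambda>j. \<bar>\<xi> $ j\<bar>)" by (rule Max_in) auto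
      then obtain i where "Max (range (\<lambda>j. \<bar>\<xi> $ j\<bar>)) = \<bar>\<xi> $ i\<bar>" by (rule rangeE)
      then show ?thesis using that[of i] by (metis Max_ge finite_class.finite_UNIV finite_imageI rangeI)
    qed
    define t where "t = \<bar>\<xi> $ i\<bar>"
    have "norm \<xi> \<le> (\<Sum>j\<in>UNIV. \<bar>\<xi> $ j\<bar>)" by (rule norm_le_l1_cart)
    also have "\<dots> \<le> (\<Sum>j\<in>(UNIV :: 'n set). t)" unfolding t_def by (intro sum_mono i)
    also have "\<dots> = real CARD('n) * t" by simp
    also have "\<dots> \<le> 2 ^ r * t" using r by (intro mult_right_mono) (auto simp: t_def)
    finally have "\<omega> (norm \<xi>) \<le> \<omega> (2 ^ r * t)" by (intro weight_mono) auto
    also have "\<dots> \<le> real K * (1 + \<omega> t)" by (rule K) (simp add: t_def)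
    finally have "real l * \<omega> (norm \<xi>) \<le> real l * (real K * (1 + \<omega> t))" by (intro mult_left_mono) auto
    then have e: "exp (real l * \<omega> (norm \<xi>)) \<le> exp (real (l * K)) * exp (real (l * K) * \<omega> t)"
      by (simp add: exp_add[symmetric] algebra_simps)
    have "exp (real (l * K) * \<omega> t) * ?F \<le> D * (C * J)"
    proof (cases "1 \<le> t")
      case True
      obtain k where k: "exp (real m * \<omega> t) / t \<le> t ^ k * winf m k"
        using weight_le_power_winf[OF True, of m] by blast
      have "exp (real m * \<omega> t) / t * ?F \<le> t ^ k * winf m k * ?F"
        using k by (intro mult_right_mono) auto
      also have "\<dots> \<le> C * J" using poly[of \<xi> i k] by (simp add: t_def)
      finally have "exp (real m * \<omega> t) * ?F \<le> t * (C * J)" using True by (simp add: field_simps)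
      also have "\<dots> \<le> (D * exp (real p * \<omega> t)) * (C * J)"
        using D(2)[of t] True C J by (intro mult_right_mono) auto
      finally have "exp (real p * \<omega> t) * (exp (real (l * K) * \<omega> t) * ?F) \<le>
          exp (real p * \<omega> t) * (D * (C * J))"
        unfolding m_def of_nat_add distrib_right exp_add by (simp only: mult_ac)
      then show ?thesis by simp
    next
      case False
      then have 0: "\<omega> t = 0" by (intro weight_zero) (auto simp: t_def)
      \<comment> \<open>Below \<open>1\<close> the weight vanishes and the estimate of order
        \<open>k = 0\<close> is enough, but the common constant contains \<open>D\<close>.\<close>
      have "1 \<le> D" using D(2)[of 0] weight_zero[of 0] by simp
      then have "C * J \<le> D * (C * J)" using C J mult_right_mono[of 1 D "C * J"] by simp
      then show ?thesis using 0 poly[of \<xi> i 0] by simp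
    qed
    then have "exp (real (l * K)) * (exp (real (l * K) * \<omega> t) * ?F) \<le> exp (real (l * K)) * (D * (C * J))"
      by (intro mult_left_mono) auto
    moreover have "exp (real l * \<omega> (norm \<xi>)) * ?F \<le> exp (real (l * K)) * exp (real (l * K) * \<omega> t) * ?F"
      using e by (intro mult_right_mono) auto
    ultimately show ?thesis unfolding mult.assoc by (rule order_trans[rotated])
  qed
  then show ?thesis using C J D by (intro exI[of _ "exp (real (l * K)) * D * (C * J)"]) auto
qed

section \<open>The two descriptions of the test functions\<close>

lemma wsup_finite_iff:
  fixes f :: "real^'n::finite \<Rightarrow> complex"
  shows "(\<forall>l>0. wsup \<omega> l f < \<infinity>) \<longleftrightarrow> (\<forall>n::nat. \<exists>C\<ge>0. \<forall>x. exp (real n * \<omega> (norm x)) * norm (f x) \<le> C)"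
proof (intro iffI allI impI)
  fix n :: nat
  assume f: "\<forall>l>0. wsup \<omega> l f < \<infinity>"
  \<comment> \<open>The successor covers \<open>n = 0\<close>, since the hypothesis concerns
    positive exponents only.\<close>
  then have "wsup \<omega> (real (Suc n)) f < \<infinity>" by simp
  then obtain C where C: "0 \<le> C" "wsup \<omega> (real (Suc n)) f = ennreal C"
    by (cases "wsup \<omega> (real (Suc n)) f") auto
  have "exp (real n * \<omega> (norm x)) * norm (f x) \<le> C" for x :: "real^'n"
  proof -
    have "ennreal (exp (real (Suc n) * \<omega> (norm x)) * norm (f x)) \<le> ennreal C"
      unfolding C(2)[symmetric] wsup_def by (rule SUP_upper) simp
    then have "exp (real (Suc n) * \<omega> (norm x)) * norm (f x) \<le> C" using C(1) by simp
    moreover have "exp (real n * \<omega> (norm x)) \<le> exp (real (Suc n) * \<omega> (norm x))"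
      using weight_nonneg[of "norm x"] by (simp add: mult_right_mono)
    then have "exp (real n * \<omega> (norm x)) * norm (f x) \<le> exp (real (Suc n) * \<omega> (norm x)) * norm (f x)"
      by (intro mult_right_mono) auto
    ultimately show ?thesis by linarith
  qed
  then show "\<exists>C\<ge>0. \<forall>x. exp (real n * \<omega> (norm x)) * norm (f x) \<le> C" using C by blast
next
  fix l :: real
  assume f: "\<forall>n::nat. \<exists>C\<ge>0. \<forall>x. exp (real n * \<omega> (norm x)) * norm (f x) \<le> C" and l: "0 < l"
  obtain C where C: "0 \<le> C" "\<And>x. exp (real (nat \<lceil>l\<rceil>) * \<omega> (norm x)) * norm (f x) \<le> C"
    using f by blast
  have "wsup \<omega> l f \<le> ennreal C"
    unfolding wsup_def
  proof (intro SUP_least ennreal_leI)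
    fix x :: "real^'n"
    have "l * \<omega> (norm x) \<le> real (nat \<lceil>l\<rceil>) * \<omega> (norm x)"
      using weight_nonneg[of "norm x"] by (intro mult_right_mono) (auto simp: of_nat_ceiling)
    then have "exp (l * \<omega> (norm x)) * norm (f x) \<le> exp (real (nat \<lceil>l\<rceil>) * \<omega> (norm x)) * norm (f x)"
      by (intro mult_right_mono) auto
    then show "exp (l * \<omega> (norm x)) * norm (f x) \<le> C" using C(2)[of x] by linarith
  qed
  then show "wsup \<omega> l f < \<infinity>" by (rule le_less_trans) simp
qed

lemma q_finite_imp_S_space:
  assumes h: "q_finite h"
  shows "h \<in> S_space \<omega>"
proof -
  have "\<forall>l>0. wsup \<omega> l (multi_deriv \<alpha> h) < \<infinity>" for \<alpha>
    unfolding wsup_finite_iff multi_deriv_eq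
    by (intro allI q_finite_decay[OF h]) (simp add: index_words_def)
  moreover have "\<forall>l>0. wsup \<omega> l (multi_deriv \<alpha> (fourier h)) < \<infinity>" for \<alpha>
  proof -
    obtain h' where h': "q_finite h'" "word_deriv (index_word coord_list \<alpha>) (osc_integral (- 1) h) =
        osc_integral (- 1) h'"
      using word_deriv_osc_integral_q_finite[OF h] by blast
    show ?thesis
      unfolding wsup_finite_iff multi_deriv_eq fourier_eq_osc_integral h'(2)
          using osc_integral_decay[OF h'(1)] by blast
  qed
  ultimately show ?thesis
    using h by (auto simp: S_space_def fourier_eq_osc_integral
        intro: q_finite_smooth rapid_integrable q_finite_rapid_self smooth_osc_integral)
qed

text \<open>Differentiating the integral brings down at most \<open>norm x ^ k\<close>, which
  together with \<open>winf m k\<close> stays below \<open>exp (m * \<omega> (norm x))\<close> and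
  is absorbed by the decay of \<open>u\<close>. The bound is uniform in the word but carries no
  weight in the space variable.\<close>

lemma word_deriv_global_bound:
  fixes u :: "real^'n::finite \<Rightarrow> complex"
  assumes u: "rapid u" and decay: "\<And>n. \<exists>C\<ge>0. \<forall>x. exp (real n * \<omega> (norm x)) * norm (u x) \<le> C"
  shows "\<exists>C\<ge>0. \<forall>w x. norm (word_deriv w (osc_integral 1 u) x) * winf m (length w) \<le> C"
proof -
  obtain n J where J: "0 \<le> J" "\<And>C v. 0 \<le> C \<Longrightarrow> integrable lborel v \<Longrightarrow>
    (\<And>x. exp (real n * \<omega> (norm x)) * norm (v x) \<le> C) \<Longrightarrow> (LINT x|lborel. norm ((v :: real^'n \<Rightarrow>
        complex) x)) \<le> C * J"
    using weight_bounded_integral by metis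
  obtain C where C: "0 \<le> C" "\<And>x. exp (real (n + m) * \<omega> (norm x)) * norm (u x) \<le> C"
    using decay by blast
  have "norm (word_deriv w (osc_integral 1 u) x) * winf m (length w) \<le> C * J" for w x
  proof -
    obtain v where v: "rapid v" "word_deriv w (osc_integral 1 u) = osc_integral 1 v"
        "\<And>x. norm (v x) \<le> (\<bar>1\<bar> * norm x) ^ length w * norm (u x)"
      using word_deriv_osc_integral[OF u, of w 1] by blast
    have "norm (osc_integral 1 v x) * winf m (length w) \<le> (LINT x|lborel. norm (v x)) * winf m
        (length w)"
      by (intro mult_right_mono norm_osc_integral_le rapid_integrable v winf_nonneg)
    also have "\<dots> = (LINT x|lborel. norm (of_real (winf m (length w)) * v x))"
      by (simp add: norm_mult winf_nonneg mult.commute)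
    also have "\<dots> \<le> C * J"
    proof (rule J(2)[OF C(1)])
      fix x
      have "norm (of_real (winf m (length w)) * v x) \<le> winf m (length w) * (norm x ^ length w * norm
          (u x))"
        using mult_left_mono[OF v(3)[of x] winf_nonneg[of m "length w"]] by
            (simp add: norm_mult winf_nonneg)
      also have "\<dots> = (norm x ^ length w * winf m (length w)) * norm (u x)" by simp
      also have "\<dots> \<le> exp (real m * \<omega> (norm x)) * norm (u x)"
        by (intro mult_right_mono power_winf_le) auto
      finally have "exp (real n * \<omega> (norm x)) * norm (of_real (winf m (length w)) * v x) \<le>
          exp (real n * \<omega> (norm x)) * (exp (real m * \<omega> (norm x)) * norm (u x))"
        by (intro mult_left_mono) auto
      also have "\<dots> = exp (real (n + m) * \<omega> (norm x)) * norm (u x)"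
        by (simp add: distrib_right exp_add)
      also have "\<dots> \<le> C" by (rule C)
      finally show "exp (real n * \<omega> (norm x)) * norm (of_real (winf m (length w)) * v x) \<le> C" .
    qed (intro integrable_mult_right rapid_integrable v)
    finally show ?thesis unfolding v(2) .
  qed
  then show ?thesis using C J by (intro exI[of _ "C * J"]) auto
qed

text \<open>Landau's inequality, applied along the half-line that starts at \<open>x\<close> in the direction \<open>\<plusminus> e\<^sub>i\<close>
  in which the weight increases, trades half of the decay of a derivative for its global bound.
  Doing so for one coordinate after the other gives the weighted bounds.\<close>

lemma word_deriv_weighted_bound:
  fixes g :: "real^'n::finite \<Rightarrow> complex"
  assumes g: "smooth g"
    and decay: "\<And>n. \<exists>C\<ge>0. \<forall>x. exp (real n * \<omega> (norm x)) * norm (g x) \<le> C"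
    and global: "\<And>m. \<exists>C\<ge>0. \<forall>w x. norm (word_deriv w g x) * winf m (length w) \<le> C"
  shows "\<exists>C\<ge>0. \<forall>\<alpha> x. exp (real n * \<omega> (norm x)) * norm (word_deriv (index_word L \<alpha>) g x) *
    winf m (length (index_word L \<alpha>)) \<le> C"
proof (induction L arbitrary: m n)
  case Nil
  show ?case using decay[of n] by simp
next
  case (Cons i L)
  \<comment> \<open>\<open>m1\<close> absorbs the geometric constant of \<open>landau\<close>. The
    indices \<open>2 * m1\<close> and \<open>2 * n\<close> used for the two input bounds compensate
    for the square root.\<close>
  obtain D m1 where D: "0 < D" "m \<le> m1" "\<And>k. 5184 ^ k * winf m k \<le> D * winf m1 k"
    using winf_power[of 5184 m] by auto
  define M where "M = 2 * m1"
  obtain C1 where C1: "0 \<le> C1" "\<And>\<alpha> x. exp (real (2 * n) * \<omega> (norm x)) * norm (word_deriv (index_word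
      L \<alpha>) g x) *
      winf M (length (index_word L \<alpha>)) \<le> C1"
    using Cons.IH[of "2 * n" M] by blast
  obtain C2 where C2: "0 \<le> C2" "\<And>w x. norm (word_deriv w g x) * winf M (length w) \<le> C2"
    using global[of M] by blast
  \<comment> \<open>Adding one makes both bounds strictly positive, as \<open>landau\<close>
    requires.\<close>
  define E where "E = sqrt ((C1 + 1) * (C2 + 1))"
  have "exp (real n * \<omega> (norm x)) * norm (word_deriv (index_word (i # L) \<alpha>) g x) *
      winf m (length (index_word (i # L) \<alpha>)) \<le> 2 * E * D" for \<alpha> x
  proof -
    define v where "v = index_word L \<alpha>"
    define a k where "a = length v" and "k = \<alpha> i"
    have w: "index_word (i # L) \<alpha> = replicate k i @ v" "length (index_word (i # L) \<alpha>) = a + k"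
      by (simp_all add: index_word_Cons v_def a_def k_def)
    let ?e = "\<lambda>n. exp (real n * \<omega> (norm x))"
    show ?thesis
    proof (cases "winf m1 (a + k) = 0")
      case True
      then have "winf m (a + k) = 0" using winf_mono[OF D(2), of "a + k"] winf_nonneg[of m "a + k"]
          by simp
      then show ?thesis using C1 C2 D by (simp add: w(2) E_def)
    next
      case False
      then have W: "0 < winf m1 (a + k)" using winf_nonneg[of m1 "a + k"] by simp
      \<comment> \<open>The split of \<open>2 * (a + k)\<close> into \<open>a\<close> and
        \<open>a + 2 * k\<close> matches the orders of the two derivatives between which Landau's
        inequality interpolates.\<close>
      have "(winf m1 (a + k))\<^sup>2 \<le> winf M (2 * (a + k))" unfolding M_def by (rule winf_square_le)
      also have "\<dots> \<le> winf M a * winf M (a + 2 * k)"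
      proof -
        have "2 * (a + k) = a + (a + 2 * k)" by simp
        then show ?thesis by (simp only: winf_add_le)
      qed
      finally have W2: "(winf m1 (a + k))\<^sup>2 \<le> winf M a * winf M (a + 2 * k)" .
      then have pos: "0 < winf M a" "0 < winf M (a + 2 * k)"
        using W winf_nonneg[of M a] winf_nonneg[of M "a + 2 * k"]
        by (smt (verit) mult_eq_0_iff zero_less_power)+
      \<comment> \<open>Pointing away from the hyperplane where the coordinate \<open>i\<close>
        vanishes, the half-line never decreases the norm, so the weight at \<open>x\<close> is a
        lower bound along all of it.\<close>
      define \<sigma> where "\<sigma> = (if 0 \<le> x $ i then 1 else - 1 :: real)"
      have \<sigma>: "\<bar>\<sigma>\<bar> = 1" by (simp add: \<sigma>_def)
      \<comment> \<open>The power of \<open>\<sigma>\<close> is the sign that the chain rule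
        produces, so that each \<open>h j\<close> has derivative \<open>h (Suc j)\<close>.\<close>
      define h where "h j t = (of_real \<sigma>) ^ j * word_deriv (replicate j i @ v) g (x + (\<sigma> * t) *\<^sub>R
          axis i 1)" for j t
      have norm_h: "norm (h j t) = norm (word_deriv (replicate j i @ v) g (x + (\<sigma> * t) *\<^sub>R axis i
          1))" for j t
        by (simp add: h_def norm_mult norm_power \<sigma>)
      define A where "A = (C1 + 1) / (?e (2 * n) * winf M a)"
      define B where "B = (C2 + 1) / winf M (a + 2 * k)"
      have "norm (h k 0) \<le> 2 * 5184 ^ k * sqrt (A * B)"
      proof (rule landau)
        fix j t
        have "((\<lambda>s. word_deriv (replicate j i @ v) g (x + s *\<^sub>R axis i 1)) has_vector_derivative
            word_deriv (replicate (Suc j) i @ v) g (x + (\<sigma> * t) *\<^sub>R axis i 1)) (at (\<sigma> * t))"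
          using has_vector_derivative_line[OF smooth_differentiable[OF smooth_word_deriv[OF g,
              of "replicate j i @ v"]]] by simp
        moreover have "((\<lambda>t. \<sigma> * t) has_vector_derivative \<sigma>) (at t)"
          by (auto intro!: derivative_eq_intros)
        ultimately have "((\<lambda>s. word_deriv (replicate j i @ v) g (x + s *\<^sub>R axis i 1)) \<circ> (\<lambda>t. \<sigma> * t)
            has_vector_derivative
            \<sigma> *\<^sub>R word_deriv (replicate (Suc j) i @ v) g (x + (\<sigma> * t) *\<^sub>R axis i 1)) (at t)"
          by (intro vector_diff_chain_at)
        then have "((\<lambda>t. (of_real \<sigma>) ^ j * word_deriv (replicate j i @ v) g (x + (\<sigma> * t) *\<^sub>R axis i
            1)) has_vector_derivative
            (of_real \<sigma>) ^ j * (\<sigma> *\<^sub>R word_deriv (replicate (Suc j) i @ v) g (x + (\<sigma> * t) *\<^sub>R axis i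
                1))) (at t)"
          unfolding o_def by (rule has_vector_derivative_mult_right)
        then show "(h j has_vector_derivative h (Suc j) t) (at t)"
          unfolding h_def by (simp add: scaleR_conv_of_real mult_ac)
      next
        fix t :: real assume t: "0 \<le> t"
        let ?y = "x + (\<sigma> * t) *\<^sub>R axis i 1"
        have "norm x \<le> norm ?y"
        proof (rule norm_le_componentwise_cart)
          show "norm (x $ j) \<le> norm (?y $ j)" for j
            using t by (auto simp: \<sigma>_def axis_def)
        qed
        then have "real (2 * n) * \<omega> (norm x) \<le> real (2 * n) * \<omega> (norm ?y)"
          by (intro mult_left_mono weight_mono) auto
        then have "?e (2 * n) * (norm (word_deriv v g ?y) * winf M a) \<le>
            exp (real (2 * n) * \<omega> (norm ?y)) * (norm (word_deriv v g ?y) * winf M a)"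
          by (intro mult_right_mono) (auto simp: winf_nonneg)
        also have "\<dots> \<le> C1 + 1" using C1(2)[of ?y \<alpha>] by (simp add: v_def a_def mult.assoc)
        finally show "norm (h 0 t) \<le> A"
          unfolding norm_h A_def using pos by (simp add: pos_le_divide_eq mult_ac)
        have "norm (word_deriv (replicate (2 * k) i @ v) g ?y) * winf M (a + 2 * k) \<le> C2 + 1"
          using C2(2)[of "replicate (2 * k) i @ v" ?y] by (simp add: a_def add.commute)
        then show "norm (h (2 * k) t) \<le> B"
          unfolding norm_h B_def using pos by (simp add: pos_le_divide_eq)
      qed (use pos C1 C2 in \<open>auto simp: A_def B_def\<close>)
      also have "sqrt (A * B) \<le> E / (?e n * winf m1 (a + k))"
      proof (rule real_le_lsqrt)
        show "0 \<le> E / (?e n * winf m1 (a + k))" using C1 C2 W by (simp add: E_def)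
        have "A * B = (C1 + 1) * (C2 + 1) / (?e (2 * n) * (winf M a * winf M (a + 2 * k)))"
          by (simp add: A_def B_def)
        also have "\<dots> \<le> (C1 + 1) * (C2 + 1) / (?e (2 * n) * (winf m1 (a + k))\<^sup>2)"
          using C1 C2 W W2 pos by (intro divide_left_mono mult_left_mono mult_pos_pos) auto
        also have "?e (2 * n) = (?e n)\<^sup>2" by (simp add: exp_double[symmetric])
        also have "(C1 + 1) * (C2 + 1) = E\<^sup>2" using C1 C2 by (simp add: E_def)
        finally show "A * B \<le> (E / (?e n * winf m1 (a + k)))\<^sup>2"
          by (simp add: power_divide power_mult_distrib)
      qed
      finally have "norm (h k 0) \<le> 2 * 5184 ^ k * (E / (?e n * winf m1 (a + k)))" by simp
      then have "?e n * norm (word_deriv (replicate k i @ v) g x) * winf m (a + k) \<le>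
          ?e n * (2 * 5184 ^ k * (E / (?e n * winf m1 (a + k)))) * winf m (a + k)"
        unfolding norm_h by (intro mult_right_mono mult_left_mono winf_nonneg) auto
      also have "\<dots> = 2 * E / winf m1 (a + k) * (5184 ^ k * winf m (a + k))" by simp
      \<comment> \<open>The exponent is raised from \<open>k\<close> to \<open>a + k\<close>, the
        order at which the weight is taken, so that the choice of \<open>D\<close> and
        \<open>m1\<close> applies.\<close>
      also have "\<dots> \<le> 2 * E / winf m1 (a + k) * (5184 ^ (a + k) * winf m (a + k))"
        using W C1 C2 winf_nonneg by (intro mult_left_mono mult_right_mono power_increasing)
            (auto simp: E_def)
      also have "\<dots> \<le> 2 * E / winf m1 (a + k) * (D * winf m1 (a + k))"
        using W C1 C2 by (intro mult_left_mono D) (auto simp: E_def)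
      also have "\<dots> = 2 * E * D" using W by simp
      finally show ?thesis unfolding w(2) unfolding w(1) .
    qed
  qed
  moreover have "0 \<le> 2 * E * D" using C1 C2 D by (simp add: E_def)
  ultimately show ?case by blast
qed

lemma S_space_imp_q_finite:
  fixes g :: "real^'n::finite \<Rightarrow> complex"
  assumes g: "g \<in> S_space \<omega>"
  shows "q_finite g"
proof -
  have sm: "smooth g" "smooth (fourier g)" using g by (auto simp: S_space_def)
  have "multi_deriv (\<lambda>_. 0) f = f" for f :: "real^'n \<Rightarrow> complex"
  proof -
    have "index_word L (\<lambda>_. 0) = []" for L :: "'n list" by (induction L) (auto simp: index_word_Cons)
    then show ?thesis by (simp add: multi_deriv_eq)
  qed
  then have "\<forall>l>0. wsup \<omega> l g < \<infinity>" "\<forall>l>0. wsup \<omega> l (fourier g) < \<infinity>"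
    using g unfolding S_space_def by (metis (mono_tags, lifting) mem_Collect_eq)+
  then have decay: "\<exists>C\<ge>0. \<forall>x. exp (real n * \<omega> (norm x)) * norm (g x) \<le> C"
    "\<exists>C\<ge>0. \<forall>x. exp (real n * \<omega> (norm x)) * norm (fourier g x) \<le> C" for n
    unfolding wsup_finite_iff by blast+
  define c where "c = osc_integral 1 (gauss :: real^'n \<Rightarrow> complex) 0"
  have c: "c \<noteq> 0" unfolding c_def by (rule osc_integral_gauss_0)
  \<comment> \<open>Division by the square of \<open>c\<close> compensates for the missing
    normalization, so that \<open>g\<close> itself is an oscillatory integral and
    \<open>word_deriv_global_bound\<close> applies to it.\<close>
  define u where "u x = fourier g x / c\<^sup>2" for x
  have u_decay: "\<exists>C\<ge>0. \<forall>x. exp (real n * \<omega> (norm x)) * norm (u x) \<le> C" for n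
  proof -
    obtain C where C: "0 \<le> C" "\<And>x. exp (real n * \<omega> (norm x)) * norm (fourier g x) \<le> C"
      using decay(2) by blast
    have "exp (real n * \<omega> (norm x)) * norm (u x) \<le> C / norm (c\<^sup>2)" for x
      using divide_right_mono[OF C(2)[of x], of "norm (c\<^sup>2)"] by (simp add: u_def norm_divide)
    then show ?thesis using C by (intro exI[of _ "C / norm (c\<^sup>2)"]) auto
  qed
  have rap: "rapid g" "rapid (fourier g)"
    using sm decay by (auto intro!: rapid_if_weight_bounded smooth_continuous)
  have "rapid u"
    using u_decay smooth_continuous[OF sm(2)] c unfolding u_def
    by (intro rapid_if_weight_bounded) (auto intro!: continuous_intros)
  have "osc_integral 1 u = g"
  proof
    fix x
    have "osc_integral 1 u x = osc_integral 1 (fourier g) x / c\<^sup>2"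
      unfolding osc_integral_def u_def by (subst integral_divide_zero[symmetric]) simp
    also have "\<dots> = g x"
      using fourier_inversion[OF rap(1)] rap(2) c unfolding fourier_eq_osc_integral c_def by simp
    finally show "osc_integral 1 u x = g x" .
  qed
  then have "\<exists>C\<ge>0. \<forall>w x. norm (word_deriv w g x) * winf m (length w) \<le> C" for m
    using word_deriv_global_bound[OF \<open>rapid u\<close> u_decay] by simp
  then have "\<exists>C\<ge>0. q_bounded m n C g" for m n
    using word_deriv_weighted_bound[OF sm(1) decay(1), of n coord_list m]
    unfolding deriv_bounded_def index_words_def by (simp add: ball_simps)
  then show ?thesis using sm by (simp add: q_finite_def)
qed

lemma S_space_eq: "S_space \<omega> = {f. q_finite f}"
  using S_space_imp_q_finite q_finite_imp_S_space by blast

end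

section \<open>Topologies given by seminorms\<close>

definition complex_subspace :: "('a \<Rightarrow> complex) set \<Rightarrow> bool" where
  "complex_subspace E \<longleftrightarrow> 0 \<in> E \<and> (\<forall>x\<in>E. \<forall>y\<in>E. x + y \<in> E) \<and> (\<forall>c. \<forall>x\<in>E. cscale c x \<in> E)"

lemma cscale_minus_one: "cscale (- 1) x = - x"
  by (simp add: cscale_def fun_eq_iff)

lemma complex_subspaceD:
  assumes "complex_subspace E"
  shows "0 \<in> E" "x \<in> E \<Longrightarrow> y \<in> E \<Longrightarrow> x + y \<in> E" "x \<in> E \<Longrightarrow> cscale c x \<in> E" "x \<in> E \<Longrightarrow> y \<in> E \<Longrightarrow> x - y \<in> E"
proof -
  show *: "0 \<in> E" "x \<in> E \<Longrightarrow> y \<in> E \<Longrightarrow> x + y \<in> E" "x \<in> E \<Longrightarrow> cscale c x \<in> E" for x y c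
    using assms by (auto simp: complex_subspace_def)
  show "x - y \<in> E" if "x \<in> E" "y \<in> E"
    using *(2)[OF that(1) *(3)[OF that(2), of "- 1"]] by (simp add: cscale_minus_one)
qed

lemma topspace_seminorm_topology [simp]: "topspace (seminorm_topology E P) = E"
proof -
  have "openin (seminorm_topology E P) E"
    unfolding openin_seminorm_topology
    by (intro conjI ballI exI[of _ "{}"] exI[of _ "1 :: real"]) auto
  then show ?thesis
    by (metis openin_seminorm_topology openin_subset openin_topspace subset_antisym)
qed

text \<open>Subadditivity is asked for on \<open>E\<close> only: for \<open>q_norm\<close> and
  \<open>r_norm\<close> it rests on the linearity of derivatives, hence on smoothness.\<close>

lemma openin_seminorm_ball:
  assumes E: "complex_subspace E" and p: "p \<in> P" and x: "x \<in> E"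
    and sub: "\<And>y z. y \<in> E \<Longrightarrow> z \<in> E \<Longrightarrow> p (y + z) \<le> p y + p z"
  shows "openin (seminorm_topology E P) {y \<in> E. p (y - x) < ennreal \<epsilon>}"
  unfolding openin_seminorm_topology
proof (intro conjI ballI)
  fix y assume "y \<in> {y \<in> E. p (y - x) < ennreal \<epsilon>}"
  then have y: "y \<in> E" "p (y - x) < ennreal \<epsilon>" by auto
  then obtain r where r: "0 \<le> r" "p (y - x) = ennreal r"
    by (cases "p (y - x)") auto
  then have "r < \<epsilon>" using y(2) by (simp add: ennreal_less_iff)
  have "p (z - x) < ennreal \<epsilon>" if z: "z \<in> E" "p (z - y) < ennreal (\<epsilon> - r)" for z
  proof -
    have "p ((z - y) + (y - x)) \<le> p (z - y) + p (y - x)"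
      using E x y z by (intro sub complex_subspaceD(4)) auto
    moreover
    obtain s where s: "0 \<le> s" "p (z - y) = ennreal s"
      using z(2) by (cases "p (z - y)") auto
    have "s < \<epsilon> - r" using z(2) s by (simp add: ennreal_less_iff)
    have "p (z - y) + p (y - x) = ennreal (s + r)" using r s by simp
    moreover have "ennreal (s + r) < ennreal \<epsilon>" using r s \<open>s < \<epsilon> - r\<close> by (intro ennreal_lessI) auto
    ultimately show ?thesis by simp
  qed
  then show "\<exists>Q \<delta>. finite Q \<and> Q \<subseteq> P \<and> (0::real) < \<delta> \<and>
      {z \<in> E. \<forall>p\<in>Q. p (z - y) < ennreal \<delta>} \<subseteq> {y \<in> E. p (y - x) < ennreal \<epsilon>}"
    using p \<open>r < \<epsilon>\<close> by (intro exI[of _ "{p}"] exI[of _ "\<epsilon> - r"]) auto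
qed auto

context weight
begin

section \<open>The norms and the topology of the test functions\<close>

lemma deriv_bounded_add:
  fixes f g :: "real^'n::finite \<Rightarrow> complex"
  assumes "smooth f" "smooth g" "deriv_bounded m l C f" "deriv_bounded m l D g"
  shows "deriv_bounded m l (C + D) (f + g)"
  unfolding deriv_bounded_def
proof (intro ballI allI)
  fix w :: "'n list" and x :: "real^'n" assume w: "w \<in> index_words"
  let ?e = "exp (l * \<omega> (norm x))"
  have "?e * norm (word_deriv w (f + g) x) * winf m (length w) \<le>
      ?e * (norm (word_deriv w f x) + norm (word_deriv w g x)) * winf m (length w)"
    using assms by (intro mult_right_mono mult_left_mono winf_nonneg)
        (auto simp: word_deriv_add norm_triangle_ineq)
  also have "\<dots> \<le> C + D"
    using assms(3,4) w unfolding deriv_bounded_def by (auto simp: algebra_simps intro!: add_mono)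
  finally show "?e * norm (word_deriv w (f + g) x) * winf m (length w) \<le> C + D" .
qed

lemma deriv_bounded_cscale:
  fixes f :: "real^'n::finite \<Rightarrow> complex"
  assumes "smooth f" "deriv_bounded m l C f"
  shows "deriv_bounded m l (norm c * C) (cscale c f)"
  unfolding deriv_bounded_def
proof (intro ballI allI)
  fix w :: "'n list" and x :: "real^'n" assume w: "w \<in> index_words"
  let ?e = "exp (l * \<omega> (norm x))"
  have "?e * norm (word_deriv w (cscale c f) x) * winf m (length w) =
      norm c * (?e * norm (word_deriv w f x) * winf m (length w))"
    unfolding word_deriv_cscale[OF assms(1)] by (simp add: cscale_def norm_mult)
  also have "\<dots> \<le> norm c * C"
    using assms(2) w unfolding deriv_bounded_def by (intro mult_left_mono) auto
  finally show "?e * norm (word_deriv w (cscale c f) x) * winf m (length w) \<le> norm c * C" .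
qed

lemma smooth_zero: "smooth (0 :: real^'n::finite \<Rightarrow> complex)"
  using smooth_const[of 0] by (simp add: zero_fun_def)

lemma cscale_0: "cscale 0 f = 0"
  by (simp add: cscale_def fun_eq_iff)

lemma word_deriv_zero: "word_deriv w (0 :: real^'n::finite \<Rightarrow> complex) = 0"
  using word_deriv_cscale[OF smooth_zero, of w 0] by (simp add: cscale_0)

lemma complex_subspace_S_space: "complex_subspace (S_space \<omega> :: (real^'n::finite \<Rightarrow> complex) set)"
  unfolding complex_subspace_def S_space_eq
proof (intro conjI ballI allI; (simp only: mem_Collect_eq)?)
  show "q_finite (0 :: real^'n \<Rightarrow> complex)"
    by (auto simp: q_finite_def smooth_zero deriv_bounded_def word_deriv_zero intro!: exI[of _ 0])
next
  fix f g :: "real^'n \<Rightarrow> complex" assume fg: "q_finite f" "q_finite g"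
  show "q_finite (f + g)"
    unfolding q_finite_def
  proof (intro conjI allI)
    show "smooth (f + g)" using fg by (intro smooth_add) (simp_all add: q_finite_def)
    fix m n
    obtain C D where "0 \<le> C" "q_bounded m n C f" "0 \<le> D" "q_bounded m n D g"
      using fg unfolding q_finite_def by blast
    then show "\<exists>C\<ge>0. q_bounded m n C (f + g)"
      using fg by (intro exI[of _ "C + D"] conjI deriv_bounded_add) (simp_all add: q_finite_def)
  qed
next
  fix f :: "real^'n \<Rightarrow> complex" and c assume f: "q_finite f"
  show "q_finite (cscale c f)"
    unfolding q_finite_def
  proof (intro conjI allI)
    show "smooth (cscale c f)" using f by (intro smooth_cscale) (simp add: q_finite_def)
    fix m n
    obtain C where "0 \<le> C" "q_bounded m n C f"
      using f unfolding q_finite_def by blast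
    then show "\<exists>C\<ge>0. q_bounded m n C (cscale c f)"
      using f by (intro exI[of _ "norm c * C"] conjI deriv_bounded_cscale) (simp_all add: q_finite_def)
  qed
qed

lemma S_space_smooth: "f \<in> S_space \<omega> \<Longrightarrow> smooth f"
  by (simp add: S_space_def)

lemma q_norm_finite:
  assumes f: "f \<in> S_space \<omega>" and m: "1 \<le> m"
  obtains C where "0 \<le> C" "q_norm \<omega> m n f = ennreal C" "q_bounded m n C f"
proof -
  obtain D where D: "0 \<le> D" "q_bounded m n D f" using f unfolding S_space_eq q_finite_def by blast
  then have "q_norm \<omega> m n f \<le> ennreal D" using m by (simp add: q_norm_le_iff)
  then obtain C where C: "0 \<le> C" "q_norm \<omega> m n f = ennreal C"
    by (cases "q_norm \<omega> m n f") (auto simp: top_unique)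
  moreover have "q_bounded m n C f"
    using C m q_norm_le_iff[of m C n f] by simp
  ultimately show ?thesis using that by blast
qed

lemma q_norm_add:
  assumes "f \<in> S_space \<omega>" "g \<in> S_space \<omega>" "1 \<le> m"
  shows "q_norm \<omega> m n (f + g) \<le> q_norm \<omega> m n f + q_norm \<omega> m n g"
proof -
  obtain C where C: "0 \<le> C" "q_norm \<omega> m n f = ennreal C" "q_bounded m n C f"
    using assms q_norm_finite by blast
  obtain D where D: "0 \<le> D" "q_norm \<omega> m n g = ennreal D" "q_bounded m n D g"
    using assms q_norm_finite by blast
  have "q_norm \<omega> m n (f + g) \<le> ennreal (C + D)"
    using C D assms by (subst q_norm_le_iff) (auto intro!: deriv_bounded_add S_space_smooth)
  then show ?thesis using C D by simp
qed

lemma q_norm_cscale: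
  assumes "f \<in> S_space \<omega>" "1 \<le> m" "0 \<le> R" "q_norm \<omega> m n f \<le> ennreal R"
  shows "q_norm \<omega> m n (cscale c f) \<le> ennreal (norm c * R)"
  using assms by (auto simp: q_norm_le_iff intro!: deriv_bounded_cscale S_space_smooth)

lemma q_norm_mono:
  assumes f: "f \<in> S_space \<omega>" and m: "1 \<le> m" and le: "m \<le> m'" "n \<le> n'"
  shows "q_norm \<omega> m n f \<le> q_norm \<omega> m' n' f"
proof -
  have "1 \<le> m'" using m le by simp
  then obtain C where C: "0 \<le> C" "q_norm \<omega> m' n' f = ennreal C" "q_bounded m' n' C f"
    using f q_norm_finite by blast
  then show ?thesis using m deriv_bounded_mono[OF C(3) le(1), of "real n" C] le(2) by
      (simp add: q_norm_le_iff)
qed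

lemma topspace_S_top [simp]: "topspace (S_top \<omega>) = S_space \<omega>"
  by (simp add: S_top_def)

lemma openin_S_top_ball:
  assumes "f \<in> S_space \<omega>" "1 \<le> m" "1 \<le> n"
  shows "openin (S_top \<omega>) {g \<in> S_space \<omega>. q_norm \<omega> m n (g - f) < ennreal \<epsilon>}"
  unfolding S_top_def using assms
      by (intro openin_seminorm_ball complex_subspace_S_space q_norm_add) auto

text \<open>The norms increase in both indices, so the countable family
  \<open>q_norm \<omega> k k\<close> already describes all neighbourhoods, and a single member
  replaces any finite set of norms.\<close>

lemma openin_S_top_D:
  fixes U :: "(real^'n::finite \<Rightarrow> complex) set"
  assumes U: "openin (S_top \<omega>) U" and f: "f \<in> U"
  obtains k \<epsilon> where "1 \<le> k" "0 < \<epsilon>" "\<And>g. g \<in> S_space \<omega> \<Longrightarrow> q_norm \<omega> k k (g - f) < ennreal \<epsilon> \<Longrightarrow> g \<in> U"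
proof -
  obtain Q \<epsilon> where Q: "finite Q" "Q \<subseteq> {q_norm \<omega> m n |m n. 1 \<le> m \<and> 1 \<le> n}" "0 < (\<epsilon>::real)"
      "{y\<in>S_space \<omega>. \<forall>p\<in>Q. p (y - f) < ennreal \<epsilon>} \<subseteq> U"
    using U f unfolding S_top_def openin_seminorm_topology by blast
  have "\<exists>k\<ge>1. \<forall>p\<in>Q. \<forall>g\<in>(S_space \<omega> :: (real^'n \<Rightarrow> complex) set). p g \<le> q_norm \<omega> k k g"
    using Q(1,2)
  proof (induction Q rule: finite_induct)
    case empty
    then show ?case by auto
  next
    case (insert p Q)
    then obtain k where k: "1 \<le> k" "\<forall>p\<in>Q. \<forall>g\<in>(S_space \<omega> :: (real^'n \<Rightarrow> complex) set). p g \<le>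
        q_norm \<omega> k k g" by auto
    obtain m n where mn: "p = q_norm \<omega> m n" "1 \<le> m" "1 \<le> n" using insert.prems by auto
    define l where "l = max k (max m n)"
    have "p' g \<le> q_norm \<omega> l l g" if "p' \<in> insert p Q" "g \<in> S_space \<omega>" for p' and g :: "real^'n \<Rightarrow> complex"
    proof (cases "p' = p")
      case True
      then show ?thesis using that mn by (auto simp: l_def intro!: q_norm_mono)
    next
      case False
      then have "p' g \<le> q_norm \<omega> k k g" using that k by auto
      also have "\<dots> \<le> q_norm \<omega> l l g" using that k by (intro q_norm_mono) (auto simp: l_def)
      finally show ?thesis .
    qed
    then show ?case using k by (intro exI[of _ l]) (auto simp: l_def)
  qed
  then obtain k where k: "1 \<le> k" "\<And>p g. p \<in> Q \<Longrightarrow> g \<in> S_space \<omega> \<Longrightarrow> p g \<le> q_norm \<omega> k k g" by blast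
  show ?thesis
  proof
    fix g assume g: "g \<in> S_space \<omega>" "q_norm \<omega> k k (g - f) < ennreal \<epsilon>"
    have "f \<in> S_space \<omega>" using openin_subset[OF U] f by auto
    then have "g - f \<in> S_space \<omega>" using g complex_subspaceD(4)[OF complex_subspace_S_space] by blast
    then have "\<forall>p\<in>Q. p (g - f) < ennreal \<epsilon>" using k(2) g(2) by (blast intro: le_less_trans)
    then show "g \<in> U" using Q(4) g(1) by auto
  qed (use k Q in auto)
qed

lemma tvs_bounded_S_top_iff:
  fixes X :: "(real^'n::finite \<Rightarrow> complex) set"
  shows "tvs_bounded (S_top \<omega>) X \<longleftrightarrow> X \<subseteq> S_space \<omega> \<and>
    (\<forall>m\<ge>1. \<forall>n\<ge>1. \<exists>C\<ge>0. \<forall>g\<in>X. q_norm \<omega> m n g \<le> ennreal C)"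
proof (intro iffI conjI allI impI)
  assume X: "tvs_bounded (S_top \<omega>) X"
  then show "X \<subseteq> S_space \<omega>" by (simp add: tvs_bounded_def)
  fix m n :: nat assume mn: "1 \<le> m" "1 \<le> n"
  let ?U = "{g \<in> S_space \<omega>. q_norm \<omega> m n (g - 0) < ennreal 1} :: (real^'n \<Rightarrow> complex) set"
  have "0 \<in> (S_space \<omega> :: (real^'n \<Rightarrow> complex) set)"
      by (rule complex_subspaceD(1)[OF complex_subspace_S_space])
  moreover have "q_norm \<omega> m n (0 :: real^'n \<Rightarrow> complex) \<le> ennreal 0"
    using mn by (subst q_norm_le_iff) (auto simp: deriv_bounded_def word_deriv_zero)
  ultimately have "openin (S_top \<omega>) ?U" "0 \<in> ?U"
    using openin_S_top_ball[OF _ mn, of "0 :: real^'n \<Rightarrow> complex" 1] by auto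
  then obtain \<rho> where \<rho>: "\<rho> > 0" "\<And>c. \<rho> \<le> norm c \<Longrightarrow> X \<subseteq> cscale c ` ?U"
    using X unfolding tvs_bounded_def by blast
  have "X \<subseteq> cscale (of_real \<rho>) ` ?U" using \<rho> by (intro \<rho>(2)) auto
  have "q_norm \<omega> m n g \<le> ennreal (norm (complex_of_real \<rho>) * 1)" if "g \<in> X" for g
  proof -
    obtain h where h: "h \<in> ?U" "g = cscale (of_real \<rho>) h"
      using \<open>X \<subseteq> cscale (of_real \<rho>) ` ?U\<close> \<open>g \<in> X\<close> by blast
    then show ?thesis using mn unfolding h(2) by (intro q_norm_cscale) (auto intro: less_imp_le)
  qed
  then show "\<exists>C\<ge>0. \<forall>g\<in>X. q_norm \<omega> m n g \<le> ennreal C"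
    using \<rho>(1) by (intro exI[of _ \<rho>]) auto
next
  assume X: "X \<subseteq> S_space \<omega> \<and> (\<forall>m\<ge>1. \<forall>n\<ge>1. \<exists>C\<ge>0. \<forall>g\<in>X. q_norm \<omega> m n g \<le> ennreal C)"
  show "tvs_bounded (S_top \<omega>) X"
    unfolding tvs_bounded_def
  proof (intro conjI allI impI)
    show "X \<subseteq> topspace (S_top \<omega>)" using X by simp
    fix U :: "(real^'n \<Rightarrow> complex) set" assume U: "openin (S_top \<omega>) U \<and> 0 \<in> U"
    obtain k \<epsilon> where k: "1 \<le> k" "0 < \<epsilon>" "\<And>g. g \<in> S_space \<omega> \<Longrightarrow> q_norm \<omega> k k (g - 0) < ennreal \<epsilon> \<Longrightarrow> g \<in> U"
      using openin_S_top_D[OF conjunct1[OF U] conjunct2[OF U]] by blast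
    obtain C where C: "0 \<le> C" "\<And>g. g \<in> X \<Longrightarrow> q_norm \<omega> k k g \<le> ennreal C"
      using X k(1) by blast
    show "\<exists>\<rho>>0. \<forall>c. \<rho> \<le> norm c \<longrightarrow> X \<subseteq> cscale c ` U"
    \<comment> \<open>The added one keeps the threshold positive for \<open>C = 0\<close> and makes
      the norm of the rescaled function strictly smaller than \<open>\<epsilon>\<close>.\<close>
    proof (intro exI[of _ "(C + 1) / \<epsilon>"] conjI allI impI subsetI)
      show "0 < (C + 1) / \<epsilon>" using C k by simp
      fix c :: complex and g assume c: "(C + 1) / \<epsilon> \<le> norm c" and g: "g \<in> X"
      have c0: "0 < norm c" using c \<open>0 < (C + 1) / \<epsilon>\<close> by linarith
      let ?h = "cscale (1 / c) g"
      have "g \<in> S_space \<omega>" using g X by auto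
      have "q_norm \<omega> k k ?h \<le> ennreal (norm (1 / c) * C)"
        using g C k X by (intro q_norm_cscale) auto
      also have "norm (1 / c) * C < \<epsilon>"
        using c c0 k by (simp add: norm_divide field_simps)
      then have "ennreal (norm (1 / c) * C) < ennreal \<epsilon>" using C by (intro ennreal_lessI) (auto simp: k)
      finally have "?h \<in> U"
        using k(3)[of ?h] complex_subspaceD(3)[OF complex_subspace_S_space \<open>g \<in> S_space \<omega>\<close>] by simp
      moreover have "g = cscale c ?h" using c0 by (auto simp: cscale_def)
      ultimately show "g \<in> cscale c ` U" by blast
    qed
  qed
qed

section \<open>The dual space\<close>

text \<open>Continuity of a functional with respect to one norm, phrased through positive real
  majorants \<open>R\<close> of the extended norm, so that the estimate stays in the reals and
  division by \<open>R\<close> is possible.\<close>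

definition functional_bounded :: "nat \<Rightarrow> real \<Rightarrow> ((real^'n::finite \<Rightarrow> complex) \<Rightarrow> complex) \<Rightarrow> bool" where
  "functional_bounded k C T \<longleftrightarrow> (\<forall>h\<in>S_space \<omega>. \<forall>R>0. q_norm \<omega> k k h \<le> ennreal R \<longrightarrow> norm (T h) \<le> C * R)"

lemma dual_spaceD:
  assumes "T \<in> dual_space (S_top \<omega>)"
  shows "f \<notin> S_space \<omega> \<Longrightarrow> T f = 0" "f \<in> S_space \<omega> \<Longrightarrow> g \<in> S_space \<omega> \<Longrightarrow> T (f + g) = T f + T g"
    "f \<in> S_space \<omega> \<Longrightarrow> T (cscale c f) = c * T f" "f \<in> S_space \<omega> \<Longrightarrow> g \<in> S_space \<omega> \<Longrightarrow> T (f - g) = T f - T g"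
proof -
  show 1: "f \<notin> S_space \<omega> \<Longrightarrow> T f = 0" "f \<in> S_space \<omega> \<Longrightarrow> g \<in> S_space \<omega> \<Longrightarrow> T (f + g) = T f + T g"
    "f \<in> S_space \<omega> \<Longrightarrow> T (cscale c f) = c * T f" for f g c
    using assms by (auto simp: dual_space_def)
  show "T (f - g) = T f - T g" if "f \<in> S_space \<omega>" "g \<in> S_space \<omega>"
  proof -
    have "T (f + cscale (- 1) g) = T f + - 1 * T g"
      using that complex_subspaceD(3)[OF complex_subspace_S_space that(2)] by (simp only: 1)
    then show ?thesis by (simp add: cscale_minus_one)
  qed
qed

lemma dual_space_functional_bounded:
  assumes T: "T \<in> dual_space (S_top \<omega> :: (real^'n::finite \<Rightarrow> complex) topology)"
  shows "\<exists>k\<ge>1. \<exists>C\<ge>0. functional_bounded k C T"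
proof -
  have "continuous_map (S_top \<omega>) euclidean T" using T by (simp add: dual_space_def)
  then have op: "openin (S_top \<omega>) {h \<in> topspace (S_top \<omega>). T h \<in> ball 0 1}"
    by (rule openin_continuous_map_preimage) simp
  have 0: "0 \<in> (S_space \<omega> :: (real^'n \<Rightarrow> complex) set)"
      by (rule complex_subspaceD(1)[OF complex_subspace_S_space])
  then have "T 0 = 0" using dual_spaceD(3)[OF T 0, of 0] by (simp add: cscale_0)
  then have mem: "0 \<in> {h \<in> topspace (S_top \<omega>). T h \<in> ball 0 1}" using 0 by simp
  obtain k \<epsilon> where k: "1 \<le> k" "0 < \<epsilon>"
    "\<And>g. g \<in> S_space \<omega> \<Longrightarrow> q_norm \<omega> k k (g - 0) < ennreal \<epsilon> \<Longrightarrow> g \<in> {h \<in> topspace (S_top \<omega>). T h \<in> ball 0 1}"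
    using openin_S_top_D[OF op mem] by blast
  have "norm (T h) \<le> (2 / \<epsilon>) * R" if h: "h \<in> S_space \<omega>" "0 < R" "q_norm \<omega> k k h \<le> ennreal R" for h R
  proof -
    \<comment> \<open>Half of \<open>\<epsilon>\<close>, so that the scaled function lies strictly
      inside the ball; this gives the constant \<open>2 / \<epsilon>\<close>.\<close>
    define c where "c = complex_of_real (\<epsilon> / (2 * R))"
    have c: "norm c = \<epsilon> / (2 * R)" using h k by (simp add: c_def norm_divide)
    have "q_norm \<omega> k k (cscale c h) \<le> ennreal (norm c * R)"
      using h k by (intro q_norm_cscale) auto
    also have "norm c * R = \<epsilon> / 2" using h c by simp
    also have "ennreal (\<epsilon> / 2) < ennreal \<epsilon>" using k by (intro ennreal_lessI) auto
    finally have "norm (T (cscale c h)) < 1"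
      using k(3)[of "cscale c h"] complex_subspaceD(3)[OF complex_subspace_S_space h(1)] by simp
    then have "\<epsilon> / (2 * R) * norm (T h) < 1"
      using dual_spaceD(3)[OF T h(1)] c by (simp add: norm_mult)
    then show ?thesis using h k by (simp add: field_simps)
  qed
  then have "functional_bounded k (2 / \<epsilon>) T" unfolding functional_bounded_def by blast
  then show ?thesis using k by (intro exI[of _ k] conjI exI[of _ "2 / \<epsilon>"]) auto
qed

lemma dual_spaceI:
  fixes T :: "(real^'n::finite \<Rightarrow> complex) \<Rightarrow> complex"
  assumes ext: "\<And>f. f \<notin> S_space \<omega> \<Longrightarrow> T f = 0"
    and add: "\<And>f g. f \<in> S_space \<omega> \<Longrightarrow> g \<in> S_space \<omega> \<Longrightarrow> T (f + g) = T f + T g"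
    and scale: "\<And>c f. f \<in> S_space \<omega> \<Longrightarrow> T (cscale c f) = c * T f"
    and k: "1 \<le> k" and C: "0 \<le> C" and bounded: "functional_bounded k C T"
  shows "T \<in> dual_space (S_top \<omega>)"
proof -
  have "continuous_map (S_top \<omega>) euclidean T"
    unfolding continuous_map_def
  proof (intro conjI allI impI)
    fix V :: "complex set" assume V: "openin euclidean V"
    show "openin (S_top \<omega>) {x \<in> topspace (S_top \<omega>). T x \<in> V}"
    proof (subst openin_subopen, intro ballI)
      fix x assume "x \<in> {x \<in> topspace (S_top \<omega>). T x \<in> V}"
      then have x: "x \<in> S_space \<omega>" "T x \<in> V" by auto
      obtain \<epsilon> where \<epsilon>: "0 < \<epsilon>" "ball (T x) \<epsilon> \<subseteq> V" using V x(2) by (auto simp: open_contains_ball)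
      define \<eta> where "\<eta> = \<epsilon> / (C + 1)"
      have \<eta>: "0 < \<eta>" "C * \<eta> < \<epsilon>" using \<epsilon>(1) C by (simp_all add: \<eta>_def field_simps)
      let ?B = "{y \<in> S_space \<omega>. q_norm \<omega> k k (y - x) < ennreal \<eta>}"
      have "T y \<in> V" if y: "y \<in> ?B" for y
      proof -
        have yx: "y - x \<in> S_space \<omega>" using y x by
            (auto intro: complex_subspaceD(4)[OF complex_subspace_S_space])
        have "norm (T (y - x)) \<le> C * \<eta>"
          using bounded yx \<eta>(1) y by (auto simp: functional_bounded_def)
        moreover have "T y = T (y - x) + T x" using add[OF yx x(1)] by simp
        ultimately have "dist (T x) (T y) < \<epsilon>" using \<eta>(2) by (simp add: dist_norm norm_minus_commute)
        then show ?thesis using \<epsilon>(2) by auto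
      qed
      moreover have "q_norm \<omega> k k (0 :: real^'n \<Rightarrow> complex) \<le> ennreal 0"
        using k by (subst q_norm_le_iff) (auto simp: deriv_bounded_def word_deriv_zero)
      ultimately show "\<exists>U. openin (S_top \<omega>) U \<and> x \<in> U \<and> U \<subseteq> {x \<in> topspace (S_top \<omega>). T x \<in> V}"
        using openin_S_top_ball[OF x(1) k k, of \<eta>] x(1) \<eta>(1) by (intro exI[of _ ?B]) auto
    qed
  qed auto
  then show ?thesis using ext add scale by (auto simp: dual_space_def)
qed

text \<open>The seminorm of uniform convergence on \<open>X\<close>, that is, the gauge of its
  polar.\<close>

definition polar_norm :: "(real^'n::finite \<Rightarrow> complex) set \<Rightarrow> ((real^'n \<Rightarrow> complex) \<Rightarrow> complex) \<Rightarrow>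
    ennreal" where
  "polar_norm X u = (SUP f\<in>X. ennreal (norm (u f)))"

lemma polar_norm_le_iff: "0 \<le> C \<Longrightarrow> polar_norm X u \<le> ennreal C \<longleftrightarrow> (\<forall>f\<in>X. norm (u f) \<le> C)"
  by (simp add: polar_norm_def SUP_le_iff)

lemma polar_norm_mono: "X \<subseteq> Y \<Longrightarrow> polar_norm X u \<le> polar_norm Y u"
  unfolding polar_norm_def by (rule SUP_subset_mono) auto

lemma polar_norm_add: "polar_norm X (u + v) \<le> polar_norm X u + polar_norm X v"
  unfolding polar_norm_def
proof (rule SUP_least)
  fix f assume f: "f \<in> X"
  have "ennreal (norm ((u + v) f)) \<le> ennreal (norm (u f)) + ennreal (norm (v f))"
    by (simp add: norm_triangle_ineq flip: ennreal_plus)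
  also have "\<dots> \<le> (SUP f\<in>X. ennreal (norm (u f))) + (SUP f\<in>X. ennreal (norm (v f)))"
    using f by (intro add_mono SUP_upper)
  finally show "ennreal (norm ((u + v) f)) \<le> \<dots>" .
qed

lemma functional_bounded_mono:
  assumes T: "functional_bounded k C T" and k: "1 \<le> k" "k \<le> l" and C: "C \<le> D"
  shows "functional_bounded l D T"
  unfolding functional_bounded_def
proof (intro ballI allI impI)
  fix h :: "real^'a \<Rightarrow> complex" and R :: real
  assume h: "h \<in> S_space \<omega>" "0 < R" "q_norm \<omega> l l h \<le> ennreal R"
  then have "q_norm \<omega> k k h \<le> ennreal R" using q_norm_mono[OF h(1) k(1) k(2) k(2)]
      by (blast intro: order_trans)
  then have "norm (T h) \<le> C * R" using T h by (auto simp: functional_bounded_def)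
  also have "\<dots> \<le> D * R" using C h by (intro mult_right_mono) auto
  finally show "norm (T h) \<le> D * R" .
qed

lemma complex_subspace_dual_space: "complex_subspace (dual_space (S_top \<omega> :: (real^'n::finite \<Rightarrow>
    complex) topology))"
  unfolding complex_subspace_def
proof (intro conjI ballI allI)
  show "0 \<in> dual_space (S_top \<omega> :: (real^'n \<Rightarrow> complex) topology)"
    by (rule dual_spaceI[of _ 1 0]) (auto simp: functional_bounded_def)
next
  fix T T' assume T: "T \<in> dual_space (S_top \<omega> :: (real^'n \<Rightarrow> complex) topology)"
    "T' \<in> dual_space (S_top \<omega> :: (real^'n \<Rightarrow> complex) topology)"
  obtain k C where k: "1 \<le> k" "0 \<le> C" "functional_bounded k C T"
      using dual_space_functional_bounded[OF T(1)] by blast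
  obtain l D where l: "1 \<le> l" "0 \<le> D" "functional_bounded l D T'"
      using dual_space_functional_bounded[OF T(2)] by blast
  have b: "functional_bounded (max k l) C T" "functional_bounded (max k l) D T'"
    using functional_bounded_mono[OF k(3) k(1)] functional_bounded_mono[OF l(3) l(1)] by auto
  show "T + T' \<in> dual_space (S_top \<omega>)"
  proof (rule dual_spaceI[of _ "max k l" "C + D"])
    show "functional_bounded (max k l) (C + D) (T + T')"
      using b unfolding functional_bounded_def
      by (auto simp: distrib_right intro!: order_trans[OF norm_triangle_ineq] add_mono)
  qed (use k l dual_spaceD[OF T(1)] dual_spaceD[OF T(2)] in \<open>auto simp: distrib_left\<close>)
next
  fix c T assume T: "T \<in> dual_space (S_top \<omega> :: (real^'n \<Rightarrow> complex) topology)"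
  obtain k C where k: "1 \<le> k" "0 \<le> C" "functional_bounded k C T"
      using dual_space_functional_bounded[OF T] by blast
  show "cscale c T \<in> dual_space (S_top \<omega>)"
  proof (rule dual_spaceI[of _ k "norm c * C"])
    show "functional_bounded k (norm c * C) (cscale c T)"
      using k(3) unfolding functional_bounded_def
      by (auto simp: cscale_def norm_mult mult.assoc intro!: mult_left_mono)
  qed (use k dual_spaceD[OF T] in \<open>auto simp: distrib_left cscale_def\<close>)
qed

lemma topspace_strong_dual [simp]: "topspace (strong_dual E) = dual_space E"
  by (simp add: strong_dual_def)

lemma strong_dual_eq:
  "strong_dual (S_top \<omega>) = seminorm_topology (dual_space (S_top \<omega>)) {polar_norm X |X. tvs_bounded
      (S_top \<omega>) X}"
  unfolding strong_dual_def polar_norm_def[abs_def] ..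

lemma openin_strong_dual_ball:
  assumes "T \<in> dual_space (S_top \<omega>)" "tvs_bounded (S_top \<omega>) X"
  shows "openin (strong_dual (S_top \<omega>)) {u \<in> dual_space (S_top \<omega>). polar_norm X (u - T) < ennreal \<epsilon>}"
  unfolding strong_dual_eq using assms
  by (intro openin_seminorm_ball complex_subspace_dual_space polar_norm_add) auto

lemma tvs_bounded_Un:
  "tvs_bounded (S_top \<omega>) X \<Longrightarrow> tvs_bounded (S_top \<omega>) Y \<Longrightarrow> tvs_bounded (S_top \<omega>) (X \<union> Y)"
  unfolding tvs_bounded_S_top_iff
proof (intro conjI allI impI)
  fix m n :: nat assume mn: "1 \<le> m" "1 \<le> n"
  assume X: "X \<subseteq> S_space \<omega> \<and> (\<forall>m\<ge>1. \<forall>n\<ge>1. \<exists>C\<ge>0. \<forall>g\<in>X. q_norm \<omega> m n g \<le> ennreal C)"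
    and Y: "Y \<subseteq> S_space \<omega> \<and> (\<forall>m\<ge>1. \<forall>n\<ge>1. \<exists>C\<ge>0. \<forall>g\<in>Y. q_norm \<omega> m n g \<le> ennreal C)"
  have "\<exists>C\<ge>0. \<forall>g\<in>X. q_norm \<omega> m n g \<le> ennreal C" "\<exists>C\<ge>0. \<forall>g\<in>Y. q_norm \<omega> m n g \<le> ennreal C"
    using X Y mn by simp_all
  then obtain C D where C: "0 \<le> C" "\<And>g. g \<in> X \<Longrightarrow> q_norm \<omega> m n g \<le> ennreal C"
    and D: "0 \<le> D" "\<And>g. g \<in> Y \<Longrightarrow> q_norm \<omega> m n g \<le> ennreal D" by blast
  have "ennreal C \<le> ennreal (max C D)" "ennreal D \<le> ennreal (max C D)" by (intro ennreal_leI; simp)+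
  then have "\<forall>g\<in>X \<union> Y. q_norm \<omega> m n g \<le> ennreal (max C D)"
    using order_trans[OF C(2)] order_trans[OF D(2)] by blast
  then show "\<exists>C\<ge>0. \<forall>g\<in>X \<union> Y. q_norm \<omega> m n g \<le> ennreal C" using C by (intro exI[of _ "max C D"]) auto
qed auto

lemma tvs_bounded_empty: "tvs_bounded (S_top \<omega>) {}"
  unfolding tvs_bounded_S_top_iff by auto

text \<open>Finite unions of bounded sets are bounded, so that a single bounded set suffices to
  describe a neighbourhood.\<close>

lemma openin_strong_dual_D:
  fixes V :: "((real^'n::finite \<Rightarrow> complex) \<Rightarrow> complex) set"
  assumes V: "openin (strong_dual (S_top \<omega>)) V" and T: "T \<in> V"
  obtains X \<epsilon> where "tvs_bounded (S_top \<omega>) X" "0 < \<epsilon>"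
    "\<And>u. u \<in> dual_space (S_top \<omega>) \<Longrightarrow> polar_norm X (u - T) < ennreal \<epsilon> \<Longrightarrow> u \<in> V"
proof -
  obtain Q \<epsilon> where Q: "finite Q" "Q \<subseteq> {polar_norm X |X. tvs_bounded (S_top \<omega>) X}" "0 < (\<epsilon>::real)"
      "{y\<in>dual_space (S_top \<omega>). \<forall>p\<in>Q. p (y - T) < ennreal \<epsilon>} \<subseteq> V"
    using V T unfolding strong_dual_eq openin_seminorm_topology by blast
  have "\<exists>X. tvs_bounded (S_top \<omega>) X \<and> (\<forall>p\<in>Q. \<forall>u. p u \<le> polar_norm X u)"
    using Q(1,2)
  proof (induction Q rule: finite_induct)
    case empty
    then show ?case using tvs_bounded_empty by auto
  next
    case (insert p Q)
    then obtain X where X: "tvs_bounded (S_top \<omega>) X" "\<forall>p\<in>Q. \<forall>u. p u \<le> polar_norm X u" by auto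
    obtain Y where Y: "p = polar_norm Y" "tvs_bounded (S_top \<omega>) Y" using insert.prems by auto
    have "p' u \<le> polar_norm (X \<union> Y) u" if "p' \<in> insert p Q" for p' u
    proof (cases "p' = p")
      case True
      then show ?thesis unfolding True Y(1) by (intro polar_norm_mono) auto
    next
      case False
      then have "p' u \<le> polar_norm X u" using that X(2) by simp
      also have "\<dots> \<le> polar_norm (X \<union> Y) u" by (intro polar_norm_mono) auto
      finally show ?thesis .
    qed
    then show ?case using tvs_bounded_Un[OF X(1) Y(2)] by blast
  qed
  then obtain X where X: "tvs_bounded (S_top \<omega>) X" "\<And>p u. p \<in> Q \<Longrightarrow> p u \<le> polar_norm X u" by blast
  show ?thesis
  proof
    fix u assume u: "u \<in> dual_space (S_top \<omega>)" "polar_norm X (u - T) < ennreal \<epsilon>"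
    then have "\<forall>p\<in>Q. p (u - T) < ennreal \<epsilon>" using X(2) by (blast intro: le_less_trans)
    then show "u \<in> V" using Q(4) u(1) by auto
  qed (use X Q in auto)
qed

text \<open>The space of test functions is metrizable, hence quasi-barrelled: if a strongly bounded set of
  functionals were not equicontinuous, witnesses to this at the norms \<open>q\<^bsub>k,k\<^esub>\<close> would form a bounded
  set on which it is unbounded.\<close>

lemma tvs_bounded_dual_equicontinuous:
  fixes B :: "((real^'n::finite \<Rightarrow> complex) \<Rightarrow> complex) set"
  assumes B: "tvs_bounded (strong_dual (S_top \<omega>)) B"
  shows "\<exists>k\<ge>1. \<exists>C\<ge>0. \<forall>T\<in>B. functional_bounded k C T"
proof (rule ccontr)
  assume contra: "\<not> ?thesis"
  have BS: "B \<subseteq> dual_space (S_top \<omega>)" using B by (simp add: tvs_bounded_def)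
  have "\<exists>T x. T \<in> B \<and> x \<in> S_space \<omega> \<and> norm (T x) = real (Suc k) \<and> q_norm \<omega> (Suc k) (Suc k) x \<le>
      ennreal 1" for k
  proof -
    have "\<not> (\<forall>T\<in>B. functional_bounded (Suc k) (real (Suc k)) T)" using contra by
        (auto simp del: of_nat_Suc)
    then obtain T h R where h: "T \<in> B" "h \<in> S_space \<omega>" "0 < R" "q_norm \<omega> (Suc k) (Suc k) h \<le> ennreal R"
      "real (Suc k) * R < norm (T h)"
      unfolding functional_bounded_def by (auto simp: not_le simp del: of_nat_Suc)
    have pos: "0 < norm (T h)" using h(3,5) by (smt (verit) mult_nonneg_nonneg of_nat_0_le_iff)
    \<comment> \<open>Scaling gives the functional the exact value \<open>Suc k\<close>; the
      violated inequality then keeps the norm of the scaled witness below one.\<close>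
    define c where "c = complex_of_real (real (Suc k) / norm (T h))"
    have c: "norm c = real (Suc k) / norm (T h)" by (simp add: c_def norm_divide del: of_nat_Suc)
    have "T (cscale c h) = c * T h" using h(1,2) BS dual_spaceD(3) by blast
    then have "norm (T (cscale c h)) = real (Suc k)" using c pos by (simp add: norm_mult del: of_nat_Suc)
    moreover have "q_norm \<omega> (Suc k) (Suc k) (cscale c h) \<le> ennreal (norm c * R)"
      using h by (intro q_norm_cscale) auto
    moreover have "norm c * R \<le> 1" using h(5) pos by (simp add: c field_simps del: of_nat_Suc)
    then have "ennreal (norm c * R) \<le> ennreal 1" by (rule ennreal_leI)
    ultimately have "q_norm \<omega> (Suc k) (Suc k) (cscale c h) \<le> ennreal 1" "norm (T (cscale c h)) =
        real (Suc k)"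
      by (blast intro: order_trans)+
    then show ?thesis
      using h(1) complex_subspaceD(3)[OF complex_subspace_S_space h(2), of c] by blast
  qed
  then obtain T x where Tx: "\<And>k. T k \<in> B" "\<And>k. x k \<in> S_space \<omega>" "\<And>k. norm (T k (x k)) = real (Suc k)"
      "\<And>k. q_norm \<omega> (Suc k) (Suc k) (x k) \<le> ennreal 1"
    by metis
  have "tvs_bounded (S_top \<omega>) (range x)"
    unfolding tvs_bounded_S_top_iff
  proof (intro conjI allI impI)
    show "range x \<subseteq> S_space \<omega>" using Tx(2) by auto
    fix m n :: nat assume mn: "1 \<le> m" "1 \<le> n"
    have "\<forall>k. \<exists>C. 0 \<le> C \<and> q_norm \<omega> m n (x k) \<le> ennreal C"
    proof
      fix k
      obtain C where "0 \<le> C" "q_norm \<omega> m n (x k) = ennreal C"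
        using q_norm_finite[OF Tx(2) mn(1)] by blast
      then show "\<exists>C. 0 \<le> C \<and> q_norm \<omega> m n (x k) \<le> ennreal C" by (intro exI[of _ C]) simp
    qed
    from choice[OF this] obtain c where c: "\<And>k. 0 \<le> c k" "\<And>k. q_norm \<omega> m n (x k) \<le> ennreal (c k)"
        by blast
    \<comment> \<open>From index \<open>max m n\<close> on, monotonicity of the norms gives the
      bound one; the finitely many earlier witnesses are accounted for by the sum.\<close>
    define C where "C = 1 + (\<Sum>k<max m n. c k)"
    have C: "0 \<le> (\<Sum>k<max m n. c k)" using c by (intro sum_nonneg) auto
    have "q_norm \<omega> m n (x k) \<le> ennreal C" for k
    proof (cases "k < max m n")
      case True
      then have "c k \<le> (\<Sum>k<max m n. c k)" using c(1) by (intro member_le_sum) auto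
      then have "c k \<le> C" by (simp add: C_def)
      then show ?thesis using c(2)[of k] by (blast intro: order_trans ennreal_leI)
    next
      case False
      then have "q_norm \<omega> m n (x k) \<le> q_norm \<omega> (Suc k) (Suc k) (x k)" using mn
          by (intro q_norm_mono Tx) auto
      also have "\<dots> \<le> ennreal 1" by (rule Tx)
      also have "\<dots> \<le> ennreal C" using C by (intro ennreal_leI) (simp add: C_def)
      finally show ?thesis .
    qed
    then show "\<exists>C\<ge>0. \<forall>g\<in>range x. q_norm \<omega> m n g \<le> ennreal C"
      using C by (intro exI[of _ C]) (auto simp: C_def)
  qed
  let ?U = "{u \<in> dual_space (S_top \<omega>). polar_norm (range x) (u - 0) < ennreal 1}"
  have 0: "0 \<in> dual_space (S_top \<omega> :: (real^'n \<Rightarrow> complex) topology)"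
    by (rule complex_subspaceD(1)[OF complex_subspace_dual_space])
  have "openin (strong_dual (S_top \<omega>)) ?U"
    using openin_strong_dual_ball[OF 0 \<open>tvs_bounded (S_top \<omega>) (range x)\<close>] .
  moreover have "polar_norm (range x) (0 - 0) \<le> ennreal 0" by (subst polar_norm_le_iff) auto
  then have "0 \<in> ?U" using 0 by auto
  ultimately obtain \<rho> where \<rho>: "0 < \<rho>" "\<And>c. \<rho> \<le> norm c \<Longrightarrow> B \<subseteq> cscale c ` ?U"
    using B unfolding tvs_bounded_def by blast
  \<comment> \<open>All of \<open>B\<close> is bounded by \<open>\<rho>\<close> on the witnesses,
    whereas \<open>T k\<close> takes the value \<open>Suc k\<close> there.\<close>
  obtain k :: nat where k: "\<rho> < real k" using reals_Archimedean2 by blast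
  have "T k \<in> cscale (of_real \<rho>) ` ?U" using \<rho>(2)[of "of_real \<rho>"] \<rho>(1) Tx(1) by auto
  then obtain u where u: "T k = cscale (of_real \<rho>) u" "polar_norm (range x) u < ennreal 1" by auto
  then have "norm (u (x k)) \<le> 1"
    using polar_norm_le_iff[of 1 "range x" u] by (auto intro: less_imp_le)
  then have "norm (T k (x k)) \<le> \<rho> * 1"
    unfolding u(1) using \<rho>(1) by (simp add: cscale_def norm_mult)
  then show False using k Tx(3)[of k] by simp
qed

section \<open>Multipliers\<close>

lemma O_step_space_iff:
  "1 \<le> m \<Longrightarrow> f \<in> O_step_space \<omega> m n \<longleftrightarrow> smooth f \<and> (\<exists>R\<ge>0. r_bounded m n R f)"
proof -
  assume m: "1 \<le> m"
  have "r_norm \<omega> m n f < \<infinity> \<longleftrightarrow> (\<exists>R\<ge>0. r_norm \<omega> m n f \<le> ennreal R)"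
    by (cases "r_norm \<omega> m n f") (auto simp: top_unique)
  then show ?thesis using m by (auto simp: O_step_space_def r_norm_le_iff)
qed

lemma O_step_space_mono: "1 \<le> m \<Longrightarrow> n \<le> n' \<Longrightarrow> O_step_space \<omega> m n \<subseteq> O_step_space \<omega> m n'"
  using deriv_bounded_mono[where m = m and m' = m and l = "- real n" and l' = "- real n'"]
      by (fastforce simp: O_step_space_iff)

lemma complex_subspace_O_step_space:
  assumes m: "1 \<le> m"
  shows "complex_subspace (O_step_space \<omega> m n :: (real^'n::finite \<Rightarrow> complex) set)"
  unfolding complex_subspace_def
proof (intro conjI ballI allI)
  show "0 \<in> (O_step_space \<omega> m n :: (real^'n \<Rightarrow> complex) set)"
    using m by (auto simp: O_step_space_iff smooth_zero deriv_bounded_def word_deriv_zero)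
next
  fix f g :: "real^'n \<Rightarrow> complex" assume "f \<in> O_step_space \<omega> m n" "g \<in> O_step_space \<omega> m n"
  then obtain R R' where "smooth f" "0 \<le> R" "r_bounded m n R f" "smooth g" "0 \<le> R'" "r_bounded m n R' g"
    using m by (auto simp: O_step_space_iff)
  then show "f + g \<in> O_step_space \<omega> m n"
    using m deriv_bounded_add[of f g m "- real n" R R'] by
        (auto simp: O_step_space_iff smooth_add intro!: exI[of _ "R + R'"])
next
  fix f :: "real^'n \<Rightarrow> complex" and c assume "f \<in> O_step_space \<omega> m n"
  then obtain R where "smooth f" "0 \<le> R" "r_bounded m n R f"
    using m by (auto simp: O_step_space_iff)
  then show "cscale c f \<in> O_step_space \<omega> m n"
    using m deriv_bounded_cscale[of f m "- real n" R c] by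
        (auto simp: O_step_space_iff smooth_cscale intro!: exI[of _ "norm c * R"])
qed

definition O_union :: "nat \<Rightarrow> (real^'n::finite \<Rightarrow> complex) set" where
  "O_union m = (\<Union>n\<in>{1..}. O_step_space \<omega> m n)"

lemma topspace_O_step_top [simp]: "topspace (O_step_top \<omega> m n) = O_step_space \<omega> m n"
  by (simp add: O_step_top_def)

lemma complex_subspace_O_union:
  assumes m: "1 \<le> m"
  shows "complex_subspace (O_union m :: (real^'n::finite \<Rightarrow> complex) set)"
  unfolding complex_subspace_def
proof (intro conjI ballI allI)
  show "0 \<in> (O_union m :: (real^'n \<Rightarrow> complex) set)"
    using complex_subspaceD(1)[OF complex_subspace_O_step_space[OF m, of 1]] by (auto simp: O_union_def)
next
  fix f g :: "real^'n \<Rightarrow> complex" assume "f \<in> O_union m" "g \<in> O_union m"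
  then obtain n n' where n: "1 \<le> n" "f \<in> O_step_space \<omega> m n" "g \<in> O_step_space \<omega> m n'"
    by (auto simp: O_union_def)
  then have "f \<in> O_step_space \<omega> m (max n n')" "g \<in> O_step_space \<omega> m (max n n')"
    using O_step_space_mono[OF m] by (meson max.cobounded1 max.cobounded2 subsetD)+
  then have "f + g \<in> O_step_space \<omega> m (max n n')"
    using complex_subspaceD(2)[OF complex_subspace_O_step_space[OF m]] by blast
  then show "f + g \<in> O_union m" using n(1) by (auto simp: O_union_def intro!: bexI[of _ "max n n'"])
next
  fix f :: "real^'n \<Rightarrow> complex" and c assume "f \<in> O_union m"
  then show "cscale c f \<in> O_union m"
    using complex_subspaceD(3)[OF complex_subspace_O_step_space[OF m]] unfolding O_union_def by blast
qed

abbreviation OM_step :: "nat \<Rightarrow> (real^'n::finite \<Rightarrow> complex) topology" where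
  "OM_step m \<equiv> ind_limit_topology {1..} (O_step_top \<omega> m)"

text \<open>The underlying set of a topology is its largest open set, so it has to be checked that
  the whole union is open. Being a vector space, the union itself serves as the absolutely convex
  neighbourhood of zero.\<close>

lemma topspace_OM_step:
  assumes m: "1 \<le> m"
  shows "topspace (OM_step m) = (O_union m :: (real^'n::finite \<Rightarrow> complex) set)"
proof
  show "topspace (OM_step m) \<subseteq> (O_union m :: (real^'n \<Rightarrow> complex) set)"
    using openin_topspace[of "OM_step m"] unfolding openin_ind_limit_topology by (auto simp: O_union_def)
  have "openin (OM_step m) (O_union m :: (real^'n \<Rightarrow> complex) set)"
    unfolding openin_ind_limit_topology
  proof (intro conjI ballI)
    fix x :: "real^'n \<Rightarrow> complex" assume x: "x \<in> O_union m"
    note sub = complex_subspaceD[OF complex_subspace_O_union[OF m, where 'n = 'n]]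
    have "absolutely_convex (O_union m :: (real^'n \<Rightarrow> complex) set)"
      unfolding absolutely_convex_def by (intro ballI allI impI sub(2) sub(3))
    moreover have "\<exists>W. openin (O_step_top \<omega> m n) W \<and> 0 \<in> W \<and> W \<subseteq> (O_union m :: (real^'n \<Rightarrow> complex) set)"
      if "n \<in> {1..}" for n
      using that complex_subspaceD(1)[OF complex_subspace_O_step_space[OF m, of n]]
      by (intro exI[of _ "O_step_space \<omega> m n"])
        (auto simp: O_union_def intro: openin_topspace[of "O_step_top \<omega> m n",
            unfolded topspace_O_step_top])
    moreover have "O_union m \<subseteq> (\<Union>n\<in>{1..}. topspace (O_step_top \<omega> m n))" by (simp add: O_union_def)
    moreover have "(\<lambda>v. x + v) ` O_union m \<subseteq> O_union m" using sub(2)[OF x] by blast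
    ultimately show "\<exists>V. V \<subseteq> (\<Union>n\<in>{1..}. topspace (O_step_top \<omega> m n)) \<and> absolutely_convex V \<and>
        (\<forall>n\<in>{1..}. \<exists>W. openin (O_step_top \<omega> m n) W \<and> 0 \<in> W \<and> W \<subseteq> V) \<and> (\<lambda>v. x + v) ` V \<subseteq> O_union m"
      by blast
  qed (auto simp: O_union_def)
  then show "(O_union m :: (real^'n \<Rightarrow> complex) set) \<subseteq> topspace (OM_step m)" by (rule openin_subset)
qed

lemma OM_top_eq:
  "OM_top \<omega> = topology_generated_by
    (\<Union>m\<in>{1..}. {U \<inter> (\<Inter>m\<in>{1..}. O_union m) |U :: (real^'n::finite \<Rightarrow> complex) set. openin (OM_step m) U})"
proof -
  have "(\<Inter>m\<in>{1..}. topspace (OM_step m)) = (\<Inter>m\<in>{1..}. O_union m :: (real^'n \<Rightarrow> complex) set)"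
    by (intro INF_cong refl topspace_OM_step) auto
  then show ?thesis unfolding OM_top_def proj_limit_topology_def by (simp only:)
qed

lemma topspace_OM_top: "topspace (OM_top \<omega>) = (\<Inter>m\<in>{1..}. O_union m :: (real^'n::finite \<Rightarrow> complex) set)"
proof -
  have "topspace (OM_step 1) \<inter> (\<Inter>m\<in>{1..}. O_union m) = (\<Inter>m\<in>{1..}. O_union m :: (real^'n \<Rightarrow> complex) set)"
    by (subst topspace_OM_step) auto
  then have "(\<Inter>m\<in>{1..}. O_union m) \<in> {U \<inter> (\<Inter>m\<in>{1..}. O_union m) |U :: (real^'n \<Rightarrow> complex) set.
      openin (OM_step 1) U}"
    by (intro CollectI exI[of _ "topspace (OM_step 1)"] conjI openin_topspace) simp
  then have "(\<Inter>m\<in>{1..}. O_union m) \<in> (\<Union>m\<in>{1..}. {U \<inter> (\<Inter>m\<in>{1..}. O_union m) |U :: (real^'n \<Rightarrow> complex)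
      set. openin (OM_step m) U})"
    by (intro UN_I[of 1]) auto
  then show ?thesis unfolding OM_top_eq topology_generated_by_topspace by blast
qed

lemma openin_OM_top:
  assumes "openin (OM_step m) U" "1 \<le> m"
  shows "openin (OM_top \<omega>) (U \<inter> topspace (OM_top \<omega>))"
  unfolding topspace_OM_top unfolding OM_top_eq
  using assms by (intro topology_generated_by_Basis) auto

lemma complex_subspace_OM: "complex_subspace (topspace (OM_top \<omega>) :: (real^'n::finite \<Rightarrow> complex) set)"
proof -
  have "complex_subspace (O_union m :: (real^'n \<Rightarrow> complex) set)" if "m \<in> {1..}" for m
    using that by (intro complex_subspace_O_union) simp
  note sub = complex_subspaceD[OF this]
  show ?thesis
    unfolding topspace_OM_top complex_subspace_def
  proof (intro conjI ballI allI INT_I)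
    fix m :: nat assume m: "m \<in> {1..}"
    show "0 \<in> (O_union m :: (real^'n \<Rightarrow> complex) set)" by (rule sub(1)[OF m])
    fix x y :: "real^'n \<Rightarrow> complex" and c
    assume x: "x \<in> (\<Inter>m\<in>{1..}. O_union m)"
    show "cscale c x \<in> O_union m" by (rule sub(3)[OF m INT_D[OF x m]])
    assume y: "y \<in> (\<Inter>m\<in>{1..}. O_union m)"
    show "x + y \<in> O_union m" by (rule sub(2)[OF m INT_D[OF x m] INT_D[OF y m]])
  qed
qed

lemma OM_smooth: "f \<in> topspace (OM_top \<omega>) \<Longrightarrow> smooth f"
  unfolding topspace_OM_top O_union_def O_step_space_def by auto

lemma OM_r_bounded:
  assumes f: "f \<in> topspace (OM_top \<omega>)"
  shows "\<exists>n R. 0 \<le> R \<and> r_bounded m n R f"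
proof -
  \<comment> \<open>The steps are indexed from one; the bound for \<open>m = 0\<close> follows by
    monotonicity.\<close>
  have "f \<in> O_union (max 1 m)" using f unfolding topspace_OM_top by auto
  then obtain n where "f \<in> O_step_space \<omega> (max 1 m) n" by (auto simp: O_union_def)
  then obtain R where "0 \<le> R" "r_bounded (max 1 m) n R f" by (auto simp: O_step_space_iff)
  then show ?thesis using deriv_bounded_mono[of "max 1 m" "- real n" R f m "- real n" R] by auto
qed

lemma OM_mult_S_space: "f \<in> topspace (OM_top \<omega>) \<Longrightarrow> g \<in> S_space \<omega> \<Longrightarrow> f * g \<in> S_space \<omega>"
  using q_finite_mult OM_smooth OM_r_bounded unfolding S_space_eq by blast

text \<open>Continuity of multiplication by one fixed multiplier, with all constants of
  \<open>f\<close> absorbed into \<open>k\<close> and \<open>D\<close>.\<close>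

lemma OM_mult_bound:
  fixes f :: "real^'n::finite \<Rightarrow> complex"
  assumes f: "f \<in> topspace (OM_top \<omega>)" and m: "1 \<le> m"
  shows "\<exists>k\<ge>1. \<exists>D>0. \<forall>g\<in>S_space \<omega>. \<forall>Q\<ge>0. q_norm \<omega> k k g \<le> ennreal Q \<longrightarrow> q_norm \<omega> m n (f * g) \<le>
      ennreal (D * Q)"
proof -
  obtain D m' where D: "0 < D" "m \<le> m'" "\<And>n n' R Q f g. smooth f \<Longrightarrow> smooth g \<Longrightarrow> 0 \<le> R \<Longrightarrow> 0 \<le> Q \<Longrightarrow>
      r_bounded m' n' R f \<Longrightarrow> q_bounded m' (n + n') Q g \<Longrightarrow> q_bounded m n (D * R * Q) (f * (g :: real^'n
          \<Rightarrow> complex))"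
    using q_bounded_mult[of m] by blast
  obtain n' R where R: "0 \<le> R" "r_bounded m' n' R f" using OM_r_bounded[OF f] by blast
  \<comment> \<open>Enlarging \<open>R\<close> makes the final constant positive even if
    \<open>f\<close> is zero.\<close>
  then have R1: "r_bounded m' n' (R + 1) f" by (intro deriv_bounded_mono[OF R(2)]) auto
  define k where "k = max m' (n + n')"
  have k: "1 \<le> k" using m D(2) by (simp add: k_def)
  have "q_norm \<omega> m n (f * g) \<le> ennreal (D * (R + 1) * Q)"
    if g: "g \<in> S_space \<omega>" "0 \<le> Q" "q_norm \<omega> k k g \<le> ennreal Q" for g Q
  proof -
    have "q_bounded k k Q g" using g k by (simp add: q_norm_le_iff)
    then have "q_bounded m' (n + n') Q g" by (rule deriv_bounded_mono) (auto simp: k_def)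
    then have "q_bounded m n (D * (R + 1) * Q) (f * g)"
      using R R1 g by (intro D(3) OM_smooth[OF f] S_space_smooth[OF g(1)]) auto
    then show ?thesis using m D(1) R g by (simp add: q_norm_le_iff)
  qed
  then show ?thesis using k D(1) R by (intro exI[of _ k] conjI exI[of _ "D * (R + 1)"]) auto
qed

lemma O_step_top_ball:
  assumes m: "1 \<le> m" and \<epsilon>: "0 < \<epsilon>"
  shows "\<exists>W :: (real^'n::finite \<Rightarrow> complex) set. openin (O_step_top \<omega> m n) W \<and> 0 \<in> W \<and>
    (\<forall>f\<in>W. smooth f \<and> r_bounded m n \<epsilon> f)"
proof (intro exI conjI)
  let ?W = "{f \<in> O_step_space \<omega> m n. r_norm \<omega> m n (f - 0) < ennreal \<epsilon>} :: (real^'n \<Rightarrow> complex) set"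
  have sub: "r_norm \<omega> m n (y + z) \<le> r_norm \<omega> m n y + r_norm \<omega> m n z"
    if yz: "y \<in> O_step_space \<omega> m n" "z \<in> O_step_space \<omega> m n" for y z :: "real^'n \<Rightarrow> complex"
  proof -
    obtain C where C: "0 \<le> C" "r_norm \<omega> m n y = ennreal C"
      using yz(1) by (cases "r_norm \<omega> m n y") (auto simp: O_step_space_def)
    obtain D where D: "0 \<le> D" "r_norm \<omega> m n z = ennreal D"
      using yz(2) by (cases "r_norm \<omega> m n z") (auto simp: O_step_space_def)
    have "r_bounded m n C y" "r_bounded m n D z"
      using C D r_norm_le_iff[OF m C(1), of n y] r_norm_le_iff[OF m D(1), of n z] by auto
    then have "r_bounded m n (C + D) (y + z)"
      using yz by (intro deriv_bounded_add) (auto simp: O_step_space_def)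
    then have "r_norm \<omega> m n (y + z) \<le> ennreal (C + D)"
      using m C D by (subst r_norm_le_iff) auto
    then show ?thesis using C D by simp
  qed
  show "openin (O_step_top \<omega> m n) ?W"
    unfolding O_step_top_def using complex_subspaceD(1)[OF complex_subspace_O_step_space[OF m]]
    by (intro openin_seminorm_ball[where x = 0] complex_subspace_O_step_space m sub) blast+
  have "r_norm \<omega> m n (0 :: real^'n \<Rightarrow> complex) \<le> ennreal 0"
    using m by (subst r_norm_le_iff) (auto simp: deriv_bounded_def word_deriv_zero)
  also have "ennreal 0 < ennreal \<epsilon>" using \<epsilon> by simp
  finally show "0 \<in> ?W"
    unfolding mem_Collect_eq diff_zero
        using complex_subspaceD(1)[OF complex_subspace_O_step_space[OF m]] by blast
  show "\<forall>f\<in>?W. smooth f \<and> r_bounded m n \<epsilon> f"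
  proof
    fix f assume "f \<in> ?W"
    then have "smooth f" "r_norm \<omega> m n f \<le> ennreal \<epsilon>" by (auto simp: O_step_space_def)
    then show "smooth f \<and> r_bounded m n \<epsilon> f" using m \<epsilon> by (simp add: r_norm_le_iff)
  qed
qed

text \<open>On a bounded set \<open>X\<close> of test functions, \<open>f \<mapsto> sup\<^bsub>g \<in> X\<^esub> q\<^bsub>m,n\<^esub> (f g)\<close> is a continuous
  seminorm. It is bounded on every step of a single inductive limit, whose index \<open>m'\<close> depends on \<open>m\<close>
  only.\<close>

lemma OM_neighbourhood:
  fixes X :: "(real^'n::finite \<Rightarrow> complex) set"
  assumes X: "tvs_bounded (S_top \<omega>) X" and f0: "f0 \<in> topspace (OM_top \<omega>)" and m: "1 \<le> m" and \<epsilon>: "0 < \<epsilon>"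
  shows "\<exists>U. openin (OM_top \<omega>) U \<and> f0 \<in> U \<and> (\<forall>f\<in>U. \<forall>g\<in>X. q_norm \<omega> m n ((f - f0) * g) \<le> ennreal \<epsilon>)"
proof -
  obtain D m' where D: "0 < D" "m \<le> m'" "\<And>n n' R Q f g. smooth f \<Longrightarrow> smooth g \<Longrightarrow> 0 \<le> R \<Longrightarrow> 0 \<le> Q \<Longrightarrow>
      r_bounded m' n' R f \<Longrightarrow> q_bounded m' (n + n') Q g \<Longrightarrow> q_bounded m n (D * R * Q) (f * (g :: real^'n
          \<Rightarrow> complex))"
    using q_bounded_mult[of m] by blast
  have m': "1 \<le> m'" using m D(2) by simp
  have XS: "X \<subseteq> S_space \<omega>" using X by (simp add: tvs_bounded_S_top_iff)
  have sm: "smooth (f * g)" if "smooth f" "g \<in> X" for f g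
    using that XS by (auto intro: smooth_mult S_space_smooth)
  have O_smooth: "smooth f" if "f \<in> O_union m'" for f :: "real^'n \<Rightarrow> complex"
    using that by (auto simp: O_union_def O_step_space_def)
  note sub = complex_subspaceD[OF complex_subspace_O_union[OF m', where 'n = 'n]]
  \<comment> \<open>\<open>P C f\<close> says that the seminorm of \<open>f\<close> in question is
    at most \<open>C\<close>, without forming a supremum that might be infinite.\<close>
  define P where "P C f \<longleftrightarrow> (\<forall>g\<in>X. q_bounded m n C (f * g))" for C and f :: "real^'n \<Rightarrow> complex"
  have P_mono: "P C' f" if "P C f" "C \<le> C'" for C C' f
    using that deriv_bounded_mono unfolding P_def by blast
  have P_add: "P (C + C') (f + f')" if "P C f" "P C' f'" "smooth f" "smooth f'" for C C' f f'
  proof -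
    have "(f + f') * g = f * g + f' * g" for g by (simp add: distrib_right)
    then show ?thesis using that unfolding P_def by (auto intro!: deriv_bounded_add sm)
  qed
  have P_cscale: "P (norm c * C) (cscale c f)" if "P C f" "smooth f" for c C f
  proof -
    have "cscale c f * g = cscale c (f * g)" for g by (auto simp: cscale_def)
    then show ?thesis using that unfolding P_def by (auto intro!: deriv_bounded_cscale sm)
  qed
  \<comment> \<open>The strict inequality leaves room around each point, which is what makes this
    set open.\<close>
  define U0 where "U0 = {f \<in> O_union m'. \<exists>C<\<epsilon>. P C (f - f0)}"
  have f0': "f0 \<in> O_union m'" using f0 m' unfolding topspace_OM_top by auto
  have "openin (OM_step m') U0"
    unfolding openin_ind_limit_topology
  proof (intro conjI ballI)
    show "U0 \<subseteq> (\<Union>n\<in>{1..}. topspace (O_step_top \<omega> m' n))" by (auto simp: U0_def O_union_def)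
    fix f assume "f \<in> U0"
    then obtain C where f: "f \<in> O_union m'" "C < \<epsilon>" "P C (f - f0)" by (auto simp: U0_def)
    define \<delta> where "\<delta> = (\<epsilon> - C) / 2"
    have \<delta>: "0 < \<delta>" "C + \<delta> < \<epsilon>" using f(2) by (simp_all add: \<delta>_def field_simps)
    \<comment> \<open>A sublevel set of a seminorm, hence absolutely convex. Being defined on the
      whole union, it is the same set for every step \<open>n'\<close>; only the ball found inside
      it depends on \<open>n'\<close>.\<close>
    define V where "V = {v \<in> O_union m'. P \<delta> v}"
    have "absolutely_convex V"
      unfolding absolutely_convex_def
    proof (intro ballI allI impI)
      fix x y :: "real^'n \<Rightarrow> complex" and a b :: complex
      assume xy: "x \<in> V" "y \<in> V" and ab: "norm a + norm b \<le> 1"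
      then have "P (norm a * \<delta> + norm b * \<delta>) (cscale a x + cscale b y)"
        by (intro P_add P_cscale smooth_cscale O_smooth) (auto simp: V_def)
      moreover have "norm a * \<delta> + norm b * \<delta> \<le> \<delta>"
        using ab \<delta>(1) mult_right_mono[of "norm a + norm b" 1 \<delta>] by (simp add: distrib_right)
      ultimately have "P \<delta> (cscale a x + cscale b y)" by (rule P_mono)
      then show "cscale a x + cscale b y \<in> V"
        using xy unfolding V_def by (auto intro: sub)
    qed
    moreover have "\<exists>W. openin (O_step_top \<omega> m' n') W \<and> 0 \<in> W \<and> W \<subseteq> V" if n': "n' \<in> {1..}" for n'
    proof -
      have "\<exists>Q\<ge>0. \<forall>g\<in>X. q_norm \<omega> m' (n + n') g \<le> ennreal Q"
        using X m' n' unfolding tvs_bounded_S_top_iff by auto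
      then obtain Q where Q: "0 \<le> Q" "\<And>g. g \<in> X \<Longrightarrow> q_bounded m' (n + n') Q g"
        using q_norm_le_iff[OF m'] by blast
      \<comment> \<open>Chosen so that the product estimate with \<open>Q\<close>, the bound of
        \<open>X\<close> in the norm with indices \<open>m'\<close> and \<open>n + n'\<close>, stays
        below \<open>\<delta>\<close>; the added one covers \<open>Q = 0\<close>.\<close>
      define \<eta> where "\<eta> = \<delta> / (D * (Q + 1))"
      have \<eta>: "0 < \<eta>" using \<delta> D Q by (simp add: \<eta>_def)
      have "D * \<eta> * Q = \<delta> * (Q / (Q + 1))" using D(1) Q(1) by (simp add: \<eta>_def)
      also have "\<dots> \<le> \<delta> * 1" using \<delta>(1) Q(1) by (intro mult_left_mono) auto
      finally have \<eta>2: "D * \<eta> * Q \<le> \<delta>" by simp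
      from O_step_top_ball[OF m' \<eta>, of n'] obtain W :: "(real^'n \<Rightarrow> complex) set"
        where "openin (O_step_top \<omega> m' n') W \<and> 0 \<in> W \<and> (\<forall>f\<in>W. smooth f \<and> r_bounded m' n' \<eta> f)"
        by (rule exE)
      then have W: "openin (O_step_top \<omega> m' n') W" "0 \<in> W" "\<And>f. f \<in> W \<Longrightarrow> smooth f \<and> r_bounded m' n' \<eta> f"
        by simp_all
      have "v \<in> V" if v: "v \<in> W" for v
      proof -
        have "q_bounded m n (D * \<eta> * Q) (v * g)" if g: "g \<in> X" for g
          by (rule D(3)[OF conjunct1[OF W(3)[OF v]] S_space_smooth[OF subsetD[OF XS g]]
              less_imp_le[OF \<eta>] Q(1)
              conjunct2[OF W(3)[OF v]] Q(2)[OF g]])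
        then have "P (D * \<eta> * Q) v" unfolding P_def by blast
        then have "P \<delta> v" using \<eta>2 by (rule P_mono)
        moreover have "v \<in> O_step_space \<omega> m' n'" using openin_subset[OF W(1)] v by auto
        ultimately show ?thesis using n' by (auto simp: V_def O_union_def)
      qed
      then show ?thesis using W by blast
    qed
    moreover have "f + v \<in> U0" if v: "v \<in> V" for v
    proof -
      have "P (C + \<delta>) ((f - f0) + v)"
        using v f f0' by (intro P_add O_smooth) (auto simp: V_def intro: sub)
      moreover have "(f - f0) + v = (f + v) - f0" by simp
      ultimately show ?thesis using v f(1) \<delta>(2) unfolding U0_def V_def by (auto intro: sub)
    qed
    moreover have "V \<subseteq> (\<Union>n\<in>{1..}. topspace (O_step_top \<omega> m' n))" by (auto simp: V_def O_union_def)
    ultimately show "\<exists>V. V \<subseteq> (\<Union>n\<in>{1..}. topspace (O_step_top \<omega> m' n)) \<and> absolutely_convex V \<and>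
        (\<forall>n\<in>{1..}. \<exists>W. openin (O_step_top \<omega> m' n) W \<and> 0 \<in> W \<and> W \<subseteq> V) \<and> (\<lambda>v. f + v) ` V \<subseteq> U0"
      by (intro exI[of _ V]) auto
  qed
  then have "openin (OM_top \<omega>) (U0 \<inter> topspace (OM_top \<omega>))" using m' by (rule openin_OM_top)
  moreover have "P 0 (f0 - f0)"
    unfolding P_def by (simp add: deriv_bounded_def word_deriv_zero)
  then have "f0 \<in> U0" using f0' \<epsilon> by (auto simp: U0_def)
  moreover have "q_norm \<omega> m n ((f - f0) * g) \<le> ennreal \<epsilon>" if "f \<in> U0" "g \<in> X" for f g
  proof -
    obtain C where "C < \<epsilon>" "P C (f - f0)" using \<open>f \<in> U0\<close> by (auto simp: U0_def)
    then have "P \<epsilon> (f - f0)" by (auto intro: P_mono)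
    then show ?thesis using \<open>g \<in> X\<close> m \<epsilon> by (simp add: P_def q_norm_le_iff)
  qed
  ultimately show ?thesis using f0 by (intro exI[of _ "U0 \<inter> topspace (OM_top \<omega>)"]) auto
qed

section \<open>Products of bounded sets\<close>

definition product_set :: "(real^'n::finite \<Rightarrow> complex) set \<Rightarrow> (real^'n \<Rightarrow> complex) set \<Rightarrow> (real^'n \<Rightarrow>
    complex) set" where
  "product_set A X = {f * g |f g. f \<in> A \<and> g \<in> X}"

lemma tvs_bounded_product_set:
  fixes A X :: "(real^'n::finite \<Rightarrow> complex) set"
  assumes A: "tvs_bounded (OM_top \<omega>) A" and X: "tvs_bounded (S_top \<omega>) X"
  shows "tvs_bounded (S_top \<omega>) (product_set A X)"
  unfolding tvs_bounded_S_top_iff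
proof (intro conjI allI impI)
  have AO: "A \<subseteq> topspace (OM_top \<omega>)" and XS: "X \<subseteq> S_space \<omega>"
    using A X by (auto simp: tvs_bounded_def tvs_bounded_S_top_iff)
  then show "product_set A X \<subseteq> S_space \<omega>" by (auto simp: product_set_def intro: OM_mult_S_space)
  fix m n :: nat assume m: "1 \<le> m" and "1 \<le> n"
  obtain U where U: "openin (OM_top \<omega>) U" "0 \<in> U" "\<forall>f\<in>U. \<forall>g\<in>X. q_norm \<omega> m n ((f - 0) * g) \<le> ennreal 1"
    using OM_neighbourhood[OF X complex_subspaceD(1)[OF complex_subspace_OM] m zero_less_one] by blast
  obtain \<rho> where \<rho>: "0 < \<rho>" "\<And>c. \<rho> \<le> norm c \<Longrightarrow> A \<subseteq> cscale c ` U"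
    using A U(1,2) unfolding tvs_bounded_def by blast
  have "q_norm \<omega> m n (f * g) \<le> ennreal \<rho>" if fg: "f \<in> A" "g \<in> X" for f g
  proof -
    have "f \<in> cscale (of_real \<rho>) ` U" using \<rho>(2)[of "of_real \<rho>"] \<rho>(1) fg(1) by auto
    then obtain f' where f': "f' \<in> U" "f = cscale (of_real \<rho>) f'" by blast
    have "f * g = cscale (of_real \<rho>) (f' * g)" unfolding f'(2) by (auto simp: cscale_def)
    moreover have "q_norm \<omega> m n (f' * g) \<le> ennreal 1" using U(3) f'(1) fg(2) by auto
    moreover have "f' * g \<in> S_space \<omega>"
      using openin_subset[OF U(1)] f'(1) fg(2) XS by (intro OM_mult_S_space) auto
    ultimately show ?thesis
      using q_norm_cscale[of "f' * g" m 1 n "of_real \<rho>"] m \<rho>(1) by simp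
  qed
  then show "\<exists>C\<ge>0. \<forall>h\<in>product_set A X. q_norm \<omega> m n h \<le> ennreal C"
    using \<rho>(1) by (intro exI[of _ \<rho>]) (auto simp: product_set_def)
qed

text \<open>Multiplication by the fixed \<open>f\<close> is continuous and linear on the test
  functions and therefore preserves boundedness.\<close>

lemma tvs_bounded_product_single:
  fixes f :: "real^'n::finite \<Rightarrow> complex"
  assumes f: "f \<in> topspace (OM_top \<omega>)" and X: "tvs_bounded (S_top \<omega>) X"
  shows "tvs_bounded (S_top \<omega>) (product_set {f} X)"
  unfolding tvs_bounded_S_top_iff
proof (intro conjI allI impI)
  have XS: "X \<subseteq> S_space \<omega>" using X by (simp add: tvs_bounded_S_top_iff)
  then show "product_set {f} X \<subseteq> S_space \<omega>" using f by
      (auto simp: product_set_def intro: OM_mult_S_space)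
  fix m n :: nat assume m: "1 \<le> m" and "1 \<le> n"
  obtain k D where k: "1 \<le> k" "0 < D"
    "\<forall>g\<in>S_space \<omega>. \<forall>Q\<ge>0. q_norm \<omega> k k g \<le> ennreal Q \<longrightarrow> q_norm \<omega> m n (f * g) \<le> ennreal (D * Q)"
    using OM_mult_bound[OF f m] by blast
  have "\<exists>C\<ge>0. \<forall>g\<in>X. q_norm \<omega> k k g \<le> ennreal C" using X k(1) by (simp add: tvs_bounded_S_top_iff)
  then obtain C where C: "0 \<le> C" "\<And>g. g \<in> X \<Longrightarrow> q_norm \<omega> k k g \<le> ennreal C" by blast
  have "q_norm \<omega> m n (f * g) \<le> ennreal (D * C)" if "g \<in> X" for g
    using k(3) that C XS by auto
  then show "\<exists>C\<ge>0. \<forall>h\<in>product_set {f} X. q_norm \<omega> m n h \<le> ennreal C"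
    using k(2) C(1) by (intro exI[of _ "D * C"]) (auto simp: product_set_def)
qed

section \<open>The multiplication operator on the dual\<close>

lemma mult_op_apply: "g \<in> S_space \<omega> \<Longrightarrow> mult_op \<omega> f T g = T (f * g)"
  by (simp add: mult_op_def)

text \<open>Transposition: testing \<open>mult_op \<omega> f T\<close> on \<open>X\<close> amounts
  to testing \<open>T\<close> on the products of \<open>f\<close> with \<open>X\<close>. This turns
  uniformity in \<open>f\<close> into boundedness of \<open>product_set A X\<close>.\<close>

lemma polar_norm_mult_op_le:
  assumes "f \<in> A" "X \<subseteq> S_space \<omega>"
  shows "polar_norm X (mult_op \<omega> f T) \<le> polar_norm (product_set A X) T"
  unfolding polar_norm_def
proof (rule SUP_least)
  fix g assume g: "g \<in> X"
  then have "mult_op \<omega> f T g = T (f * g)" using assms by (intro mult_op_apply) auto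
  moreover have "f * g \<in> product_set A X" using g assms(1) by (auto simp: product_set_def)
  ultimately show "ennreal (norm (mult_op \<omega> f T g)) \<le> (SUP h\<in>product_set A X. ennreal (norm (T h)))"
    by (auto intro: SUP_upper)
qed

text \<open>The continuity estimate of \<open>T\<close> is composed with that of multiplication by
  \<open>f\<close>.\<close>

lemma mult_op_dual_space:
  fixes f :: "real^'n::finite \<Rightarrow> complex"
  assumes f: "f \<in> topspace (OM_top \<omega>)" and T: "T \<in> dual_space (S_top \<omega>)"
  shows "mult_op \<omega> f T \<in> dual_space (S_top \<omega>)"
proof -
  obtain l C where l: "1 \<le> l" "0 \<le> C" "functional_bounded l C T"
    using dual_space_functional_bounded[OF T] by blast
  obtain k D where k: "1 \<le> k" "0 < D"
    "\<forall>g\<in>S_space \<omega>. \<forall>Q\<ge>0. q_norm \<omega> k k g \<le> ennreal Q \<longrightarrow> q_norm \<omega> l l (f * g) \<le> ennreal (D * Q)"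
    using OM_mult_bound[OF f l(1)] by blast
  note sub = complex_subspaceD[OF complex_subspace_S_space]
  show ?thesis
  proof (rule dual_spaceI[OF _ _ _ k(1)])
    show "0 \<le> C * D" using l k by simp
    show "functional_bounded k (C * D) (mult_op \<omega> f T)"
      unfolding functional_bounded_def
    proof (intro ballI allI impI)
      fix h :: "real^'n \<Rightarrow> complex" and R :: real
      assume h: "h \<in> S_space \<omega>" "0 < R" "q_norm \<omega> k k h \<le> ennreal R"
      then have "q_norm \<omega> l l (f * h) \<le> ennreal (D * R)" using k(3) by auto
      moreover have "f * h \<in> S_space \<omega>" using f h(1) by (rule OM_mult_S_space)
      moreover have "0 < D * R" using k(2) h(2) by simp
      ultimately have "norm (T (f * h)) \<le> C * (D * R)" using l(3) unfolding functional_bounded_def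
          by blast
      then show "norm (mult_op \<omega> f T h) \<le> C * D * R" using h(1) by (simp add: mult_op_apply mult.assoc)
    qed
  next
    fix g h :: "real^'n \<Rightarrow> complex" assume gh: "g \<in> S_space \<omega>" "h \<in> S_space \<omega>"
    have "T (f * (g + h)) = T (f * g) + T (f * h)"
      unfolding distrib_left using gh by (intro dual_spaceD[OF T] OM_mult_S_space[OF f])
    then show "mult_op \<omega> f T (g + h) = mult_op \<omega> f T g + mult_op \<omega> f T h"
      using gh by (simp only: mult_op_apply sub(2))
  next
    fix c and g :: "real^'n \<Rightarrow> complex" assume g: "g \<in> S_space \<omega>"
    have "f * cscale c g = cscale c (f * g)" by (auto simp: cscale_def)
    then have "T (f * cscale c g) = c * T (f * g)"
      using g by (simp only: dual_spaceD(3)[OF T] OM_mult_S_space[OF f])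
    then show "mult_op \<omega> f T (cscale c g) = c * mult_op \<omega> f T g"
      using g by (simp only: mult_op_apply sub(3))
  qed (simp add: mult_op_def)
qed

lemma mult_op_add_left:
  assumes f: "f \<in> topspace (OM_top \<omega>)" "f' \<in> topspace (OM_top \<omega>)" and T: "T \<in> dual_space (S_top \<omega>)"
  shows "mult_op \<omega> (f + f') T = mult_op \<omega> f T + mult_op \<omega> f' T"
proof
  fix g
  have "T ((f + f') * g) = T (f * g) + T (f' * g)" if "g \<in> S_space \<omega>"
    unfolding distrib_right using that f by (intro dual_spaceD[OF T] OM_mult_S_space)
  then show "mult_op \<omega> (f + f') T g = (mult_op \<omega> f T + mult_op \<omega> f' T) g" by (simp add: mult_op_def)
qed

lemma mult_op_cscale_left:
  assumes f: "f \<in> topspace (OM_top \<omega>)" and T: "T \<in> dual_space (S_top \<omega>)"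
  shows "mult_op \<omega> (cscale c f) T = cscale c (mult_op \<omega> f T)"
proof
  fix g
  have "T (cscale c f * g) = c * T (f * g)" if g: "g \<in> S_space \<omega>"
  proof -
    have "cscale c f * g = cscale c (f * g)" by (auto simp: cscale_def)
    then show ?thesis using dual_spaceD(3)[OF T OM_mult_S_space[OF f g]] by simp
  qed
  then show "mult_op \<omega> (cscale c f) T g = cscale c (mult_op \<omega> f T) g" by
      (simp add: mult_op_def cscale_def)
qed

lemma mult_op_add_right: "mult_op \<omega> f (T + T') = mult_op \<omega> f T + mult_op \<omega> f T'"
  by (simp add: mult_op_def fun_eq_iff)

lemma mult_op_cscale_right: "mult_op \<omega> f (cscale c T) = cscale c (mult_op \<omega> f T)"
  by (simp add: mult_op_def cscale_def fun_eq_iff)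

lemma mult_op_diff_right: "mult_op \<omega> f (T - T') = mult_op \<omega> f T - mult_op \<omega> f T'"
  by (simp add: mult_op_def fun_eq_iff)

lemma linear_mult_op_right:
  "f \<in> topspace (OM_top \<omega>) \<Longrightarrow> linear_map_on (strong_dual (S_top \<omega>)) (strong_dual (S_top \<omega>)) (mult_op \<omega> f)"
  unfolding linear_map_on_def by
      (auto simp: mult_op_add_right mult_op_cscale_right intro: mult_op_dual_space)

lemma linear_mult_op_left:
  "T \<in> dual_space (S_top \<omega>) \<Longrightarrow> linear_map_on (OM_top \<omega>) (strong_dual (S_top \<omega>)) (\<lambda>f. mult_op \<omega> f T)"
  unfolding linear_map_on_def by
      (auto simp: mult_op_add_left mult_op_cscale_left intro: mult_op_dual_space)

section \<open>Continuity and equicontinuity of multiplication\<close>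

lemma continuous_map_strong_dualI:
  assumes h: "h ` topspace E \<subseteq> dual_space (S_top \<omega>)"
    and nbhd: "\<And>x X \<epsilon>. x \<in> topspace E \<Longrightarrow> tvs_bounded (S_top \<omega> :: (real^'n::finite \<Rightarrow> complex) topology) X \<Longrightarrow>
      0 < \<epsilon> \<Longrightarrow> \<exists>U. openin E U \<and> x \<in> U \<and> (\<forall>y\<in>U. polar_norm X (h y - h x) < ennreal \<epsilon>)"
  shows "continuous_map E (strong_dual (S_top \<omega>)) h"
  unfolding continuous_map_def
proof (intro conjI allI impI)
  show "h \<in> topspace E \<rightarrow> topspace (strong_dual (S_top \<omega>))" using h by auto
  fix V :: "((real^'n \<Rightarrow> complex) \<Rightarrow> complex) set"
  assume V: "openin (strong_dual (S_top \<omega>)) V"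
  show "openin E {y \<in> topspace E. h y \<in> V}"
  proof (subst openin_subopen, intro ballI)
    fix x assume "x \<in> {y \<in> topspace E. h y \<in> V}"
    then have x: "x \<in> topspace E" "h x \<in> V" by auto
    obtain X \<epsilon> where X: "tvs_bounded (S_top \<omega>) X" "0 < \<epsilon>"
      "\<And>u. u \<in> dual_space (S_top \<omega>) \<Longrightarrow> polar_norm X (u - h x) < ennreal \<epsilon> \<Longrightarrow> u \<in> V"
      using openin_strong_dual_D[OF V x(2)] by blast
    obtain U where U: "openin E U" "x \<in> U" "\<And>y. y \<in> U \<Longrightarrow> polar_norm X (h y - h x) < ennreal \<epsilon>"
      using nbhd[OF x(1) X(1,2)] by blast
    have "U \<subseteq> {y \<in> topspace E. h y \<in> V}"
      using openin_subset[OF U(1)] X(3)[OF _ U(3)] h by blast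
    then show "\<exists>U. openin E U \<and> x \<in> U \<and> U \<subseteq> {y \<in> topspace E. h y \<in> V}" using U(1,2) by blast
  qed
qed

lemma equicontinuous_in_strong_dualI:
  assumes H: "\<And>h. h \<in> H \<Longrightarrow> linear_map_on E (strong_dual (S_top \<omega>)) h \<and>
      continuous_map E (strong_dual (S_top \<omega>)) h"
    and nbhd: "\<And>X \<epsilon>. tvs_bounded (S_top \<omega> :: (real^'n::finite \<Rightarrow> complex) topology) X \<Longrightarrow> 0 < \<epsilon> \<Longrightarrow>
      \<exists>U. openin E U \<and> 0 \<in> U \<and> (\<forall>y\<in>U. \<forall>h\<in>H. polar_norm X (h y) < ennreal \<epsilon>)"
  shows "equicontinuous_in E (strong_dual (S_top \<omega>)) H"
  unfolding equicontinuous_in_def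
proof (intro conjI allI impI)
  show "\<forall>h\<in>H. linear_map_on E (strong_dual (S_top \<omega>)) h \<and> continuous_map E (strong_dual (S_top \<omega>)) h"
    using H by blast
  fix V assume V: "openin (strong_dual (S_top \<omega>)) V \<and> (0 :: (real^'n \<Rightarrow> complex) \<Rightarrow> complex) \<in> V"
  obtain X \<epsilon> where X: "tvs_bounded (S_top \<omega>) X" "0 < \<epsilon>"
    "\<And>u. u \<in> dual_space (S_top \<omega>) \<Longrightarrow> polar_norm X (u - 0) < ennreal \<epsilon> \<Longrightarrow> u \<in> V"
    using openin_strong_dual_D[OF conjunct1[OF V] conjunct2[OF V]] by blast
  obtain U where U: "openin E U" "0 \<in> U" "\<And>y h. y \<in> U \<Longrightarrow> h \<in> H \<Longrightarrow> polar_norm X (h y) < ennreal \<epsilon>"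
    using nbhd[OF X(1,2)] by blast
  have "h y \<in> V" if "h \<in> H" "y \<in> U" for h y
  proof (rule X(3))
    show "h y \<in> dual_space (S_top \<omega>)"
      using H[OF that(1)] openin_subset[OF U(1)] that(2) by (auto simp: linear_map_on_def)
    show "polar_norm X (h y - 0) < ennreal \<epsilon>" unfolding diff_zero using that by (intro U(3))
  qed
  then show "\<exists>U. openin E U \<and> 0 \<in> U \<and> (\<forall>h\<in>H. h ` U \<subseteq> V)" using U(1,2) by blast
qed

text \<open>Uniform in \<open>f\<close>, so that it serves twice: \<open>A = {f}\<close> gives
  continuity in the second variable at any \<open>T0\<close>, and a bounded \<open>A\<close> with
  \<open>T0 = 0\<close> gives equicontinuity.\<close>

lemma mult_op_right_neighbourhood:
  fixes T0 :: "(real^'n::finite \<Rightarrow> complex) \<Rightarrow> complex"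
  assumes T0: "T0 \<in> dual_space (S_top \<omega>)" and X: "X \<subseteq> S_space \<omega>"
    and AX: "tvs_bounded (S_top \<omega>) (product_set A X)" and \<epsilon>: "0 < \<epsilon>"
  shows "\<exists>U. openin (strong_dual (S_top \<omega>)) U \<and> T0 \<in> U \<and>
    (\<forall>T\<in>U. \<forall>f\<in>A. polar_norm X (mult_op \<omega> f T - mult_op \<omega> f T0) < ennreal \<epsilon>)"
proof -
  let ?U = "{T \<in> dual_space (S_top \<omega>). polar_norm (product_set A X) (T - T0) < ennreal \<epsilon>}"
  have "openin (strong_dual (S_top \<omega>)) ?U" using T0 AX by (rule openin_strong_dual_ball)
  moreover have "polar_norm (product_set A X) (T0 - T0) \<le> ennreal 0" by (subst polar_norm_le_iff) auto
  then have "polar_norm (product_set A X) (T0 - T0) < ennreal \<epsilon>" by (rule le_less_trans) (use \<epsilon> in simp)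
  then have "T0 \<in> ?U" using T0 by blast
  moreover have "polar_norm X (mult_op \<omega> f T - mult_op \<omega> f T0) < ennreal \<epsilon>" if "T \<in> ?U" "f \<in> A" for T f
    unfolding mult_op_diff_right[symmetric]
    using polar_norm_mult_op_le[OF that(2) X, of "T - T0"] that(1) by (blast intro: le_less_trans)
  ultimately show ?thesis by blast
qed

lemma continuous_mult_op_right:
  fixes f :: "real^'n::finite \<Rightarrow> complex"
  assumes f: "f \<in> topspace (OM_top \<omega>)"
  shows "continuous_map (strong_dual (S_top \<omega>)) (strong_dual (S_top \<omega>)) (mult_op \<omega> f)"
proof (rule continuous_map_strong_dualI)
  fix T and X :: "(real^'n \<Rightarrow> complex) set" and \<epsilon> :: real
  assume "T \<in> topspace (strong_dual (S_top \<omega> :: (real^'n \<Rightarrow> complex) topology))" "tvs_bounded (S_top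
      \<omega>) X" "0 < \<epsilon>"
  then show "\<exists>U. openin (strong_dual (S_top \<omega>)) U \<and> T \<in> U \<and>
      (\<forall>T'\<in>U. polar_norm X (mult_op \<omega> f T' - mult_op \<omega> f T) < ennreal \<epsilon>)"
    using mult_op_right_neighbourhood[of T X "{f}" \<epsilon>] tvs_bounded_product_single[OF f]
    by (simp add: tvs_bounded_S_top_iff)
qed (use f in \<open>auto intro: mult_op_dual_space\<close>)

text \<open>The counterpart for the first variable, uniform over functionals with a common
  continuity estimate: \<open>B = {T}\<close> gives continuity, and a bounded \<open>B\<close> with
  \<open>f0 = 0\<close> gives equicontinuity.\<close>

lemma mult_op_left_neighbourhood:
  fixes f0 :: "real^'n::finite \<Rightarrow> complex"
  assumes f0: "f0 \<in> topspace (OM_top \<omega>)" and X: "tvs_bounded (S_top \<omega>) X" and k: "1 \<le> k" and C: "0 \<le> C"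
    and B: "B \<subseteq> dual_space (S_top \<omega>)" "\<And>T. T \<in> B \<Longrightarrow> functional_bounded k C T" and \<epsilon>: "0 < \<epsilon>"
  shows "\<exists>U. openin (OM_top \<omega>) U \<and> f0 \<in> U \<and>
    (\<forall>f\<in>U. \<forall>T\<in>B. polar_norm X (mult_op \<omega> f T - mult_op \<omega> f0 T) < ennreal \<epsilon>)"
proof -
  \<comment> \<open>The factor \<open>2\<close> yields the strict inequality with
    \<open>\<epsilon>\<close>, and the added one covers \<open>C = 0\<close>.\<close>
  define \<delta> where "\<delta> = \<epsilon> / (2 * (C + 1))"
  have \<delta>: "0 < \<delta>" using \<epsilon> C by (simp add: \<delta>_def)
  have "C * \<delta> = (\<epsilon> / 2) * (C / (C + 1))" using C by (simp add: \<delta>_def)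
  also have "\<dots> \<le> (\<epsilon> / 2) * 1" using C \<epsilon> by (intro mult_left_mono) auto
  finally have C\<delta>: "C * \<delta> \<le> \<epsilon> / 2" by simp
  have XS: "X \<subseteq> S_space \<omega>" using X by (simp add: tvs_bounded_S_top_iff)
  obtain U where U: "openin (OM_top \<omega>) U" "f0 \<in> U" "\<forall>f\<in>U. \<forall>g\<in>X. q_norm \<omega> k k ((f - f0) * g) \<le> ennreal \<delta>"
    using OM_neighbourhood[OF X f0 k \<delta>] by blast
  have "polar_norm X (mult_op \<omega> f T - mult_op \<omega> f0 T) < ennreal \<epsilon>" if f: "f \<in> U" and T: "T \<in> B" for f T
  proof -
    have fO: "f \<in> topspace (OM_top \<omega>)" using openin_subset[OF U(1)] f by auto
    have TS: "T \<in> dual_space (S_top \<omega>)" using B(1) T by auto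
    have "norm ((mult_op \<omega> f T - mult_op \<omega> f0 T) g) \<le> \<epsilon> / 2" if g: "g \<in> X" for g
    proof -
      have gS: "g \<in> S_space \<omega>" using g XS by auto
      have "(mult_op \<omega> f T - mult_op \<omega> f0 T) g = T (f * g - f0 * g)"
        using dual_spaceD(4)[OF TS OM_mult_S_space[OF fO gS] OM_mult_S_space[OF f0 gS]] gS by
            (simp add: mult_op_apply)
      also have "f * g - f0 * g = (f - f0) * g" by (simp only: left_diff_distrib)
      finally have "(mult_op \<omega> f T - mult_op \<omega> f0 T) g = T ((f - f0) * g)" .
      moreover have "(f - f0) * g \<in> S_space \<omega>"
        using complex_subspaceD(4)[OF complex_subspace_OM fO f0] gS by (rule OM_mult_S_space)
      then have "norm (T ((f - f0) * g)) \<le> C * \<delta>"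
        using B(2)[OF T] U(3) f g \<delta> unfolding functional_bounded_def by blast
      ultimately show ?thesis using C\<delta> by simp
    qed
    then have "polar_norm X (mult_op \<omega> f T - mult_op \<omega> f0 T) \<le> ennreal (\<epsilon> / 2)"
      using \<epsilon> by (subst polar_norm_le_iff) auto
    also have "\<dots> < ennreal \<epsilon>" using \<epsilon> by (intro ennreal_lessI) auto
    finally show ?thesis .
  qed
  then show ?thesis using U(1,2) by blast
qed

lemma continuous_mult_op_left:
  fixes T :: "(real^'n::finite \<Rightarrow> complex) \<Rightarrow> complex"
  assumes T: "T \<in> dual_space (S_top \<omega>)"
  shows "continuous_map (OM_top \<omega>) (strong_dual (S_top \<omega>)) (\<lambda>f. mult_op \<omega> f T)"
proof (rule continuous_map_strong_dualI)
  obtain k C where k: "1 \<le> k" "0 \<le> C" "functional_bounded k C T"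
    using dual_space_functional_bounded[OF T] by blast
  fix f :: "real^'n \<Rightarrow> complex" and X :: "(real^'n \<Rightarrow> complex) set" and \<epsilon> :: real
  assume "f \<in> topspace (OM_top \<omega>)" "tvs_bounded (S_top \<omega>) X" "0 < \<epsilon>"
  then show "\<exists>U. openin (OM_top \<omega>) U \<and> f \<in> U \<and>
      (\<forall>f'\<in>U. polar_norm X (mult_op \<omega> f' T - mult_op \<omega> f T) < ennreal \<epsilon>)"
    using mult_op_left_neighbourhood[of f X k C "{T}" \<epsilon>] k T by simp
qed (use T in \<open>auto intro: mult_op_dual_space\<close>)

lemma mult_op_zero: "T \<in> dual_space (S_top \<omega>) \<Longrightarrow> mult_op \<omega> 0 T = 0" "mult_op \<omega> f 0 = 0"
proof -
  show "mult_op \<omega> 0 T = 0" if T: "T \<in> dual_space (S_top \<omega>)"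
    using mult_op_cscale_left[OF complex_subspaceD(1)[OF complex_subspace_OM] T, of 0] by
        (simp add: cscale_0)
  show "mult_op \<omega> f 0 = 0" by (simp add: mult_op_def fun_eq_iff)
qed

lemma zero_in_dual_space: "0 \<in> dual_space (S_top \<omega> :: (real^'n::finite \<Rightarrow> complex) topology)"
  by (rule complex_subspaceD(1)[OF complex_subspace_dual_space])

lemma equicontinuous_mult_op_right:
  fixes A :: "(real^'n::finite \<Rightarrow> complex) set"
  assumes A: "tvs_bounded (OM_top \<omega>) A"
  shows "equicontinuous_in (strong_dual (S_top \<omega>)) (strong_dual (S_top \<omega>)) (mult_op \<omega> ` A)"
proof (rule equicontinuous_in_strong_dualI)
  have "A \<subseteq> topspace (OM_top \<omega>)" using A by (simp add: tvs_bounded_def)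
  then show "linear_map_on (strong_dual (S_top \<omega>)) (strong_dual (S_top \<omega>)) h \<and>
      continuous_map (strong_dual (S_top \<omega>)) (strong_dual (S_top \<omega>)) h" if "h \<in> mult_op \<omega> ` A" for h
    using that linear_mult_op_right continuous_mult_op_right by auto
  fix X :: "(real^'n \<Rightarrow> complex) set" and \<epsilon> :: real
  assume X: "tvs_bounded (S_top \<omega>) X" "0 < \<epsilon>"
  then have "X \<subseteq> S_space \<omega>" by (simp add: tvs_bounded_S_top_iff)
  from mult_op_right_neighbourhood[OF zero_in_dual_space this tvs_bounded_product_set[OF A X(1)] X(2)]
  show "\<exists>U. openin (strong_dual (S_top \<omega>)) U \<and> 0 \<in> U \<and>
      (\<forall>T\<in>U. \<forall>h\<in>mult_op \<omega> ` A. polar_norm X (h T) < ennreal \<epsilon>)"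
    unfolding mult_op_zero(2) diff_zero by blast
qed

lemma equicontinuous_mult_op_left:
  fixes B :: "((real^'n::finite \<Rightarrow> complex) \<Rightarrow> complex) set"
  assumes B: "tvs_bounded (strong_dual (S_top \<omega>)) B"
  shows "equicontinuous_in (OM_top \<omega>) (strong_dual (S_top \<omega>)) ((\<lambda>T f. mult_op \<omega> f T) ` B)"
proof (rule equicontinuous_in_strong_dualI)
  have BS: "B \<subseteq> dual_space (S_top \<omega>)" using B by (simp add: tvs_bounded_def)
  then show "linear_map_on (OM_top \<omega>) (strong_dual (S_top \<omega>)) h \<and>
      continuous_map (OM_top \<omega>) (strong_dual (S_top \<omega>)) h" if "h \<in> (\<lambda>T f. mult_op \<omega> f T) ` B" for h
    using that linear_mult_op_left continuous_mult_op_left by auto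
  \<comment> \<open>Quasi-barrelledness enters here: all functionals in the bounded set share one
    norm and one constant.\<close>
  obtain k C where k: "1 \<le> k" "0 \<le> C" "\<And>T. T \<in> B \<Longrightarrow> functional_bounded k C T"
    using tvs_bounded_dual_equicontinuous[OF B] by blast
  fix X :: "(real^'n \<Rightarrow> complex) set" and \<epsilon> :: real
  assume X: "tvs_bounded (S_top \<omega>) X" "0 < \<epsilon>"
  obtain U where U: "openin (OM_top \<omega>) U" "0 \<in> U"
      "\<forall>f\<in>U. \<forall>T\<in>B. polar_norm X (mult_op \<omega> f T - mult_op \<omega> 0 T) < ennreal \<epsilon>"
    using mult_op_left_neighbourhood[OF complex_subspaceD(1)[OF complex_subspace_OM] X(1) k(1,2) BS
        k(3) X(2)] by blast
  have "polar_norm X (mult_op \<omega> f T) < ennreal \<epsilon>" if "f \<in> U" "T \<in> B" for f T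
  proof -
    have "mult_op \<omega> f T - mult_op \<omega> 0 T = mult_op \<omega> f T"
      using mult_op_zero(1)[of T] BS that(2) by auto
    then show ?thesis using U(3) that by metis
  qed
  then show "\<exists>U. openin (OM_top \<omega>) U \<and> 0 \<in> U \<and>
      (\<forall>f\<in>U. \<forall>h\<in>(\<lambda>T f. mult_op \<omega> f T) ` B. polar_norm X (h f) < ennreal \<epsilon>)"
    using U(1,2) by blast
qed

end

theorem proposition4p3:
  fixes \<omega> :: "real \<Rightarrow> real"
    and M :: "(real^'n::finite \<Rightarrow> complex) \<Rightarrow> ((real^'n \<Rightarrow> complex) \<Rightarrow> complex) \<Rightarrow>
              (real^'n \<Rightarrow> complex) \<Rightarrow> complex"
  assumes "nonquasianalytic_weight \<omega>"
  defines "M \<equiv> mult_op \<omega>"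
  shows "bilinear_map_on (OM_top \<omega>) (strong_dual (S_top \<omega>)) (strong_dual (S_top \<omega>)) M \<and>
         separately_continuous (OM_top \<omega>) (strong_dual (S_top \<omega>)) (strong_dual (S_top \<omega>)) M \<and>
         hypocontinuous (OM_top \<omega>) (strong_dual (S_top \<omega>)) (strong_dual (S_top \<omega>)) M"
proof -
  interpret weight \<omega> using assms(1) by unfold_locales
  show ?thesis
    unfolding M_def bilinear_map_on_def separately_continuous_def hypocontinuous_def
    by (intro conjI ballI allI impI linear_mult_op_right linear_mult_op_left continuous_mult_op_right
        continuous_mult_op_left equicontinuous_mult_op_right equicontinuous_mult_op_left) simp_all
qed

end
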